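(* Let $n\ge1$, let $\Omega$ be a bounded domain with smooth boundary in the Heisenberg group $\mathbb{H}^n$, and let $0<\lambda_1\le\lambda_2\le\cdots\to+\infty$ be the eigenvalues of the problem $$(-\Delta_{\mathbb{H}^n})^2u=\lambda u\ \text{ in }\Omega,\qquad u=\frac{\partial u}{\partial\nu}=0\ \text{ on }\partial\Omega.$$ Then, for each $k\ge1$, $$\sum_{i=1}^k(\lambda_{k+1}-\lambda_i)^2\le\frac{4(n+1)}{n^2}\sum_{i=1}^k(\lambda_{k+1}-\lambda_i)\lambda_i.$$
   Context: The Heisenberg group $\mathbb{H}^n$ is $\mathbb{R}^{2n+1}$ with coordinates $(x,y,t)$, $x,y\in\mathbb{R}^n$, $t\in\mathbb{R}$, and group law $(x,y,t)(x',y',t')=\big(x+x',\,y+y',\,t+t'+\tfrac12(\langle x',y\rangle_{\mathbb{R}^n}-\langle x,y'\rangle_{\mathbb{R}^n})\big)$. For $p=1,\dots,n$ set $X_p=\frac{\partial}{\partial x_p}+\frac{y_p}{2}\frac{\partial}{\partial t}$ and $Y_p=\frac{\partial}{\partial y_p}-\frac{x_p}{2}\frac{\partial}{\partial t}$. The (real) Kohn Laplacian is $\Delta_{\mathbb{H}^n}=\sum_{p=1}^n(X_p^2+Y_p^2)$. $\nu$ denotes the outward unit normal to $\partial\Omega$. For a positive integer $l$ (here $l=2$), $S^{l,2}(\Omega)$ is the Hilbert space of functions $u\in L^2(\Omega)$ such that $X_p^du,Y_p^du\in L^2(\Omega)$ for $1\le d\le l$, $1\le p\le n$, with norm $\|u\|_{S^{l,2}}^2=\int_\Omega\big(\sum_{d=1}^l\sum_{p=1}^n(|X_p^du|^2+|Y_p^du|^2)+|u|^2\big)\,dx\,dy\,dt$,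 and $S_0^{l,2}(\Omega)$ is the closure of $C_0^\infty(\Omega)$ in it. The eigenvalues of the problem are listed with multiplicity, with corresponding eigenfunctions $u_i\in S_0^{l,2}(\Omega)$, orthonormal in $L^2(\Omega)$. *)

theory Defs
  imports "HOL-Analysis.Analysis"
begin

text \<open>
  The Heisenberg group of dimension \<open>2n+1\<close>, with \<open>n = CARD('n)\<close>; points are triples \<open>(x, y, t)\<close>.
  Lebesgue measure \<open>dx dy dt\<close> is \<^term>\<open>lebesgue\<close> on this product type.
\<close>

type_synonym 'n heis = "(real ^ 'n) \<times> (real ^ 'n) \<times> real"

definition heis_mult :: "'n::finite heis \<Rightarrow> 'n heis \<Rightarrow> 'n heis" where
  "heis_mult = (\<lambda>(x, y, t) (x', y', t'). (x + x', y + y', t + t' + (x' \<bullet> y - x \<bullet> y') / 2))"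

definition X_field :: "'n::finite \<Rightarrow> 'n heis \<Rightarrow> 'n heis" where
  "X_field p = (\<lambda>(x, y, t). (axis p 1, 0, y $ p / 2))"

definition Y_field :: "'n::finite \<Rightarrow> 'n heis \<Rightarrow> 'n heis" where
  "Y_field p = (\<lambda>(x, y, t). (0, axis p 1, - (x $ p) / 2))"

text \<open>Consistency of the sign conventions: the fields are the left-invariant ones.\<close>

lemma X_field_left_invariant:
  "((\<lambda>s. heis_mult z (s *\<^sub>R axis p 1, 0, 0)) has_vector_derivative X_field p z) (at 0)"
proof -
  obtain x y t where z: "z = (x, y, t)" by (cases z)
  have "(\<lambda>s. heis_mult z (s *\<^sub>R axis p 1, 0, 0)) = (\<lambda>s. z + s *\<^sub>R X_field p z)"
    by (auto simp: z heis_mult_def X_field_def inner_axis' fun_eq_iff)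
  then show ?thesis
    by (auto intro!: derivative_eq_intros)
qed

lemma Y_field_left_invariant:
  "((\<lambda>s. heis_mult z (0, s *\<^sub>R axis p 1, 0)) has_vector_derivative Y_field p z) (at 0)"
proof -
  obtain x y t where z: "z = (x, y, t)" by (cases z)
  have "(\<lambda>s. heis_mult z (0, s *\<^sub>R axis p 1, 0)) = (\<lambda>s. z + s *\<^sub>R Y_field p z)"
    by (auto simp: z heis_mult_def Y_field_def inner_axis fun_eq_iff)
  then show ?thesis
    by (auto intro!: derivative_eq_intros)
qed

text \<open>A vector field acting on functions as a first-order differential operator.\<close>

definition along :: "('a::real_normed_vector \<Rightarrow> 'a) \<Rightarrow> ('a \<Rightarrow> real) \<Rightarrow> 'a \<Rightarrow> real" where
  "along V f z = frechet_derivative f (at z) (V z)"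

definition kohn_laplacian :: "('n::finite heis \<Rightarrow> real) \<Rightarrow> 'n heis \<Rightarrow> real" where
  "kohn_laplacian f z = (\<Sum>p\<in>UNIV. (along (X_field p) ^^ 2) f z + (along (Y_field p) ^^ 2) f z)"

text \<open>\<open>C\<^sup>k\<close> and \<open>C\<^sup>\<infinity>\<close> functions; meant for open \<open>S\<close>.\<close>

fun Ck_on :: "nat \<Rightarrow> 'a set \<Rightarrow> ('a::euclidean_space \<Rightarrow> real) \<Rightarrow> bool" where
  "Ck_on 0 S f = continuous_on S f"
| "Ck_on (Suc k) S f = (f differentiable_on S \<and>
     (\<forall>v. Ck_on k S (\<lambda>z. frechet_derivative f (at z) v)))"

definition smooth_on :: "'a set \<Rightarrow> ('a::euclidean_space \<Rightarrow> real) \<Rightarrow> bool" where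
  "smooth_on S f \<longleftrightarrow> (\<forall>k. Ck_on k S f)"

text \<open>The boundary is locally a regular level set, with the domain on one side of it.\<close>

definition smooth_boundary :: "'a::euclidean_space set \<Rightarrow> bool" where
  "smooth_boundary \<Omega> \<longleftrightarrow>
     (\<forall>q\<in>frontier \<Omega>. \<exists>U \<rho>. open U \<and> q \<in> U \<and> smooth_on U \<rho> \<and>
        (\<forall>z\<in>U. frechet_derivative \<rho> (at z) \<noteq> (\<lambda>v. 0)) \<and>
        \<Omega> \<inter> U = {z\<in>U. \<rho> z < 0})"

definition smooth_bounded_domain :: "'a::euclidean_space set \<Rightarrow> bool" where
  "smooth_bounded_domain \<Omega> \<longleftrightarrow>
     open \<Omega> \<and> connected \<Omega> \<and> \<Omega> \<noteq> {} \<and> bounded \<Omega> \<and> smooth_boundary \<Omega>"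

definition test_functions :: "'a::euclidean_space set \<Rightarrow> ('a \<Rightarrow> real) set" where
  "test_functions \<Omega> = {\<phi>. smooth_on UNIV \<phi> \<and>
     compact (closure {z. \<phi> z \<noteq> 0}) \<and> closure {z. \<phi> z \<noteq> 0} \<subseteq> \<Omega>}"

definition L2 :: "'a::euclidean_space set \<Rightarrow> ('a \<Rightarrow> real) set" where
  "L2 \<Omega> = {u. u \<in> borel_measurable (lebesgue_on \<Omega>) \<and> integrable (lebesgue_on \<Omega>) (\<lambda>z. (u z)\<^sup>2)}"

definition L2_inner :: "'a::euclidean_space set \<Rightarrow> ('a \<Rightarrow> real) \<Rightarrow> ('a \<Rightarrow> real) \<Rightarrow> real" where
  "L2_inner \<Omega> u v = (\<integral>z. u z * v z \<partial>lebesgue_on \<Omega>)"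

text \<open>
  \<open>g = V\<^sup>d u\<close> in the sense of distributions. The formal adjoint of \<open>V\<close> is taken to be \<open>-V\<close>, which
  is correct because the definition is only used for the divergence-free fields \<^const>\<open>X_field\<close> and
  \<^const>\<open>Y_field\<close>.
\<close>

definition has_weak_deriv ::
  "'a::euclidean_space set \<Rightarrow> ('a \<Rightarrow> 'a) \<Rightarrow> nat \<Rightarrow> ('a \<Rightarrow> real) \<Rightarrow> ('a \<Rightarrow> real) \<Rightarrow> bool" where
  "has_weak_deriv \<Omega> V d u g \<longleftrightarrow>
     g \<in> L2 \<Omega> \<and> (\<forall>\<phi>\<in>test_functions \<Omega>. L2_inner \<Omega> g \<phi> = (-1) ^ d * L2_inner \<Omega> u ((along V ^^ d) \<phi>))"

text \<open>Weak derivatives are unique up to null sets, so the choice does not affect integrals.\<close>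

definition weak_deriv ::
  "'a::euclidean_space set \<Rightarrow> ('a \<Rightarrow> 'a) \<Rightarrow> nat \<Rightarrow> ('a \<Rightarrow> real) \<Rightarrow> 'a \<Rightarrow> real" where
  "weak_deriv \<Omega> V d u = (SOME g. has_weak_deriv \<Omega> V d u g)"

text \<open>The spaces \<open>S\<^sup>l\<^sup>,\<^sup>2(\<Omega>)\<close> and \<open>S\<^sub>0\<^sup>l\<^sup>,\<^sup>2(\<Omega>)\<close>, as sets of functions rather than of classes modulo null sets.\<close>

definition S_space :: "nat \<Rightarrow> 'n::finite heis set \<Rightarrow> ('n heis \<Rightarrow> real) set" where
  "S_space l \<Omega> = {u. u \<in> L2 \<Omega> \<and> (\<forall>d\<in>{1..l}. \<forall>p.
     (\<exists>g. has_weak_deriv \<Omega> (X_field p) d u g) \<and> (\<exists>g. has_weak_deriv \<Omega> (Y_field p) d u g))}"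

definition S_norm :: "nat \<Rightarrow> 'n::finite heis set \<Rightarrow> ('n heis \<Rightarrow> real) \<Rightarrow> real" where
  "S_norm l \<Omega> u = sqrt (\<integral>z. (\<Sum>d=1..l. \<Sum>p\<in>UNIV.
       (weak_deriv \<Omega> (X_field p) d u z)\<^sup>2 + (weak_deriv \<Omega> (Y_field p) d u z)\<^sup>2) + (u z)\<^sup>2
     \<partial>lebesgue_on \<Omega>)"

definition S0_space :: "nat \<Rightarrow> 'n::finite heis set \<Rightarrow> ('n heis \<Rightarrow> real) set" where
  "S0_space l \<Omega> = {u\<in>S_space l \<Omega>. \<forall>\<epsilon>>0. \<exists>\<phi>\<in>test_functions \<Omega>. S_norm l \<Omega> (\<lambda>z. u z - \<phi> z) < \<epsilon>}"

text \<open>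
  \<open>u \<noteq> 0\<close> solves \<open>(-\<Delta>)\<^sup>2 u = \<mu> u\<close> in \<open>\<Omega>\<close> in the sense of distributions (\<open>\<Delta>\<close> is formally
  self-adjoint); the boundary condition \<open>u = \<partial>u/\<partial>\<nu> = 0\<close> is expressed by membership in \<open>S\<^sub>0\<^sup>2\<^sup>,\<^sup>2(\<Omega>)\<close>.
\<close>

definition eigenfunction :: "'n::finite heis set \<Rightarrow> real \<Rightarrow> ('n heis \<Rightarrow> real) \<Rightarrow> bool" where
  "eigenfunction \<Omega> \<mu> u \<longleftrightarrow>
     u \<in> S0_space 2 \<Omega> \<and> \<not> (AE z in lebesgue_on \<Omega>. u z = 0) \<and>
     (\<forall>\<phi>\<in>test_functions \<Omega>.
        L2_inner \<Omega> u (((\<lambda>f z. - kohn_laplacian f z) ^^ 2) \<phi>) = \<mu> * L2_inner \<Omega> u \<phi>)"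

text \<open>
  \<open>lam 1 \<le> lam 2 \<le> \<dots>\<close> lists all eigenvalues with multiplicity (\<open>lam 0\<close> is irrelevant):
  there are \<open>L\<^sup>2\<close>-orthonormal eigenfunctions \<open>u i\<close> for \<open>lam i\<close> such that, for every real \<open>\<mu>\<close>, those
  with \<open>lam i = \<mu>\<close> span the eigenspace of \<open>\<mu>\<close>. The index sets below are finite because \<open>lam\<close> tends
  to infinity. No completeness of the \<open>u i\<close> in \<open>L\<^sup>2(\<Omega>)\<close> is required.
\<close>

definition eigenvalue_sequence :: "'n::finite heis set \<Rightarrow> (nat \<Rightarrow> real) \<Rightarrow> bool" where
  "eigenvalue_sequence \<Omega> lam \<longleftrightarrow>
     0 < lam 1 \<and> (\<forall>i\<ge>1. lam i \<le> lam (i + 1)) \<and> filterlim lam at_top sequentially \<and>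
     (\<exists>u. (\<forall>i\<ge>1. eigenfunction \<Omega> (lam i) (u i)) \<and>
        (\<forall>i\<ge>1. \<forall>j\<ge>1. L2_inner \<Omega> (u i) (u j) = (if i = j then 1 else 0)) \<and>
        (\<forall>\<mu> v. eigenfunction \<Omega> \<mu> v \<longrightarrow>
           (\<exists>c. AE z in lebesgue_on \<Omega>. v z = (\<Sum>i | i \<ge> 1 \<and> lam i = \<mu>. c i * u i z))))"

end

theory Submission
  imports Defs "HOL-Computational_Algebra.Polynomial"
begin

text \<open>
  Write \<open>L = -\<Delta>\<close>. For an eigenfunction \<open>u\<^sub>i\<close> and a coordinate \<open>c\<close> conjugate to a field \<open>X\<close>, the function
  \<open>c u\<^sub>i - \<Sum>\<^sub>l \<langle>c u\<^sub>i, u\<^sub>l\<rangle> u\<^sub>l\<close> is a trial function for \<open>\<lambda>\<^sub>k\<^sub>+\<^sub>1\<close>. The commutators \<open>[X, c] = 1\<close> and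
  \<open>\<langle>[L\<^sup>2, c] u, c u\<rangle> = 2 \<langle>L u, u\<rangle> + 4 \<parallel>X u\<parallel>\<^sup>2\<close> give, after summing over the \<open>2n\<close> pairs \<open>(c, X)\<close>,
  \<open>n\<^sup>2 (\<Sum> \<delta>\<^sub>i\<^sup>2)\<^sup>2 \<le> 4 (n + 1) (\<Sum> \<delta>\<^sub>i\<^sup>2 \<langle>L u\<^sub>i, u\<^sub>i\<rangle>) (\<Sum> \<delta>\<^sub>i \<langle>L u\<^sub>i, u\<^sub>i\<rangle>)\<close> with
  \<open>\<delta>\<^sub>i = \<lambda>\<^sub>k\<^sub>+\<^sub>1 - \<lambda>\<^sub>i\<close>; the claim follows from \<open>\<langle>L u\<^sub>i, u\<^sub>i\<rangle> \<le> \<lambda>\<^sub>i\<^sup>1\<^sup>/\<^sup>2\<close> and Chebyshev's sum inequality.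

  Completeness of the eigenfunctions is not assumed, so the variational characterization of \<open>\<lambda>\<^sub>k\<^sub>+\<^sub>1\<close>
  is proved by the direct method: a Rayleigh quotient below \<open>\<lambda>\<^sub>k\<^sub>+\<^sub>1\<close> would yield a minimizer, which is an
  eigenfunction missing from the list. This needs that \<open>\<parallel>L u\<parallel>\<close> controls all \<open>X\<^sub>j\<^sup>2 u\<close> (so that the
  minimizer lies in \<open>S\<^sub>0\<^sup>2\<^sup>,\<^sup>2\<close>) and a compactness estimate. Both follow from
  \<open>\<parallel>\<partial>\<^sub>t u\<parallel> \<le> C (\<parallel>L u\<parallel> + \<parallel>u\<parallel>)\<close>, proved without Fourier analysis: vertical translations are
  commutators of horizontal flows, whence \<open>\<parallel>u(\<cdot> + s e\<^sub>t) - u\<parallel>\<^sup>2 \<le> 8 s \<langle>L u, u\<rangle>\<close>, and this is applied to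
  dyadic vertical differences of \<open>u\<close>, which are summed by almost orthogonality.
\<close>

subsection \<open>The Hilbert space of square integrable functions\<close>

text \<open>The norm of \<open>S0_space\<close> sees only the pure powers \<open>X_j u\<close> and
  \<open>X_j^2 u\<close>, so \<open>norm (L u)\<close> has to control each \<open>X_j^2 u\<close>
  separately. Expanding \<open>norm (L u)^2\<close> and commuting the fields turns the cross terms
  into squares of mixed derivatives, except for \<open>- 2 n * norm (d_t u)^2\<close>. This negative
  term is the obstacle. A commutator of horizontal flows yields half a derivative in
  \<open>t\<close>; used twice at a single scale, it gives
  \<open>norm (D_s D_s u) \<le> 8 s * norm (L u)\<close> for the vertical difference
  \<open>D_s\<close>, which just misses a full first derivative. Summation over dyadic scales
  recovers the endpoint. An element of \<open>S0_space\<close> is handled through its jet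
  \<open>(u, X_j u, X_j^2 u)\<close> in a product of complete spaces. Identities for test functions
  are closed conditions on jets, so they pass to the limit. The constant arises by summing
  \<open>2 <L u, u> + 4 norm (X u)^2\<close> over the 2n fields, which gives
  \<open>4 (n + 1) <L u, u>\<close>; the left side is multiplied by \<open>2 n\<close>, and the free
  parameter of a Young inequality is then optimised.\<close>

definition sq_integrable :: "('a::euclidean_space \<Rightarrow> real) \<Rightarrow> bool" where
  "sq_integrable f \<longleftrightarrow> f \<in> borel_measurable lebesgue \<and> integrable lebesgue (\<lambda>z. (f z)\<^sup>2)"

lemma sq_integrable_mult:
  assumes "sq_integrable f" "sq_integrable g"
  shows "integrable lebesgue (\<lambda>z. f z * g z)"
proof (rule Bochner_Integration.integrable_bound)
  show "integrable lebesgue (\<lambda>z. (f z)\<^sup>2 + (g z)\<^sup>2)"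
    using assms by (auto simp: sq_integrable_def)
  show "(\<lambda>z. f z * g z) \<in> borel_measurable lebesgue"
    using assms by (auto simp: sq_integrable_def)
  have "norm (f z * g z) \<le> norm ((f z)\<^sup>2 + (g z)\<^sup>2)" for z
  proof -
    have "2 * \<bar>f z\<bar> * \<bar>g z\<bar> \<le> (f z)\<^sup>2 + (g z)\<^sup>2"
      using sum_squares_bound[of "\<bar>f z\<bar>" "\<bar>g z\<bar>"] by simp
    moreover have "0 \<le> \<bar>f z\<bar> * \<bar>g z\<bar>" by simp
    ultimately show ?thesis unfolding real_norm_def abs_mult by linarith
  qed
  then show "AE z in lebesgue. norm (f z * g z) \<le> norm ((f z)\<^sup>2 + (g z)\<^sup>2)" by simp
qed

lemma sq_integrable_zero: "sq_integrable (\<lambda>z. 0)"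
  by (simp add: sq_integrable_def)

lemma sq_integrable_add:
  assumes "sq_integrable f" "sq_integrable g"
  shows "sq_integrable (\<lambda>z. f z + g z)"
proof -
  have "integrable lebesgue (\<lambda>z. (f z)\<^sup>2 + (g z)\<^sup>2 + 2 * (f z * g z))"
    using assms sq_integrable_mult[OF assms] by (auto simp: sq_integrable_def)
  moreover have "(\<lambda>z. f z + g z) \<in> borel_measurable lebesgue"
    using assms by (intro borel_measurable_add) (auto simp: sq_integrable_def)
  ultimately show ?thesis
    by (simp add: sq_integrable_def power2_sum mult.assoc)
qed

lemma sq_integrable_scale:
  assumes "sq_integrable f" shows "sq_integrable (\<lambda>z. c * f z)"
  using assms by (auto simp: sq_integrable_def power_mult_distrib)

lemma sq_integrable_uminus:
  assumes "sq_integrable f" shows "sq_integrable (\<lambda>z. - f z)"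
  using assms by (auto simp: sq_integrable_def)

lemma sq_integrable_diff:
  assumes "sq_integrable f" "sq_integrable g"
  shows "sq_integrable (\<lambda>z. f z - g z)"
  using sq_integrable_add[OF assms(1) sq_integrable_uminus[OF assms(2)]] by simp

lemma sq_integrable_bounded_mult:
  assumes h: "h \<in> borel_measurable lebesgue" "\<And>z. \<bar>h z\<bar> \<le> B" and f: "sq_integrable f"
  shows "sq_integrable (\<lambda>z. h z * f z)"
proof -
  have [measurable]: "h \<in> borel_measurable lebesgue" "f \<in> borel_measurable lebesgue"
    using h f by (auto simp: sq_integrable_def)
  have "integrable lebesgue (\<lambda>z. (h z * f z)\<^sup>2)"
  proof (rule Bochner_Integration.integrable_bound)
    show "integrable lebesgue (\<lambda>z. B\<^sup>2 * (f z)\<^sup>2)"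
      using f by (auto simp: sq_integrable_def)
    have "\<bar>h z\<bar>\<^sup>2 \<le> B\<^sup>2" for z
      using h(2) by (intro power_mono) auto
    then show "AE z in lebesgue. norm ((h z * f z)\<^sup>2) \<le> norm (B\<^sup>2 * (f z)\<^sup>2)"
      by (auto simp: power_mult_distrib intro!: mult_right_mono)
  qed measurable
  then show ?thesis by (simp add: sq_integrable_def)
qed

\<comment> \<open>The quotient is partial: only square integrable functions represent a class.
  Classes modulo null sets form an instance of the Banach and inner product type classes, which
  gives access to closures, limits and bounded linear maps. All classes live on the whole space;
  functions on \<open>\<Omega>\<close> enter through extension by zero.\<close>
quotient_type (overloaded) 'a l2 = "'a::euclidean_space \<Rightarrow> real" /
  partial: "\<lambda>f g. sq_integrable f \<and> sq_integrable g \<and> (AE z in lebesgue. f z = g z)"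
proof (rule part_equivpI)
  show "\<exists>x::'a \<Rightarrow> real. sq_integrable x \<and> sq_integrable x \<and> (AE z in lebesgue. x z = x z)"
    using sq_integrable_zero by auto
  show "symp (\<lambda>f g::'a \<Rightarrow> real. sq_integrable f \<and> sq_integrable g \<and> (AE z in lebesgue. f z = g z))"
    by (auto intro!: sympI)
  show "transp (\<lambda>f g::'a \<Rightarrow> real. sq_integrable f \<and> sq_integrable g \<and> (AE z in lebesgue. f z = g z))"
    by (rule transpI) (auto elim: AE_mp)
qed

instantiation l2 :: (euclidean_space) real_inner
begin

lift_definition zero_l2 :: "'a l2" is "\<lambda>z. 0"
  by (simp add: sq_integrable_zero)

lift_definition plus_l2 :: "'a l2 \<Rightarrow> 'a l2 \<Rightarrow> 'a l2" is "\<lambda>f g z. f z + g z"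
  by (auto intro!: sq_integrable_add elim!: AE_mp)

lift_definition minus_l2 :: "'a l2 \<Rightarrow> 'a l2 \<Rightarrow> 'a l2" is "\<lambda>f g z. f z - g z"
  by (auto intro!: sq_integrable_diff elim!: AE_mp)

lift_definition uminus_l2 :: "'a l2 \<Rightarrow> 'a l2" is "\<lambda>f z. - f z"
  by (auto intro!: sq_integrable_uminus elim!: AE_mp)

lift_definition scaleR_l2 :: "real \<Rightarrow> 'a l2 \<Rightarrow> 'a l2" is "\<lambda>c f z. c * f z"
  by (auto intro!: sq_integrable_scale elim!: AE_mp)

lift_definition inner_l2 :: "'a l2 \<Rightarrow> 'a l2 \<Rightarrow> real" is "\<lambda>f g. \<integral>z. f z * g z \<partial>lebesgue"
proof -
  fix f1 f2 g1 g2 :: "'a \<Rightarrow> real"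
  assume a: "sq_integrable f1 \<and> sq_integrable f2 \<and> (AE z in lebesgue. f1 z = f2 z)"
    and b: "sq_integrable g1 \<and> sq_integrable g2 \<and> (AE z in lebesgue. g1 z = g2 z)"
  have [measurable]: "f1 \<in> borel_measurable lebesgue" "f2 \<in> borel_measurable lebesgue"
    "g1 \<in> borel_measurable lebesgue" "g2 \<in> borel_measurable lebesgue"
    using a b by (auto simp: sq_integrable_def)
  show "(\<integral>z. f1 z * g1 z \<partial>lebesgue) = (\<integral>z. f2 z * g2 z \<partial>lebesgue)"
    using a b by (intro integral_cong_AE) (auto elim!: AE_mp)
qed

definition norm_l2 :: "'a l2 \<Rightarrow> real" where "norm_l2 x = sqrt (inner x x)"
definition sgn_l2 :: "'a l2 \<Rightarrow> 'a l2" where "sgn_l2 x = scaleR (inverse (norm x)) x"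
definition dist_l2 :: "'a l2 \<Rightarrow> 'a l2 \<Rightarrow> real" where "dist_l2 x y = norm (x - y)"
definition uniformity_l2 :: "('a l2 \<times> 'a l2) filter" where
  "uniformity_l2 = (INF e\<in>{0<..}. principal {(x, y). dist x y < e})"
definition open_l2 :: "'a l2 set \<Rightarrow> bool" where
  "open_l2 U \<longleftrightarrow> (\<forall>x\<in>U. eventually (\<lambda>(x', y). x' = x \<longrightarrow> y \<in> U) uniformity)"

instance
proof
  fix a b c :: "'a l2" and r s :: real
  show "a + b + c = a + (b + c)"
    by transfer (simp add: sq_integrable_add add.assoc)
  show "a + b = b + a"
    by transfer (simp add: sq_integrable_add add.commute)
  show "0 + a = a"
    by transfer simp
  show "- a + a = 0"
    by transfer (simp add: sq_integrable_zero)
  show "a - b = a + - b"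
    by transfer (simp add: sq_integrable_diff)
  show "r *\<^sub>R (a + b) = r *\<^sub>R a + r *\<^sub>R b"
    by transfer (simp add: sq_integrable_add sq_integrable_scale distrib_left)
  show "(r + s) *\<^sub>R a = r *\<^sub>R a + s *\<^sub>R a"
    by transfer (simp add: sq_integrable_add sq_integrable_scale distrib_right)
  show "r *\<^sub>R s *\<^sub>R a = (r * s) *\<^sub>R a"
    by transfer (simp add: sq_integrable_scale mult.assoc)
  show "1 *\<^sub>R a = a"
    by transfer simp
  show "dist a b = norm (a - b)" by (rule dist_l2_def)
  show "sgn a = scaleR (inverse (norm a)) a" by (rule sgn_l2_def)
  show "uniformity = (INF e\<in>{0<..}. principal {(x::'a l2, y). dist x y < e})"
    by (rule uniformity_l2_def)
  show "open U = (\<forall>x\<in>U. \<forall>\<^sub>F (x', y) in uniformity. x' = x \<longrightarrow> y \<in> U)" for U :: "'a l2 set"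
    by (rule open_l2_def)
  show "inner a b = inner b a"
    by transfer (simp add: mult.commute)
  show "inner (a + b) c = inner a c + inner b c"
    by transfer (simp add: distrib_right sq_integrable_mult)
  show "inner (r *\<^sub>R a) b = r * inner a b"
    by transfer (simp add: mult.assoc)
  show "0 \<le> inner a a"
    by transfer simp
  show "inner a a = 0 \<longleftrightarrow> a = 0"
  proof transfer
    fix f :: "'a \<Rightarrow> real"
    assume f: "sq_integrable f \<and> sq_integrable f \<and> (AE z in lebesgue. f z = f z)"
    have "(\<integral>z. f z * f z \<partial>lebesgue) = 0 \<longleftrightarrow> (AE z in lebesgue. f z * f z = 0)"
      using f by (intro integral_nonneg_eq_0_iff_AE sq_integrable_mult) auto
    then show "(\<integral>z. f z * f z \<partial>lebesgue) = 0 \<longleftrightarrow>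
        sq_integrable f \<and> sq_integrable (\<lambda>z. 0::real) \<and> (AE z in lebesgue. f z = 0)"
      using f by (simp add: sq_integrable_zero)
  qed
  show "norm a = sqrt (inner a a)" by (rule norm_l2_def)
qed

end

text \<open>The class of \<open>f\<close>; junk for functions that are not square integrable.\<close>

definition to_l2 :: "('a::euclidean_space \<Rightarrow> real) \<Rightarrow> 'a l2" where
  "to_l2 f = abs_l2 f"

lemma to_l2_cases: obtains f where "sq_integrable f" "x = to_l2 f"
  using l2.abs_induct[of "\<lambda>y. y = x \<longrightarrow> thesis" x] unfolding to_l2_def by auto

lemma to_l2_eq_iff:
  "sq_integrable f \<Longrightarrow> sq_integrable g \<Longrightarrow> to_l2 f = to_l2 g \<longleftrightarrow> (AE z in lebesgue. f z = g z)"
  unfolding to_l2_def using Quotient_l2 by (auto simp: Quotient_def)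

lemma to_l2_add: "sq_integrable f \<Longrightarrow> sq_integrable g \<Longrightarrow> to_l2 (\<lambda>z. f z + g z) = to_l2 f + to_l2 g"
  unfolding to_l2_def by (simp add: plus_l2.abs_eq)

lemma to_l2_diff: "sq_integrable f \<Longrightarrow> sq_integrable g \<Longrightarrow> to_l2 (\<lambda>z. f z - g z) = to_l2 f - to_l2 g"
  unfolding to_l2_def by (simp add: minus_l2.abs_eq)

lemma to_l2_uminus: "sq_integrable f \<Longrightarrow> to_l2 (\<lambda>z. - f z) = - to_l2 f"
  unfolding to_l2_def by (simp add: uminus_l2.abs_eq)

lemma to_l2_scale: "sq_integrable f \<Longrightarrow> to_l2 (\<lambda>z. c * f z) = c *\<^sub>R to_l2 f"
  unfolding to_l2_def by (simp add: scaleR_l2.abs_eq)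

lemma to_l2_zero: "to_l2 (\<lambda>z. 0) = 0"
  unfolding to_l2_def zero_l2_def ..

lemma inner_to_l2:
  "sq_integrable f \<Longrightarrow> sq_integrable g \<Longrightarrow> inner (to_l2 f) (to_l2 g) = (\<integral>z. f z * g z \<partial>lebesgue)"
  unfolding to_l2_def by (simp add: inner_l2.abs_eq)

lemma norm_to_l2_sq:
  "sq_integrable f \<Longrightarrow> (norm (to_l2 f))\<^sup>2 = (\<integral>z. (f z)\<^sup>2 \<partial>lebesgue)"
  by (simp add: power2_norm_eq_inner inner_to_l2) (simp add: power2_eq_square)


text \<open>Riesz--Fischer: the weights \<open>2^m\<close> make a sufficiently fast Cauchy subsequence converge almost
  everywhere, and Fatou's lemma identifies the limit.\<close>

lemma l2_Cauchy_convergent: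
  fixes X :: "nat \<Rightarrow> 'a::euclidean_space l2"
  assumes "Cauchy X"
  shows "convergent X"
proof -
  have "\<forall>m. \<exists>N. \<forall>p\<ge>N. \<forall>q\<ge>N. norm (X p - X q) < (1/2)^m"
    using assms unfolding Cauchy_def dist_norm by simp
  then obtain N where N: "\<And>m p q. p \<ge> N m \<Longrightarrow> q \<ge> N m \<Longrightarrow> norm (X p - X q) < (1/2)^m"
    by metis
  \<comment> \<open>Partial sums of \<open>Suc (N i)\<close> make \<open>r\<close> strictly
    increasing and keep \<open>r l\<close> above \<open>N m\<close> whenever
    \<open>m \<le> l\<close>.\<close>
  define r where "r m = (\<Sum>i\<le>m. Suc (N i))" for m
  have r_mono: "strict_mono r"
    unfolding strict_mono_Suc_iff r_def by simp
  have rN: "r l \<ge> N m" if "m \<le> l" for l m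
  proof -
    have "Suc (N m) \<le> r l" unfolding r_def
      using that by (intro member_le_sum) auto
    then show ?thesis by simp
  qed
  have "\<forall>m. \<exists>f. sq_integrable f \<and> X (r m) = to_l2 f"
    by (metis to_l2_cases)
  then obtain f where f: "\<And>m. sq_integrable (f m)" "\<And>m. X (r m) = to_l2 (f m)"
    by metis
  have [measurable]: "f m \<in> borel_measurable lebesgue" for m
    using f(1) by (simp add: sq_integrable_def)
  have quarter: "((1/2::real)^m)\<^sup>2 = (1/4)^m" for m
    unfolding power2_eq_square power_mult_distrib[symmetric] by simp
  have close: "(\<integral>z. (f l z - f m z)\<^sup>2 \<partial>lebesgue) \<le> (1/4)^m" if "m \<le> l" for l m
  proof -
    have "norm (X (r l) - X (r m)) < (1/2)^m"
      using that by (intro N rN) auto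
    then have "(norm (X (r l) - X (r m)))\<^sup>2 \<le> ((1/2)^m)\<^sup>2"
      by (intro power_mono) auto
    then show ?thesis
      unfolding quarter f(2) to_l2_diff[OF f(1) f(1), symmetric]
        norm_to_l2_sq[OF sq_integrable_diff[OF f(1) f(1)]] .
  qed
  have int: "integrable lebesgue (\<lambda>z. (f l z - f m z)\<^sup>2)" for l m
    using sq_integrable_diff[OF f(1) f(1), of l m] by (simp add: sq_integrable_def)
  define d where "d m z = f (Suc m) z - f m z" for m z
  have [measurable]: "d m \<in> borel_measurable lebesgue" for m
    unfolding d_def[abs_def] by measurable
  have "(\<integral>\<^sup>+z. (\<Sum>m. ennreal (2^m * (d m z)\<^sup>2)) \<partial>lebesgue)
      = (\<Sum>m. \<integral>\<^sup>+z. ennreal (2^m * (d m z)\<^sup>2) \<partial>lebesgue)"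
    by (rule nn_integral_suminf) measurable
  also have "\<dots> \<le> (\<Sum>m. ennreal ((1/2)^m))"
  proof (rule suminf_le)
    fix m
    have "(\<integral>\<^sup>+z. ennreal (2^m * (d m z)\<^sup>2) \<partial>lebesgue) = ennreal (\<integral>z. 2^m * (d m z)\<^sup>2 \<partial>lebesgue)"
      unfolding d_def using int by (intro nn_integral_eq_integral) auto
    also have "(\<integral>z. 2^m * (d m z)\<^sup>2 \<partial>lebesgue) = 2^m * (\<integral>z. (d m z)\<^sup>2 \<partial>lebesgue)" by simp
    also have "\<dots> \<le> 2^m * (1/4)^m"
      unfolding d_def using close[of m "Suc m"] by (intro mult_left_mono) auto
    also have "(2::real)^m * (1/4)^m = (1/2)^m" unfolding power_mult_distrib[symmetric] by simp
    finally show "(\<integral>\<^sup>+z. ennreal (2^m * (d m z)\<^sup>2) \<partial>lebesgue) \<le> ennreal ((1/2)^m)"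
      by (simp add: ennreal_leI)
  qed auto
  also have "\<dots> < top"
    using summable_geometric[of "1/2::real"]
    by (subst suminf_ennreal2) auto
  finally have "(\<integral>\<^sup>+z. (\<Sum>m. ennreal (2^m * (d m z)\<^sup>2)) \<partial>lebesgue) \<noteq> \<infinity>" by simp
  then have "AE z in lebesgue. (\<Sum>m. ennreal (2^m * (d m z)\<^sup>2)) \<noteq> \<infinity>"
    by (intro nn_integral_PInf_AE) auto
  then have conv: "AE z in lebesgue. convergent (\<lambda>m. f m z)"
  proof eventually_elim
    case (elim z)
    have s: "summable (\<lambda>m. 2^m * (d m z)\<^sup>2)"
      using elim by (intro summable_suminf_not_top) auto
    \<comment> \<open>Expanding \<open>2^m * (\<bar>d m z\<bar> - (1/2)^m)^2 \<ge> 0\<close> turns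
      summability of the weighted squares into absolute summability of the increments, so that
      \<open>f m z\<close> converges by telescoping.\<close>
    have "\<bar>d m z\<bar> \<le> 2^m * (d m z)\<^sup>2 + (1/2)^m" for m
    proof -
      have *: "p * (\<bar>y\<bar> - q)\<^sup>2 = p * y\<^sup>2 - 2 * \<bar>y\<bar> * (p * q) + (p * q) * q" for p q y :: real
        by (simp add: power2_diff algebra_simps power2_eq_square)
      have pq: "(2::real)^m * (1/2)^m = 1"
        unfolding power_mult_distrib[symmetric] by simp
      have "0 \<le> 2^m * (\<bar>d m z\<bar> - (1/2)^m)\<^sup>2" by simp
      then have "2 * \<bar>d m z\<bar> \<le> 2^m * (d m z)\<^sup>2 + (1/2)^m"
        unfolding * pq by simp
      moreover have "0 \<le> \<bar>d m z\<bar>" by simp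
      ultimately show ?thesis by linarith
    qed
    moreover have "summable (\<lambda>m. 2^m * (d m z)\<^sup>2 + (1/2)^m)"
      using s by (intro summable_add summable_geometric) auto
    ultimately have "summable (\<lambda>m. d m z)"
      using summable_comparison_test'[of "\<lambda>m. 2^m * (d m z)\<^sup>2 + (1/2)^m" 0 "\<lambda>m. d m z"]
      unfolding real_norm_def by blast
    then have "convergent (\<lambda>n. \<Sum>m<n. d m z)"
      unfolding summable_iff_convergent .
    then have "convergent (\<lambda>n. f n z - f 0 z)"
      unfolding d_def sum_lessThan_telescope[of "\<lambda>m. f m z"] .
    then show ?case
      by (simp add: convergent_diff_const_right_iff)
  qed
  define F where "F z = lim (\<lambda>m. f m z)" for z
  have [measurable]: "F \<in> borel_measurable lebesgue"
    unfolding F_def[abs_def] by (rule borel_measurable_lim_metric) measurable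
  have Fclose: "sq_integrable (\<lambda>z. F z - f m z) \<and> (\<integral>z. (F z - f m z)\<^sup>2 \<partial>lebesgue) \<le> (1/4)^m" for m
  proof -
    have "(\<integral>\<^sup>+z. ennreal ((F z - f m z)\<^sup>2) \<partial>lebesgue)
        = (\<integral>\<^sup>+z. liminf (\<lambda>l. ennreal ((f l z - f m z)\<^sup>2)) \<partial>lebesgue)"
    proof (rule nn_integral_cong_AE, use conv in eventually_elim)
      case (elim z)
      then have "(\<lambda>l. f l z) \<longlonglongrightarrow> F z"
        unfolding F_def by (rule convergent_LIMSEQ_iff[THEN iffD1])
      then have "(\<lambda>l. ennreal ((f l z - f m z)\<^sup>2)) \<longlonglongrightarrow> ennreal ((F z - f m z)\<^sup>2)"
        by (intro tendsto_intros)
      then show ?case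
        by (rule lim_imp_Liminf[OF sequentially_bot, symmetric])
    qed
    also have "\<dots> \<le> liminf (\<lambda>l. \<integral>\<^sup>+z. ennreal ((f l z - f m z)\<^sup>2) \<partial>lebesgue)"
      by (rule nn_integral_liminf) measurable
    also have "\<dots> \<le> liminf (\<lambda>l. ennreal ((1/4)^m))"
    proof (rule Liminf_mono, rule eventually_sequentiallyI)
      fix l assume "m \<le> l"
      show "(\<integral>\<^sup>+z. ennreal ((f l z - f m z)\<^sup>2) \<partial>lebesgue) \<le> ennreal ((1/4)^m)"
        using close[OF \<open>m \<le> l\<close>] int by (subst nn_integral_eq_integral) (auto intro: ennreal_leI)
    qed
    also have "\<dots> = ennreal ((1/4)^m)" by (simp add: Liminf_const)
    finally have le: "(\<integral>\<^sup>+z. ennreal ((F z - f m z)\<^sup>2) \<partial>lebesgue) \<le> ennreal ((1/4)^m)" .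
    have i: "integrable lebesgue (\<lambda>z. (F z - f m z)\<^sup>2)"
      using le by (intro integrableI_bounded) (auto intro: order.strict_trans1)
    have "ennreal (\<integral>z. (F z - f m z)\<^sup>2 \<partial>lebesgue) \<le> ennreal ((1/4)^m)"
      using le i by (subst nn_integral_eq_integral[symmetric]) auto
    then show ?thesis using i by (auto simp: sq_integrable_def)
  qed
  have "sq_integrable F"
    using sq_integrable_add[OF conjunct1[OF Fclose[of 0]] f(1)[of 0]] by simp
  have "norm (X (r m) - to_l2 F) \<le> (1/2)^m" for m
  proof -
    have "(norm (to_l2 F - X (r m)))\<^sup>2 \<le> ((1/2)^m)\<^sup>2"
      using Fclose[of m]
      unfolding quarter f(2) to_l2_diff[OF \<open>sq_integrable F\<close> f(1), symmetric]
        norm_to_l2_sq[OF sq_integrable_diff[OF \<open>sq_integrable F\<close> f(1)]] by simp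
    then show ?thesis
      by (subst norm_minus_commute) (rule power2_le_imp_le, auto)
  qed
  then have "(\<lambda>m. X (r m) - to_l2 F) \<longlonglongrightarrow> 0"
    by (intro Lim_null_comparison[OF always_eventually LIMSEQ_realpow_zero[of "1/2"]]) auto
  then have "(X \<circ> r) \<longlonglongrightarrow> to_l2 F"
    by (simp add: o_def Lim_null[symmetric])
  then show ?thesis
    using Cauchy_converges_subseq[OF assms r_mono] by (auto simp: convergent_def)
qed

instance l2 :: (euclidean_space) banach
  by standard (rule l2_Cauchy_convergent)

text \<open>The guard replaces a multiplier that is unbounded or not measurable by 0, so that the
  operation preserves square integrability for every \<open>h\<close> and descends to
  classes.\<close>

lift_definition l2_mult :: "('a::euclidean_space \<Rightarrow> real) \<Rightarrow> 'a l2 \<Rightarrow> 'a l2" is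
  "\<lambda>h f z. (if h \<in> borel_measurable lebesgue \<and> bounded (range h) then h z else 0) * f z"
proof -
  fix h f g :: "'a \<Rightarrow> real"
  assume fg: "sq_integrable f \<and> sq_integrable g \<and> (AE z in lebesgue. f z = g z)"
  let ?h = "\<lambda>z. if h \<in> borel_measurable lebesgue \<and> bounded (range h) then h z else 0"
  obtain B where "\<And>z. \<bar>?h z\<bar> \<le> B"
  proof (cases "bounded (range h)")
    case True
    then obtain B where B: "\<bar>h z\<bar> \<le> B" for z by (auto simp: bounded_iff)
    then have "\<bar>?h z\<bar> \<le> max B 0" for z using B[of z] by (auto simp: le_max_iff_disj)
    then show thesis by (rule that)
  next
    case False
    then show thesis by (intro that[of 0]) auto
  qed
  moreover have "?h \<in> borel_measurable lebesgue"
    by (cases "h \<in> borel_measurable lebesgue"; cases "bounded (range h)"; simp)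
  ultimately show "sq_integrable (\<lambda>z. ?h z * f z) \<and> sq_integrable (\<lambda>z. ?h z * g z) \<and>
      (AE z in lebesgue. ?h z * f z = ?h z * g z)"
    using fg sq_integrable_bounded_mult[of ?h B f] sq_integrable_bounded_mult[of ?h B g]
    by (auto elim!: AE_mp)
qed

lemma l2_mult_to_l2:
  assumes "h \<in> borel_measurable lebesgue" "\<And>z. \<bar>h z\<bar> \<le> B" "sq_integrable f"
  shows "l2_mult h (to_l2 f) = to_l2 (\<lambda>z. h z * f z)"
proof -
  have "bounded (range h)" using assms(2) by (auto simp: bounded_iff)
  then show ?thesis
    using assms unfolding to_l2_def by (simp add: l2_mult.abs_eq)
qed

lemma bounded_linear_l2_mult:
  fixes h :: "'a::euclidean_space \<Rightarrow> real"
  assumes h: "h \<in> borel_measurable lebesgue" "\<And>z. \<bar>h z\<bar> \<le> B"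
  shows "bounded_linear (l2_mult h)"
proof (rule bounded_linear_intro)
  fix x y :: "'a l2" and r :: real
  obtain f where f: "sq_integrable f" "x = to_l2 f" by (rule to_l2_cases)
  obtain g where g: "sq_integrable g" "y = to_l2 g" by (rule to_l2_cases)
  note m = sq_integrable_bounded_mult[OF h]
  note e = l2_mult_to_l2[OF h]
  show "l2_mult h (x + y) = l2_mult h x + l2_mult h y"
    by (simp add: f g e m sq_integrable_add distrib_left flip: to_l2_add)
  show "l2_mult h (r *\<^sub>R x) = r *\<^sub>R l2_mult h x"
    by (simp add: f g e m sq_integrable_scale mult.left_commute flip: to_l2_scale)
  have "B \<ge> 0" using h(2)[of undefined] by linarith
  have "(norm (l2_mult h x))\<^sup>2 \<le> (norm x * B)\<^sup>2"
  proof -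
    have "(\<integral>z. (h z * f z)\<^sup>2 \<partial>lebesgue) \<le> (\<integral>z. B\<^sup>2 * (f z)\<^sup>2 \<partial>lebesgue)"
    proof (rule integral_mono)
      show "integrable lebesgue (\<lambda>z. (h z * f z)\<^sup>2)" "integrable lebesgue (\<lambda>z. B\<^sup>2 * (f z)\<^sup>2)"
        using m[OF f(1)] f(1) by (auto simp: sq_integrable_def)
      show "(h z * f z)\<^sup>2 \<le> B\<^sup>2 * (f z)\<^sup>2" for z
        using power_mono[OF h(2)[of z] abs_ge_zero, of 2]
        by (auto simp: power_mult_distrib intro!: mult_right_mono)
    qed
    then show ?thesis
      unfolding f(2) e[OF f(1)] norm_to_l2_sq[OF m[OF f(1)]] power_mult_distrib[of "norm (to_l2 f)"]
        norm_to_l2_sq[OF f(1)] by (simp add: mult.commute)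
  qed
  then show "norm (l2_mult h x) \<le> norm x * B"
    by (rule power2_le_imp_le) (simp add: \<open>B \<ge> 0\<close>)
qed

lemma inner_l2_mult:
  fixes h :: "'a::euclidean_space \<Rightarrow> real"
  assumes h: "h \<in> borel_measurable lebesgue" "\<And>z. \<bar>h z\<bar> \<le> B"
  shows "inner (l2_mult h x) y = inner x (l2_mult h y)"
proof -
  obtain f where f: "sq_integrable f" "x = to_l2 f" by (rule to_l2_cases)
  obtain g where g: "sq_integrable g" "y = to_l2 g" by (rule to_l2_cases)
  note m = sq_integrable_bounded_mult[OF h]
  have "(\<integral>z. (h z * f z) * g z \<partial>lebesgue) = (\<integral>z. f z * (h z * g z) \<partial>lebesgue)"
    by (simp add: mult_ac)
  then show ?thesis
    unfolding f(2) g(2) l2_mult_to_l2[OF h f(1)] l2_mult_to_l2[OF h g(1)]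
      inner_to_l2[OF m[OF f(1)] g(1)] inner_to_l2[OF f(1) m[OF g(1)]] .
qed

subsection \<open>Smooth functions and affine flows\<close>

definition dir_deriv :: "'a::real_normed_vector \<Rightarrow> ('a \<Rightarrow> real) \<Rightarrow> 'a \<Rightarrow> real" where
  "dir_deriv v f z = frechet_derivative f (at z) v"

lemma dir_deriv_eqI:
  assumes "\<And>z. (f has_derivative f' z) (at z)"
  shows "dir_deriv v f = (\<lambda>z. f' z v)"
  using frechet_derivative_at[OF assms] by (auto simp: dir_deriv_def fun_eq_iff)

lemma Ck_on_UNIV_Suc:
  "Ck_on (Suc k) UNIV f \<longleftrightarrow> (\<forall>z. f differentiable at z) \<and> (\<forall>v. Ck_on k UNIV (dir_deriv v f))"
  by (simp add: differentiable_on_def dir_deriv_def[abs_def])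

declare Ck_on.simps(2) [simp del]

lemma has_derivative_dir_deriv:
  "f differentiable at z \<Longrightarrow> (f has_derivative (\<lambda>v. dir_deriv v f z)) (at z)"
  unfolding dir_deriv_def by (simp add: frechet_derivative_works)

lemma Ck_on_SucD: "Ck_on (Suc k) UNIV f \<Longrightarrow> Ck_on k UNIV f"
proof (induction k arbitrary: f)
  case 0
  then show ?case
    by (auto simp: Ck_on_UNIV_Suc intro!: continuous_at_imp_continuous_on differentiable_imp_continuous_within)
next
  case (Suc k)
  then show ?case by (simp add: Ck_on_UNIV_Suc[of "Suc k"] Ck_on_UNIV_Suc[of k f])
qed

lemma smooth_differentiable: "smooth_on UNIV f \<Longrightarrow> f differentiable at z"
  unfolding smooth_on_def using Ck_on_UNIV_Suc by blast

lemma smooth_dir_deriv: "smooth_on UNIV f \<Longrightarrow> smooth_on UNIV (dir_deriv v f)"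
  unfolding smooth_on_def using Ck_on_UNIV_Suc by blast

lemma smooth_has_derivative:
  "smooth_on UNIV f \<Longrightarrow> (f has_derivative (\<lambda>v. dir_deriv v f z)) (at z)"
  by (simp add: has_derivative_dir_deriv smooth_differentiable)

lemma smooth_continuous_on: "smooth_on UNIV f \<Longrightarrow> continuous_on S f"
  using Ck_on.simps(1)[of UNIV f] unfolding smooth_on_def by (metis continuous_on_subset subset_UNIV)

text \<open>Smooth functions form the largest class of differentiable functions that is closed under
  directional derivatives. Smoothness can therefore be shown by exhibiting an invariant class, with
  no induction over the order at the place of use.\<close>

lemma smooth_coinduct:
  assumes "P f" and step: "\<And>g. P g \<Longrightarrow> (\<forall>z. g differentiable at z) \<and> (\<forall>v. P (dir_deriv v g))"
  shows "smooth_on UNIV f"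
proof -
  have "Ck_on k UNIV g" if "P g" for k g
    using that
  proof (induction k arbitrary: g)
    case 0
    then show ?case using step
      by (auto intro!: continuous_at_imp_continuous_on differentiable_imp_continuous_within)
  next
    case (Suc k)
    then show ?case using step unfolding Ck_on_UNIV_Suc by blast
  qed
  then show ?thesis using assms(1) by (auto simp: smooth_on_def)
qed

lemma dir_deriv_const: "dir_deriv v (\<lambda>z. c) = (\<lambda>z. 0)"
  using dir_deriv_eqI[of "\<lambda>z. c" "\<lambda>z v. 0"] by auto

lemma smooth_const: "smooth_on UNIV (\<lambda>z. c)"
  by (rule smooth_coinduct[where P = "\<lambda>f. \<exists>c. f = (\<lambda>z. c)"]) (auto simp: dir_deriv_const)

lemma dir_deriv_linear: "bounded_linear g \<Longrightarrow> dir_deriv v g = (\<lambda>z. g v)"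
  using dir_deriv_eqI[of g "\<lambda>z. g"] by (auto intro: bounded_linear_imp_has_derivative)

lemma smooth_linear:
  assumes "bounded_linear g" shows "smooth_on UNIV g"
proof (rule smooth_coinduct[where P = "\<lambda>f. bounded_linear f \<or> smooth_on UNIV f"])
  fix h assume h: "bounded_linear h \<or> smooth_on UNIV h"
  then show "(\<forall>z. h differentiable at z) \<and>
      (\<forall>v. bounded_linear (dir_deriv v h) \<or> smooth_on UNIV (dir_deriv v h))"
    by (auto simp: dir_deriv_linear smooth_const bounded_linear_imp_differentiable
        intro: smooth_differentiable smooth_dir_deriv)
qed (use assms in auto)

lemma dir_deriv_add:
  "(\<And>z. f differentiable at z) \<Longrightarrow> (\<And>z. g differentiable at z) \<Longrightarrow>
    dir_deriv v (\<lambda>z. f z + g z) = (\<lambda>z. dir_deriv v f z + dir_deriv v g z)"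
  by (rule dir_deriv_eqI[of "\<lambda>z. f z + g z" "\<lambda>z v. dir_deriv v f z + dir_deriv v g z"])
    (auto intro!: has_derivative_add has_derivative_dir_deriv)

lemma dir_deriv_mult:
  "(\<And>z. f differentiable at z) \<Longrightarrow> (\<And>z. g differentiable at z) \<Longrightarrow>
    dir_deriv v (\<lambda>z. f z * g z) = (\<lambda>z. f z * dir_deriv v g z + dir_deriv v f z * g z)"
  by (rule dir_deriv_eqI[of "\<lambda>z. f z * g z" "\<lambda>z v. f z * dir_deriv v g z + dir_deriv v f z * g z"])
    (auto intro!: has_derivative_mult has_derivative_dir_deriv)

lemma Ck_on_add: "Ck_on k UNIV f \<Longrightarrow> Ck_on k UNIV g \<Longrightarrow> Ck_on k UNIV (\<lambda>z. f z + g z)"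
proof (induction k arbitrary: f g)
  case 0 then show ?case by (auto intro: continuous_on_add)
next
  case (Suc k) then show ?case
    by (auto simp: Ck_on_UNIV_Suc dir_deriv_add intro!: differentiable_add)
qed

lemma Ck_on_mult: "Ck_on k UNIV f \<Longrightarrow> Ck_on k UNIV g \<Longrightarrow> Ck_on k UNIV (\<lambda>z. f z * g z)"
proof (induction k arbitrary: f g)
  case 0 then show ?case by (auto intro: continuous_on_mult)
next
  case (Suc k)
  have d: "\<And>z. f differentiable at z" "\<And>z. g differentiable at z"
    "\<And>v. Ck_on k UNIV (dir_deriv v f)" "\<And>v. Ck_on k UNIV (dir_deriv v g)"
    using Suc.prems by (auto simp: Ck_on_UNIV_Suc)
  have "Ck_on k UNIV f" "Ck_on k UNIV g" using Suc.prems Ck_on_SucD by blast+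
  then have "Ck_on k UNIV (\<lambda>z. f z * dir_deriv v g z + dir_deriv v f z * g z)" for v
    using d by (intro Ck_on_add Suc.IH)
  then show ?case unfolding Ck_on_UNIV_Suc
    using d by (auto simp: dir_deriv_mult intro!: differentiable_mult)
qed

lemma smooth_add: "smooth_on UNIV f \<Longrightarrow> smooth_on UNIV g \<Longrightarrow> smooth_on UNIV (\<lambda>z. f z + g z)"
  by (simp add: smooth_on_def Ck_on_add)

lemma smooth_mult: "smooth_on UNIV f \<Longrightarrow> smooth_on UNIV g \<Longrightarrow> smooth_on UNIV (\<lambda>z. f z * g z)"
  by (simp add: smooth_on_def Ck_on_mult)

lemma smooth_scale: "smooth_on UNIV f \<Longrightarrow> smooth_on UNIV (\<lambda>z. c * f z)"
  by (intro smooth_mult smooth_const)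

lemma smooth_uminus: "smooth_on UNIV f \<Longrightarrow> smooth_on UNIV (\<lambda>z. - f z)"
  using smooth_scale[of f "-1"] by simp

lemma smooth_diff: "smooth_on UNIV f \<Longrightarrow> smooth_on UNIV g \<Longrightarrow> smooth_on UNIV (\<lambda>z. f z - g z)"
  using smooth_add[OF _ smooth_uminus, of f g] by simp

lemma smooth_sum: "(\<And>i. i \<in> I \<Longrightarrow> smooth_on UNIV (f i)) \<Longrightarrow> smooth_on UNIV (\<lambda>z. \<Sum>i\<in>I. f i z)"
  by (induction I rule: infinite_finite_induct) (auto simp: smooth_const smooth_add)

lemma smooth_prod: "(\<And>i. i \<in> I \<Longrightarrow> smooth_on UNIV (f i)) \<Longrightarrow> smooth_on UNIV (\<lambda>z. \<Prod>i\<in>I. f i z)"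
  by (induction I rule: infinite_finite_induct) (auto simp: smooth_const smooth_mult)

lemma dir_deriv_affine:
  assumes "\<And>z. f differentiable at z" "bounded_linear A"
  shows "dir_deriv v (\<lambda>z. f (a + A z)) = (\<lambda>z. dir_deriv (A v) f (a + A z))"
proof (rule dir_deriv_eqI[of "\<lambda>z. f (a + A z)" "\<lambda>z v. dir_deriv (A v) f (a + A z)"])
  fix z
  have "((\<lambda>z. a + A z) has_derivative A) (at z)"
    using bounded_linear_imp_has_derivative[OF assms(2)] by (auto intro!: derivative_eq_intros)
  from has_derivative_compose[OF this has_derivative_dir_deriv[OF assms(1)]]
  show "((\<lambda>z. f (a + A z)) has_derivative (\<lambda>v. dir_deriv (A v) f (a + A z))) (at z)" .
qed

lemma smooth_affine:
  assumes "smooth_on UNIV f" "bounded_linear A"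
  shows "smooth_on UNIV (\<lambda>z. f (a + A z))"
proof (rule smooth_coinduct[where P = "\<lambda>h. \<exists>f. smooth_on UNIV f \<and> h = (\<lambda>z. f (a + A z))"])
  fix h assume "\<exists>f. smooth_on UNIV f \<and> h = (\<lambda>z. f (a + A z))"
  then obtain f where f: "smooth_on UNIV f" "h = (\<lambda>z. f (a + A z))" by auto
  have "((\<lambda>z. a + A z) has_derivative A) (at z)" for z
    using bounded_linear_imp_has_derivative[OF assms(2)] by (auto intro!: derivative_eq_intros)
  then have "(\<lambda>z. f (a + A z)) differentiable at z" for z
    using has_derivative_compose[OF _ smooth_has_derivative[OF f(1)]] differentiable_def by blast
  then show "(\<forall>z. h differentiable at z) \<and> (\<forall>v. \<exists>f. smooth_on UNIV f \<and> dir_deriv v h = (\<lambda>z. f (a + A z)))"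
    using f dir_deriv_affine[OF smooth_differentiable[OF f(1)] assms(2)] smooth_dir_deriv by blast
qed (use assms in auto)

text \<open>The family \<open>F\<close> lists the successive derivatives of the outer function. The
  induction over the order runs for all \<open>i\<close> at once, because the chain rule replaces
  \<open>F i\<close> by \<open>F (Suc i)\<close>.\<close>

lemma smooth_compose_real:
  fixes F :: "nat \<Rightarrow> real \<Rightarrow> real"
  assumes F: "\<And>i x. (F i has_field_derivative F (Suc i) x) (at x)" and g: "smooth_on UNIV g"
  shows "smooth_on UNIV (\<lambda>z. F i (g z))"
proof -
  have der: "((\<lambda>z. F i (g z)) has_derivative (\<lambda>v. F (Suc i) (g z) * dir_deriv v g z)) (at z)" for i z
    using has_derivative_compose[OF smooth_has_derivative[OF g] F[unfolded has_field_derivative_def]]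
    by simp
  have "Ck_on k UNIV (\<lambda>z. F i (g z))" for k
  proof (induction k arbitrary: i)
    case 0
    then show ?case
      by (auto intro!: continuous_at_imp_continuous_on has_derivative_continuous[OF der])
  next
    case (Suc k)
    have "Ck_on k UNIV (dir_deriv v g)" for v
      using smooth_dir_deriv[OF g] by (simp add: smooth_on_def)
    then show ?case unfolding Ck_on_UNIV_Suc dir_deriv_eqI[OF der]
      using der Suc.IH by (auto simp: differentiable_def intro!: Ck_on_mult)
  qed
  then show ?thesis by (simp add: smooth_on_def)
qed

lemma test_functionsI:
  assumes "smooth_on UNIV f" "compact K" "K \<subseteq> \<Omega>" "\<And>z. z \<notin> K \<Longrightarrow> f z = 0"
  shows "f \<in> test_functions \<Omega>"
proof -
  have "closure {z. f z \<noteq> 0} \<subseteq> K"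
    using assms by (intro closure_minimal) (auto intro: compact_imp_closed)
  moreover from this have "compact (closure {z. f z \<noteq> 0})"
    using compact_Int_closed[OF assms(2) closed_closure] by (metis Int_absorb1)
  ultimately show ?thesis
    unfolding test_functions_def using assms by auto
qed

lemma test_functionsE:
  assumes "f \<in> test_functions \<Omega>"
  obtains K where "smooth_on UNIV f" "compact K" "K \<subseteq> \<Omega>" "\<And>z. z \<notin> K \<Longrightarrow> f z = 0"
proof (rule that[of "closure {z. f z \<noteq> 0}"])
  show "f z = 0" if "z \<notin> closure {z. f z \<noteq> 0}" for z
    using that closure_subset[of "{z. f z \<noteq> 0}"] by auto
qed (use assms in \<open>auto simp: test_functions_def\<close>)

lemma test_smooth: "f \<in> test_functions \<Omega> \<Longrightarrow> smooth_on UNIV f"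
  by (simp add: test_functions_def)

lemma test_outside: "f \<in> test_functions \<Omega> \<Longrightarrow> z \<notin> \<Omega> \<Longrightarrow> f z = 0"
  by (erule test_functionsE) auto

lemma test_mono: "\<Omega> \<subseteq> \<Omega>' \<Longrightarrow> f \<in> test_functions \<Omega> \<Longrightarrow> f \<in> test_functions \<Omega>'"
  by (auto simp: test_functions_def)

lemma test_zero: "(\<lambda>z. 0) \<in> test_functions \<Omega>"
  by (rule test_functionsI[of _ "{}"]) (auto simp: smooth_const)

lemma test_smooth_mult:
  assumes "f \<in> test_functions \<Omega>" "smooth_on UNIV g"
  shows "(\<lambda>z. g z * f z) \<in> test_functions \<Omega>"
  using assms(1)
proof (rule test_functionsE)
  fix K assume "smooth_on UNIV f" "compact K" "K \<subseteq> \<Omega>" "\<And>z. z \<notin> K \<Longrightarrow> f z = 0"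
  then show ?thesis using assms(2)
    by (intro test_functionsI[of _ K] smooth_mult) auto
qed

lemma test_scale: "f \<in> test_functions \<Omega> \<Longrightarrow> (\<lambda>z. c * f z) \<in> test_functions \<Omega>"
  by (rule test_smooth_mult[OF _ smooth_const])

lemma test_uminus: "f \<in> test_functions \<Omega> \<Longrightarrow> (\<lambda>z. - f z) \<in> test_functions \<Omega>"
  using test_scale[of f \<Omega> "-1"] by simp

lemma test_add:
  assumes "f \<in> test_functions \<Omega>" "g \<in> test_functions \<Omega>"
  shows "(\<lambda>z. f z + g z) \<in> test_functions \<Omega>"
  using assms(1)
proof (rule test_functionsE)
  fix K assume K: "smooth_on UNIV f" "compact K" "K \<subseteq> \<Omega>" "\<And>z. z \<notin> K \<Longrightarrow> f z = 0"
  show ?thesis using assms(2)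
  proof (rule test_functionsE)
    fix K' assume "smooth_on UNIV g" "compact K'" "K' \<subseteq> \<Omega>" "\<And>z. z \<notin> K' \<Longrightarrow> g z = 0"
    then show ?thesis using K
      by (intro test_functionsI[of _ "K \<union> K'"] smooth_add) auto
  qed
qed

lemma test_diff:
  "f \<in> test_functions \<Omega> \<Longrightarrow> g \<in> test_functions \<Omega> \<Longrightarrow> (\<lambda>z. f z - g z) \<in> test_functions \<Omega>"
  using test_add[OF _ test_uminus, of f \<Omega> g] by simp

lemma test_sum:
  "(\<And>i. i \<in> I \<Longrightarrow> f i \<in> test_functions \<Omega>) \<Longrightarrow> (\<lambda>z. \<Sum>i\<in>I. f i z) \<in> test_functions \<Omega>"
  by (induction I rule: infinite_finite_induct) (auto simp: test_zero test_add)

lemma test_dir_deriv: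
  assumes "f \<in> test_functions \<Omega>"
  shows "dir_deriv v f \<in> test_functions \<Omega>"
  using assms
proof (rule test_functionsE)
  fix K assume K: "smooth_on UNIV f" "compact K" "K \<subseteq> \<Omega>" "\<And>z. z \<notin> K \<Longrightarrow> f z = 0"
  have "dir_deriv v f z = 0" if "z \<notin> K" for z
  proof -
    have "(f has_derivative (\<lambda>v. 0)) (at z)"
      by (rule has_derivative_transform_within_open[of "\<lambda>z. 0" _ _ UNIV "- K"])
        (use K that in \<open>auto intro: compact_imp_closed\<close>)
    then show ?thesis
      using frechet_derivative_at unfolding dir_deriv_def by metis
  qed
  then show ?thesis using K
    by (intro test_functionsI[of _ K] smooth_dir_deriv) auto
qed

text \<open>Affine fields whose integral curves are straight lines and which are divergence free
  coordinate by coordinate; their flow at time \<open>s\<close> is \<open>z \<mapsto> z + s V(z)\<close>.\<close>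

definition shear_field :: "('a::euclidean_space \<Rightarrow> 'a) \<Rightarrow> bool" where
  "shear_field V \<longleftrightarrow> (\<exists>a A. bounded_linear A \<and> V = (\<lambda>z. a + A z) \<and> (\<forall>z. A (V z) = 0) \<and>
     (\<forall>b\<in>Basis. A b \<bullet> b = 0))"

lemma shear_field_const: "shear_field (\<lambda>z. v)"
  unfolding shear_field_def by (rule exI[of _ v], rule exI[of _ "\<lambda>z. 0"]) auto

definition flow :: "('a::euclidean_space \<Rightarrow> 'a) \<Rightarrow> real \<Rightarrow> ('a \<Rightarrow> real) \<Rightarrow> 'a \<Rightarrow> real" where
  "flow V s f z = f (z + s *\<^sub>R V z)"

lemma along_const: "along (\<lambda>z. v) f = dir_deriv v f"
  by (simp add: along_def dir_deriv_def fun_eq_iff)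

lemma along_eq_sum:
  fixes f :: "'a::euclidean_space \<Rightarrow> real"
  assumes "smooth_on UNIV f"
  shows "along V f = (\<lambda>z. \<Sum>b\<in>Basis. (V z \<bullet> b) * dir_deriv b f z)"
proof
  fix z
  have lin: "linear (frechet_derivative f (at z))"
    by (rule linear_frechet_derivative[OF smooth_differentiable[OF assms]])
  have "along V f z = frechet_derivative f (at z) (\<Sum>b\<in>Basis. (V z \<bullet> b) *\<^sub>R b)"
    by (simp add: along_def euclidean_representation)
  also have "\<dots> = (\<Sum>b\<in>Basis. (V z \<bullet> b) * dir_deriv b f z)"
    by (simp add: linear_sum[OF lin] linear_cmul[OF lin] dir_deriv_def)
  finally show "along V f z = (\<Sum>b\<in>Basis. (V z \<bullet> b) * dir_deriv b f z)" .
qed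

lemma shear_field_smooth_component:
  assumes "shear_field V" shows "smooth_on UNIV (\<lambda>z. V z \<bullet> b)"
proof -
  obtain a A where A: "bounded_linear A" "V = (\<lambda>z. a + A z)"
    using assms by (auto simp: shear_field_def)
  have "bounded_linear (\<lambda>z. A z \<bullet> b)"
    by (rule bounded_linear_compose[OF bounded_linear_inner_left A(1)])
  then show ?thesis
    unfolding A(2) inner_add_left by (intro smooth_add smooth_const smooth_linear)
qed

lemma smooth_along:
  "shear_field V \<Longrightarrow> smooth_on UNIV f \<Longrightarrow> smooth_on UNIV (along V f)"
  unfolding along_eq_sum
  by (intro smooth_sum smooth_mult shear_field_smooth_component smooth_dir_deriv)

lemma test_along:
  assumes "shear_field V" "f \<in> test_functions \<Omega>" shows "along V f \<in> test_functions \<Omega>"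
  unfolding along_eq_sum[OF test_smooth[OF assms(2)]]
  by (intro test_sum test_smooth_mult test_dir_deriv
      shear_field_smooth_component assms)

lemma along_add:
  "smooth_on UNIV f \<Longrightarrow> smooth_on UNIV g \<Longrightarrow> along V (\<lambda>z. f z + g z) = (\<lambda>z. along V f z + along V g z)"
  by (simp add: along_eq_sum smooth_add dir_deriv_add smooth_differentiable distrib_left sum.distrib)

lemma along_mult:
  "smooth_on UNIV f \<Longrightarrow> smooth_on UNIV g \<Longrightarrow>
    along V (\<lambda>z. f z * g z) = (\<lambda>z. f z * along V g z + along V f z * g z)"
  by (simp add: along_eq_sum smooth_mult dir_deriv_mult smooth_differentiable distrib_left
      sum.distrib sum_distrib_left sum_distrib_right mult_ac)

lemma along_mult_const: "smooth_on UNIV f \<Longrightarrow> along V (\<lambda>z. c * f z) = (\<lambda>z. c * along V f z)"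
  by (simp add: along_mult smooth_const along_def)

lemma along_uminus: "smooth_on UNIV f \<Longrightarrow> along V (\<lambda>z. - f z) = (\<lambda>z. - along V f z)"
  using along_mult_const[of f V "-1"] by simp

lemma along_diff:
  "smooth_on UNIV f \<Longrightarrow> smooth_on UNIV g \<Longrightarrow> along V (\<lambda>z. f z - g z) = (\<lambda>z. along V f z - along V g z)"
  using along_add[OF _ smooth_uminus, of f g V] by (simp add: along_uminus)

lemma along_linear: "bounded_linear g \<Longrightarrow> along V g = (\<lambda>z. g (V z))"
  using dir_deriv_linear[of g] by (auto simp: along_def dir_deriv_def fun_eq_iff)

lemma shear_field_linear_flow:
  assumes "shear_field V"
  obtains a A where "bounded_linear A" "\<And>z. z + s *\<^sub>R V z = a + A z"
proof -
  obtain a A where A: "bounded_linear A" "V = (\<lambda>z. a + A z)"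
    using assms by (auto simp: shear_field_def)
  show thesis
  proof (rule that)
    show "bounded_linear (\<lambda>z. z + s *\<^sub>R A z)"
      by (intro bounded_linear_add bounded_linear_ident bounded_linear_const_scaleR A)
    show "z + s *\<^sub>R V z = s *\<^sub>R a + (z + s *\<^sub>R A z)" for z
      by (simp add: A algebra_simps)
  qed
qed

lemma shear_field_flow:
  assumes "shear_field V" shows "V (z + s *\<^sub>R V z) = V z"
proof -
  obtain a A where A: "bounded_linear A" "V = (\<lambda>z. a + A z)" "\<And>z. A (V z) = 0"
    using assms unfolding shear_field_def by metis
  have "A (z + s *\<^sub>R V z) = A z"
    using A(1,3) by (simp add: linear_add[OF bounded_linear.linear] linear_cmul[OF bounded_linear.linear])
  then show ?thesis by (metis A(2))
qed

lemma flow_flow: "shear_field V \<Longrightarrow> flow V s (flow V t f) = flow V (s + t) f"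
  by (simp add: flow_def fun_eq_iff shear_field_flow scaleR_add_left add.assoc)

lemma flow_0: "flow V 0 f = f"
  by (simp add: flow_def fun_eq_iff)

lemma smooth_flow: "shear_field V \<Longrightarrow> smooth_on UNIV f \<Longrightarrow> smooth_on UNIV (flow V s f)"
  by (rule shear_field_linear_flow[of V s]) (auto simp: flow_def[abs_def] intro: smooth_affine)

lemma continuous_on_shear_field: "shear_field V \<Longrightarrow> continuous_on S V"
  unfolding shear_field_def
  by (elim exE conjE, hypsubst, intro continuous_on_add continuous_on_const linear_continuous_on)

text \<open>Since \<open>V\<close> is constant along its own lines, the flow at time
  \<open>s\<close> is inverted by \<open>w \<mapsto> w - s V(w)\<close>. The preimages of
  \<open>K\<close> for all times up to \<open>R\<close> thus lie in one continuous image of a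
  compact set.\<close>

lemma flow_support:
  assumes "shear_field V" "compact K"
  obtains K' where "compact K'" "\<And>z s. \<bar>s\<bar> \<le> R \<Longrightarrow> z + s *\<^sub>R V z \<in> K \<Longrightarrow> z \<in> K'"
proof -
  let ?g = "\<lambda>(w, s). w - s *\<^sub>R V w"
  have "continuous_on (K \<times> {-R..R}) ?g"
    unfolding case_prod_beta
    by (intro continuous_intros continuous_on_compose2[OF continuous_on_shear_field[OF assms(1), of UNIV]]) auto
  then have "compact (?g ` (K \<times> {-R..R}))"
    using assms(2) by (intro compact_continuous_image compact_Times) auto
  moreover have "z \<in> ?g ` (K \<times> {-R..R})" if "\<bar>s\<bar> \<le> R" "z + s *\<^sub>R V z \<in> K" for z s
    by (rule image_eqI[of _ _ "(z + s *\<^sub>R V z, s)"]) (use that shear_field_flow[OF assms(1)] in auto)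
  ultimately show thesis by (rule that)
qed

lemma test_flow:
  assumes "shear_field V" "f \<in> test_functions UNIV" shows "flow V s f \<in> test_functions UNIV"
  using assms(2)
proof (rule test_functionsE)
  fix K assume K: "smooth_on UNIV f" "compact K" "K \<subseteq> UNIV" "\<And>z. z \<notin> K \<Longrightarrow> f z = 0"
  obtain K' where K': "compact K'" "\<And>z t. \<bar>t\<bar> \<le> \<bar>s\<bar> \<Longrightarrow> z + t *\<^sub>R V z \<in> K \<Longrightarrow> z \<in> K'"
    using flow_support[OF assms(1) K(2)] by blast
  show ?thesis
  proof (rule test_functionsI[OF smooth_flow[OF assms(1) K(1)] K'(1)])
    fix z assume "z \<notin> K'"
    then have "z + s *\<^sub>R V z \<notin> K" using K'(2)[of s z] by auto
    then show "flow V s f z = 0" using K(4) by (auto simp: flow_def)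
  qed auto
qed

lemma along_flow:
  assumes "shear_field V" "smooth_on UNIV f"
  shows "along V (flow V s f) = flow V s (along V f)"
proof
  fix z
  obtain a A where A: "bounded_linear A" "\<And>z. z + s *\<^sub>R V z = a + A z"
    using shear_field_linear_flow[OF assms(1)] by blast
  obtain a' A' where V: "bounded_linear A'" "V = (\<lambda>z. a' + A' z)" "\<And>z. A' (V z) = 0"
    using assms(1) unfolding shear_field_def by metis
  have AV: "A w = w + s *\<^sub>R A' w" for w
  proof -
    have "a + A w - (a + A 0) = (w + s *\<^sub>R V w) - (0 + s *\<^sub>R V 0)" by (metis A(2))
    also have "\<dots> = w + s *\<^sub>R A' w" by (simp add: V(2) algebra_simps linear_0[OF bounded_linear.linear[OF V(1)]])
    finally show ?thesis by (simp add: linear_0[OF bounded_linear.linear[OF A(1)]])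
  qed
  have "flow V s f = (\<lambda>z. f (a + A z))"
    by (simp add: flow_def fun_eq_iff A(2))
  then have "along V (flow V s f) z = dir_deriv (V z) (\<lambda>z. f (a + A z)) z"
    by (simp add: along_def dir_deriv_def)
  also have "\<dots> = dir_deriv (A (V z)) f (a + A z)"
    by (simp add: dir_deriv_affine[OF smooth_differentiable[OF assms(2)] A(1)])
  also have "A (V z) = V (z + s *\<^sub>R V z)"
    by (simp add: AV V(3) shear_field_flow[OF assms(1)])
  finally show "along V (flow V s f) z = flow V s (along V f) z"
    by (simp add: flow_def[of _ _ "along V f"] along_def[of V f] dir_deriv_def A(2))
qed

lemma flow_has_real_derivative:
  assumes "shear_field V" "smooth_on UNIV f"
  shows "((\<lambda>s. flow V s f z) has_real_derivative flow V s (along V f) z) (at s)"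
proof -
  have "((\<lambda>s. z + s *\<^sub>R V z) has_derivative (\<lambda>h. h *\<^sub>R V z)) (at s)"
    by (auto intro!: derivative_eq_intros)
  from has_derivative_compose[OF this smooth_has_derivative[OF assms(2)]]
  have "((\<lambda>s. flow V s f z) has_derivative (\<lambda>h. dir_deriv (h *\<^sub>R V z) f (z + s *\<^sub>R V z))) (at s)"
    by (simp add: flow_def)
  moreover have "dir_deriv (h *\<^sub>R V z) f (z + s *\<^sub>R V z) = flow V s (along V f) z * h" for h
    using linear_cmul[OF linear_frechet_derivative[OF smooth_differentiable[OF assms(2)]]]
    by (simp add: dir_deriv_def flow_def along_def shear_field_flow[OF assms(1)])
  ultimately show ?thesis by (simp add: has_field_derivative_def)
qed

section \<open>Boundedness and integrability of test functions\<close>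

lemma test_bounded:
  assumes "f \<in> test_functions \<Omega>" obtains B where "\<And>z. \<bar>f z\<bar> \<le> B" "B \<ge> 0"
  using assms
proof (rule test_functionsE)
  fix K assume K: "smooth_on UNIV f" "compact K" "K \<subseteq> \<Omega>" "\<And>z. z \<notin> K \<Longrightarrow> f z = 0"
  have "bounded (f ` K)"
    by (intro compact_imp_bounded compact_continuous_image smooth_continuous_on K)
  then obtain B where "\<And>z. z \<in> K \<Longrightarrow> \<bar>f z\<bar> \<le> B" by (auto simp: bounded_iff)
  then have "\<bar>f z\<bar> \<le> max B 0" for z using K(4) by (cases "z \<in> K") (auto simp: le_max_iff_disj)
  then show thesis by (rule that) auto
qed

lemma compact_support_integrable:
  fixes f :: "'a::euclidean_space \<Rightarrow> real"
  assumes "continuous_on UNIV f" "compact K" "\<And>z. z \<notin> K \<Longrightarrow> f z = 0"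
  shows "integrable lborel f" "integrable lebesgue f"
proof -
  have "indicator K x *\<^sub>R f x = f x" for x using assms(3) by (cases "x \<in> K") auto
  then have "(\<lambda>x. indicator K x *\<^sub>R f x) = f" by auto
  then show 1: "integrable lborel f"
    using borel_integrable_compact[OF assms(2) continuous_on_subset[OF assms(1)]] by (metis subset_UNIV)
  then show "integrable lebesgue f"
    by (subst integrable_completion) auto
qed

lemma test_sq_integrable:
  assumes "f \<in> test_functions \<Omega>" shows "sq_integrable f"
  using assms
proof (rule test_functionsE)
  fix K assume K: "smooth_on UNIV f" "compact K" "K \<subseteq> \<Omega>" "\<And>z. z \<notin> K \<Longrightarrow> f z = 0"
  have c: "continuous_on UNIV f" by (rule smooth_continuous_on[OF K(1)])
  have "integrable lebesgue f" "integrable lebesgue (\<lambda>z. (f z)\<^sup>2)"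
    using K by (auto intro!: compact_support_integrable[of _ K] continuous_intros c)
  then show ?thesis by (auto simp: sq_integrable_def)
qed

lemma test_integrable:
  assumes "f \<in> test_functions \<Omega>" shows "integrable lborel f"
  using assms
proof (rule test_functionsE)
  fix K assume K: "smooth_on UNIV f" "compact K" "K \<subseteq> \<Omega>" "\<And>z. z \<notin> K \<Longrightarrow> f z = 0"
  then show ?thesis
    by (intro compact_support_integrable[of _ K] smooth_continuous_on)
qed

text \<open>The set where two continuous functions differ is open, and a negligible open set is
  empty. This lets identities in L2 be read pointwise.\<close>

lemma to_l2_test_inject:
  assumes "f \<in> test_functions \<Omega>" "g \<in> test_functions \<Omega>'" "to_l2 f = to_l2 g"
  shows "f = g"
proof -
  let ?S = "{z. f z \<noteq> g z}"
  have "AE z in lebesgue. f z = g z"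
    using assms by (simp add: to_l2_eq_iff test_sq_integrable)
  then have "negligible ?S"
    by (simp add: negligible_iff_null_sets AE_iff_null_sets eventually_ae_filter)
      (metis (mono_tags, lifting) null_sets_completion_subset)
  moreover have "open ?S"
    using assms by (intro open_Collect_neq smooth_continuous_on test_smooth)
  ultimately have "?S = {}" using open_not_negligible by blast
  then show ?thesis by auto
qed

subsection \<open>Integration by parts and unitary flows\<close>

lemma integrable_indicator_compact:
  fixes K :: "'a::euclidean_space set"
  assumes "compact K" shows "integrable lborel (\<lambda>z. B * indicator K z :: real)"
  using assms emeasure_bounded_finite[OF compact_imp_bounded[OF assms]]
  by (auto simp: borel_compact)

text \<open>The mean value inequality along flow lines, with one compact set serving all times up to
  \<open>R\<close>. It supplies the dominating function when difference quotients are taken under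
  the integral.\<close>

lemma flow_increment_bound:
  assumes V: "shear_field V" and f: "f \<in> test_functions UNIV"
  obtains K B where "compact K" "B \<ge> 0"
    "\<And>z s. \<bar>s\<bar> \<le> R \<Longrightarrow> \<bar>flow V s f z - f z\<bar> \<le> \<bar>s\<bar> * (B * indicator K z)"
    "\<And>z. \<bar>along V f z\<bar> \<le> B * indicator K z"
proof -
  obtain K1 where K1: "smooth_on UNIV f" "compact K1" "\<And>z. z \<notin> K1 \<Longrightarrow> f z = 0"
    using f by (rule test_functionsE) blast
  have Vf: "along V f \<in> test_functions UNIV" by (rule test_along[OF V f])
  obtain K2 where K2: "compact K2" "\<And>z. z \<notin> K2 \<Longrightarrow> along V f z = 0"
    using Vf by (rule test_functionsE) blast
  obtain B where B: "\<And>z. \<bar>along V f z\<bar> \<le> B" "B \<ge> 0"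
    using Vf by (rule test_bounded) blast
  obtain K3 where K3: "compact K3" "\<And>z s. \<bar>s\<bar> \<le> R \<Longrightarrow> z + s *\<^sub>R V z \<in> K1 \<Longrightarrow> z \<in> K3"
    using flow_support[OF V K1(2)] by blast
  show thesis
  proof (rule that)
    show "compact (K1 \<union> K2 \<union> K3)" using K1 K2 K3 by (intro compact_Un)
    show "0 \<le> B" by fact
    show "\<bar>along V f z\<bar> \<le> B * indicator (K1 \<union> K2 \<union> K3) z" for z
      using B(1)[of z] K2(2)[of z] by (auto simp: indicator_def)
    fix z and s :: real assume s: "\<bar>s\<bar> \<le> R"
    show "\<bar>flow V s f z - f z\<bar> \<le> \<bar>s\<bar> * (B * indicator (K1 \<union> K2 \<union> K3) z)"
    proof (cases "z \<in> K1 \<union> K2 \<union> K3")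
      case False
      then have "z + s *\<^sub>R V z \<notin> K1" using K3(2)[OF s] by auto
      then show ?thesis using K1(3)[of z] K1(3) False by (simp add: flow_def)
    next
      case True
      have "norm (flow V s f z - flow V 0 f z) \<le> B * norm (s - 0)"
        by (rule field_differentiable_bound[of UNIV _ "\<lambda>s. flow V s (along V f) z"])
          (use flow_has_real_derivative[OF V K1(1)] B in \<open>auto simp: flow_def\<close>)
      then show ?thesis using True by (simp add: flow_0 mult.commute)
    qed
  qed
qed

lemma flow_difference_quotient:
  assumes V: "shear_field V" and f: "smooth_on UNIV f" and S: "\<And>n. S n \<noteq> 0" "S \<longlonglongrightarrow> 0"
  shows "(\<lambda>n. (flow V (S n) f z - f z) / S n) \<longlonglongrightarrow> along V f z"
proof -
  have "((\<lambda>h. (flow V (0 + h) f z - flow V 0 f z) / h) \<longlongrightarrow> flow V 0 (along V f) z) (at 0)"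
    using flow_has_real_derivative[OF V f, of z 0] by (simp add: DERIV_def)
  then have "((\<lambda>h. (flow V h f z - f z) / h) \<longlongrightarrow> along V f z) (at 0)"
    by (simp add: flow_0)
  then show ?thesis
    using S unfolding tendsto_at_iff_sequentially comp_def by auto
qed

lemma integral_translate:
  fixes f :: "'a::euclidean_space \<Rightarrow> real"
  assumes "f \<in> borel_measurable borel"
  shows "(\<integral>z. f (z + c) \<partial>lborel) = (\<integral>z. f z \<partial>lborel)"
proof -
  have "(\<integral>z. f z \<partial>lborel) = (\<integral>z. f z \<partial>distr lborel borel ((+) c))"
    by (simp add: lborel_distr_plus)
  also have "\<dots> = (\<integral>z. f (c + z) \<partial>lborel)"
    using assms by (intro integral_distr) auto
  finally show ?thesis by (simp add: add.commute)
qed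

lemma smooth_borel_measurable: "smooth_on UNIV f \<Longrightarrow> f \<in> borel_measurable borel"
  by (intro borel_measurable_continuous_onI smooth_continuous_on)

text \<open>By translation invariance every difference quotient has integral zero, and dominated
  convergence carries this over to the derivative.\<close>

lemma integral_dir_deriv:
  assumes f: "f \<in> test_functions UNIV"
  shows "(\<integral>z. dir_deriv v f z \<partial>lborel) = 0"
proof -
  let ?V = "\<lambda>z. v"
  let ?S = "\<lambda>n. inverse (real (Suc n))"
  note V = shear_field_const[of v]
  note sf = test_smooth[OF f]
  obtain K B where K: "compact K"
      "\<And>z s. \<bar>s\<bar> \<le> 1 \<Longrightarrow> \<bar>flow ?V s f z - f z\<bar> \<le> \<bar>s\<bar> * (B * indicator K z)"
    using flow_increment_bound[OF V f, of 1] by metis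
  have [measurable]: "f \<in> borel_measurable borel" "dir_deriv v f \<in> borel_measurable borel"
    "\<And>s. flow ?V s f \<in> borel_measurable borel"
    by (auto intro!: smooth_borel_measurable smooth_flow V sf smooth_dir_deriv)
  have "(\<lambda>n. \<integral>z. (flow ?V (?S n) f z - f z) / ?S n \<partial>lborel) \<longlonglongrightarrow> (\<integral>z. dir_deriv v f z \<partial>lborel)"
  proof (rule integral_dominated_convergence[where w = "\<lambda>z. B * indicator K z"])
    show "integrable lborel (\<lambda>z. B * indicator K z)"
      by (rule integrable_indicator_compact[OF K(1)])
    show "AE z in lborel. (\<lambda>n. (flow ?V (?S n) f z - f z) / ?S n) \<longlonglongrightarrow> dir_deriv v f z"
    proof (rule AE_I2)
      fix z
      have nz: "?S n \<noteq> 0" for n by (simp del: of_nat_Suc)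
      show "(\<lambda>n. (flow ?V (?S n) f z - f z) / ?S n) \<longlonglongrightarrow> dir_deriv v f z"
        using flow_difference_quotient[OF V sf, of ?S z, OF nz LIMSEQ_inverse_real_of_nat]
        unfolding along_const .
    qed
    fix n
    have "\<bar>flow ?V (?S n) f z - f z\<bar> \<le> \<bar>?S n\<bar> * (B * indicator K z)" for z
      by (rule K(2)) (simp add: field_simps)
    then have "norm ((flow ?V (?S n) f z - f z) / ?S n) \<le> B * indicator K z" for z
      unfolding real_norm_def abs_divide by (subst pos_divide_le_eq) (auto simp: mult.commute)
    then show "AE z in lborel. norm ((flow ?V (?S n) f z - f z) / ?S n) \<le> B * indicator K z"
      by simp
  qed measurable
  moreover have "(\<integral>z. (flow ?V s f z - f z) / s \<partial>lborel) = 0" for s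
  proof -
    have "integrable lborel (flow ?V s f)" "integrable lborel f"
      using f test_flow[OF V f] by (auto intro: test_integrable)
    moreover have "(\<integral>z. flow ?V s f z \<partial>lborel) = (\<integral>z. f z \<partial>lborel)"
      unfolding flow_def by (rule integral_translate) measurable
    ultimately show ?thesis by simp
  qed
  ultimately have "(\<lambda>n. 0) \<longlonglongrightarrow> (\<integral>z. dir_deriv v f z \<partial>lborel)" by (simp only:)
  then show ?thesis by (simp add: LIMSEQ_const_iff)
qed

text \<open>A shear field is divergence free term by term: the derivative of the component
  \<open>V z \<bullet> b\<close> in direction \<open>b\<close> is
  \<open>A b \<bullet> b = 0\<close>. Hence \<open>along V f\<close> is a sum of derivatives of the
  test functions \<open>(V z \<bullet> b) * f z\<close>, each with integral zero.\<close>

lemma integral_along: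
  assumes V: "shear_field V" and f: "f \<in> test_functions UNIV"
  shows "(\<integral>z. along V f z \<partial>lborel) = 0"
proof -
  note sf = test_smooth[OF f]
  note sV = shear_field_smooth_component[OF V]
  obtain a A where A: "bounded_linear A" "V = (\<lambda>z. a + A z)" "\<And>b. b \<in> Basis \<Longrightarrow> A b \<bullet> b = 0"
    using V unfolding shear_field_def by blast
  have d: "dir_deriv b (\<lambda>z. V z \<bullet> b) = (\<lambda>z. 0)" if "b \<in> Basis" for b
  proof -
    have "bounded_linear (\<lambda>z. A z \<bullet> b)"
      by (rule bounded_linear_compose[OF bounded_linear_inner_left A(1)])
    then have "dir_deriv b (\<lambda>z. a \<bullet> b + A z \<bullet> b) = (\<lambda>z. 0 + A b \<bullet> b)"
      by (subst dir_deriv_add)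
        (auto simp: dir_deriv_linear dir_deriv_const bounded_linear_imp_differentiable)
    then show ?thesis by (simp add: A that inner_add_left)
  qed
  have "along V f z = (\<Sum>b\<in>Basis. dir_deriv b (\<lambda>z. (V z \<bullet> b) * f z) z)" for z
    unfolding along_eq_sum[OF sf] by (intro sum.cong refl)
      (simp add: dir_deriv_mult smooth_differentiable sV sf d)
  moreover have tf: "(\<lambda>z. (V z \<bullet> b) * f z) \<in> test_functions UNIV" for b
    by (intro test_smooth_mult f sV)
  have "integrable lborel (dir_deriv b (\<lambda>z. (V z \<bullet> b) * f z))" for b
    by (rule test_integrable[OF test_dir_deriv[OF tf]])
  then have "(\<integral>z. (\<Sum>b\<in>Basis. dir_deriv b (\<lambda>z. (V z \<bullet> b) * f z) z) \<partial>lborel) = 0"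
    by (simp add: integral_dir_deriv[OF tf])
  ultimately show ?thesis by simp
qed

lemma inner_test_functions:
  assumes "f \<in> test_functions \<Omega>" "g \<in> test_functions \<Omega>'"
  shows "inner (to_l2 f) (to_l2 g) = (\<integral>z. f z * g z \<partial>lborel)"
proof -
  have [measurable]: "f \<in> borel_measurable borel" "g \<in> borel_measurable borel"
    using assms by (auto intro: smooth_borel_measurable test_smooth)
  have "(\<integral>z. f z * g z \<partial>lebesgue) = (\<integral>z. f z * g z \<partial>lborel)"
    by (rule integral_completion) measurable
  then show ?thesis
    using assms by (simp add: inner_to_l2 test_sq_integrable)
qed

lemma inner_along:
  assumes V: "shear_field V" and f: "f \<in> test_functions UNIV" and g: "g \<in> test_functions UNIV"
  shows "inner (to_l2 (along V f)) (to_l2 g) = - inner (to_l2 f) (to_l2 (along V g))"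
proof -
  note tf = test_smooth_mult[OF _ test_smooth]
  have "(\<integral>z. along V (\<lambda>z. f z * g z) z \<partial>lborel) = 0"
    by (rule integral_along[OF V tf[OF g f]])
  moreover have "integrable lborel (\<lambda>z. f z * along V g z)" "integrable lborel (\<lambda>z. along V f z * g z)"
    using tf[OF test_along[OF V g] f] tf[OF g test_along[OF V f]]
    by (auto intro: test_integrable)
  ultimately show ?thesis
    using f g V by (simp add: along_mult test_smooth inner_test_functions[of _ UNIV _ UNIV] test_along)
qed

text \<open>The remainder \<open>?Q s\<close> of the difference quotient tends to zero pointwise
  and, for bounded \<open>s\<close>, is at most \<open>2 * B\<close> on a fixed compact set and zero
  elsewhere. Its L2 norm is handled along sequences \<open>S\<close>, the setting of dominated
  convergence.\<close>

lemma flow_has_vector_derivative_0: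
  assumes V: "shear_field V" and f: "f \<in> test_functions UNIV"
  shows "((\<lambda>s. to_l2 (flow V s f)) has_vector_derivative to_l2 (along V f)) (at 0)"
  unfolding has_vector_derivative_def has_derivative_at
proof
  let ?Q = "\<lambda>s z. (flow V s f z - f z) / s - along V f z"
  note sf = test_smooth[OF f]
  note tf = test_flow[OF V f] test_along[OF V f] f
  have [measurable]: "f \<in> borel_measurable borel" "along V f \<in> borel_measurable borel"
    "\<And>s. flow V s f \<in> borel_measurable borel"
    by (auto intro!: smooth_borel_measurable smooth_flow V sf smooth_along)
  have Q: "?Q s \<in> test_functions UNIV" for s
    using test_diff[OF test_scale[OF test_diff[OF tf(1) tf(3)]] tf(2), of "1/s" s]
    by simp
  show "bounded_linear (\<lambda>h. h *\<^sub>R to_l2 (along V f))"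
    by (rule bounded_linear_scaleR_left)
  have "(\<lambda>n. norm (to_l2 (?Q (S n)))) \<longlonglongrightarrow> 0" if S: "\<And>n. S n \<noteq> 0" "S \<longlonglongrightarrow> 0" for S
  proof -
    have "Bseq S" using S(2) by (intro convergent_imp_Bseq) (auto simp: convergent_def)
    then obtain R where R: "\<And>n. \<bar>S n\<bar> \<le> R" by (auto simp: Bseq_def)
    obtain K B where K: "compact K" "B \<ge> 0"
        "\<And>z s. \<bar>s\<bar> \<le> R \<Longrightarrow> \<bar>flow V s f z - f z\<bar> \<le> \<bar>s\<bar> * (B * indicator K z)"
        "\<And>z. \<bar>along V f z\<bar> \<le> B * indicator K z"
      using flow_increment_bound[OF V f] by blast
    have "(\<lambda>n. \<integral>z. (?Q (S n) z)\<^sup>2 \<partial>lborel) \<longlonglongrightarrow> (\<integral>z. 0 \<partial>(lborel :: 'a measure))"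
    proof (rule integral_dominated_convergence[where w = "\<lambda>z. (2 * B)\<^sup>2 * indicator K z"])
      show "integrable lborel (\<lambda>z. (2 * B)\<^sup>2 * indicator K z)"
        by (rule integrable_indicator_compact[OF K(1)])
      show "AE z in lborel. (\<lambda>n. (?Q (S n) z)\<^sup>2) \<longlonglongrightarrow> 0"
      proof (rule AE_I2)
        fix z
        have "(\<lambda>n. (?Q (S n) z)\<^sup>2) \<longlonglongrightarrow> (along V f z - along V f z)\<^sup>2"
          by (intro tendsto_intros flow_difference_quotient[OF V sf] S)
        then show "(\<lambda>n. (?Q (S n) z)\<^sup>2) \<longlonglongrightarrow> 0" by simp
      qed
      fix n
      have "(?Q (S n) z)\<^sup>2 \<le> (2 * B)\<^sup>2 * indicator K z" for z
      proof -
        have "\<bar>(flow V (S n) f z - f z) / S n\<bar> \<le> B * indicator K z"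
          using K(3)[OF R[of n], of z] S(1)[of n]
          by (simp add: abs_divide pos_divide_le_eq mult.commute)
        then have "\<bar>?Q (S n) z\<bar> \<le> 2 * B * indicator K z"
          using K(4)[of z] by linarith
        then have "\<bar>?Q (S n) z\<bar>\<^sup>2 \<le> (2 * B * indicator K z)\<^sup>2"
          by (intro power_mono) auto
        then show ?thesis by (cases "z \<in> K") (auto simp: power_mult_distrib)
      qed
      then show "AE z in lborel. norm ((?Q (S n) z)\<^sup>2) \<le> (2 * B)\<^sup>2 * indicator K z" by simp
    qed measurable
    moreover have "(\<integral>z. (?Q s z)\<^sup>2 \<partial>lborel) = (norm (to_l2 (?Q s)))\<^sup>2" for s
      by (simp add: power2_norm_eq_inner inner_test_functions[OF Q Q]) (simp add: power2_eq_square)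
    ultimately have "(\<lambda>n. (norm (to_l2 (?Q (S n))))\<^sup>2) \<longlonglongrightarrow> 0" by simp
    then have "(\<lambda>n. sqrt ((norm (to_l2 (?Q (S n))))\<^sup>2)) \<longlonglongrightarrow> sqrt 0"
      by (rule tendsto_real_sqrt)
    then show ?thesis by simp
  qed
  then have "((\<lambda>s. norm (to_l2 (?Q s))) \<longlongrightarrow> 0) (at 0)"
    unfolding tendsto_at_iff_sequentially comp_def by auto
  moreover have "norm (to_l2 (flow V (0 + h) f) - to_l2 (flow V 0 f) - h *\<^sub>R to_l2 (along V f)) / norm h
      = norm (to_l2 (?Q h))" if "h \<noteq> 0" for h
  proof -
    have "to_l2 (flow V (0 + h) f) - to_l2 (flow V 0 f) - h *\<^sub>R to_l2 (along V f)
        = to_l2 (\<lambda>z. flow V h f z - f z - h * along V f z)"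
      using tf[THEN test_sq_integrable]
      by (simp add: to_l2_diff to_l2_scale sq_integrable_diff sq_integrable_scale flow_0)
    also have "(\<lambda>z. flow V h f z - f z - h * along V f z) = (\<lambda>z. h * ?Q h z)"
      using that by (auto simp: field_simps)
    also have "to_l2 \<dots> = h *\<^sub>R to_l2 (?Q h)"
      by (rule to_l2_scale[OF test_sq_integrable[OF Q]])
    finally show ?thesis using that by simp
  qed
  ultimately show "(\<lambda>h. norm (to_l2 (flow V (0 + h) f) - to_l2 (flow V 0 f)
      - h *\<^sub>R to_l2 (along V f)) / norm h) \<midarrow>0\<rightarrow> 0"
    by (subst tendsto_cong[OF eventually_at_filter[THEN iffD2, OF always_eventually]]) auto
qed

lemma flow_has_vector_derivative:
  assumes V: "shear_field V" and f: "f \<in> test_functions UNIV"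
  shows "((\<lambda>s. to_l2 (flow V s f)) has_vector_derivative to_l2 (flow V s (along V f))) (at s)"
proof -
  have "((\<lambda>t. to_l2 (flow V t (flow V s f))) has_vector_derivative to_l2 (along V (flow V s f))) (at 0)"
    by (intro flow_has_vector_derivative_0 V test_flow f)
  then have "((\<lambda>t. to_l2 (flow V (t + s) f)) has_vector_derivative to_l2 (flow V s (along V f))) (at (s - s))"
    by (simp add: flow_flow[OF V] along_flow[OF V test_smooth[OF f]])
  then have "((\<lambda>t. to_l2 (flow V (t + s) f)) \<circ> (\<lambda>t. t - s) has_vector_derivative
      1 *\<^sub>R to_l2 (flow V s (along V f))) (at s)"
    by (intro vector_diff_chain_at) (auto intro!: derivative_eq_intros)
  then show ?thesis by (simp add: o_def)
qed

text \<open>Unitarity of the flow follows from skew-adjointness of its generator: the derivative in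
  \<open>s\<close> of the inner product is the sum of two terms that cancel by
  \<open>inner_along\<close>.\<close>

lemma inner_flow:
  assumes V: "shear_field V" and f: "f \<in> test_functions UNIV" and g: "g \<in> test_functions UNIV"
  shows "inner (to_l2 (flow V s f)) (to_l2 (flow V s g)) = inner (to_l2 f) (to_l2 g)"
proof -
  let ?I = "\<lambda>s. inner (to_l2 (flow V s f)) (to_l2 (flow V s g))"
  have "(?I has_real_derivative 0) (at s)" for s
  proof -
    have "((\<lambda>s. to_l2 (flow V s h)) has_derivative (\<lambda>x. x *\<^sub>R to_l2 (along V (flow V s h)))) (at s)"
      if "h \<in> test_functions UNIV" for h
      using flow_has_vector_derivative[OF V that, of s]
      by (simp add: has_vector_derivative_def along_flow[OF V test_smooth[OF that]])
    from has_derivative_inner[OF this[OF f] this[OF g]]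
    have "(?I has_derivative (\<lambda>x. inner (to_l2 (flow V s f)) (x *\<^sub>R to_l2 (along V (flow V s g)))
        + inner (x *\<^sub>R to_l2 (along V (flow V s f))) (to_l2 (flow V s g)))) (at s)" .
    also have "(\<lambda>x. inner (to_l2 (flow V s f)) (x *\<^sub>R to_l2 (along V (flow V s g)))
        + inner (x *\<^sub>R to_l2 (along V (flow V s f))) (to_l2 (flow V s g))) = (\<lambda>x. 0 * x)"
      using inner_along[OF V test_flow[OF V f] test_flow[OF V g], of s s]
      by (simp add: fun_eq_iff)
    finally show ?thesis unfolding has_field_derivative_def .
  qed
  then have "?I s = ?I 0" by (intro DERIV_isconst_all) auto
  then show ?thesis by (simp add: flow_0)
qed

lemma norm_flow:
  assumes "shear_field V" "f \<in> test_functions UNIV"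
  shows "norm (to_l2 (flow V s f)) = norm (to_l2 f)"
  by (simp add: norm_eq_sqrt_inner inner_flow assms)

text \<open>The curve \<open>s \<mapsto> flow V s f\<close> in L2 has constant speed
  \<open>norm (along V f)\<close>, because the flow is isometric and commutes with
  \<open>along V\<close>.\<close>

lemma norm_flow_diff:
  assumes V: "shear_field V" and f: "f \<in> test_functions UNIV"
  shows "norm (to_l2 (flow V s f) - to_l2 f) \<le> \<bar>s\<bar> * norm (to_l2 (along V f))"
proof -
  have "norm (to_l2 (flow V s f) - to_l2 (flow V 0 f)) \<le> norm (to_l2 (along V f)) * norm (s - 0)"
  proof (rule differentiable_bound[of UNIV _ "\<lambda>s h. h *\<^sub>R to_l2 (flow V s (along V f))"])
    show "((\<lambda>s. to_l2 (flow V s f)) has_derivative (\<lambda>h. h *\<^sub>R to_l2 (flow V s (along V f)))) (at s)" for s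
      using flow_has_vector_derivative[OF V f] by (simp add: has_vector_derivative_def)
    show "onorm (\<lambda>h. h *\<^sub>R to_l2 (flow V s (along V f))) \<le> norm (to_l2 (along V f))" for s
      by (rule onorm_le) (simp add: norm_flow[OF V test_along[OF V f]] mult.commute)
  qed auto
  then show ?thesis by (simp add: flow_0 mult.commute)
qed

lemma test_weak_eqI:
  assumes f: "f \<in> test_functions UNIV" and g: "g \<in> test_functions UNIV"
    and eq: "\<And>h. h \<in> test_functions UNIV \<Longrightarrow> inner (to_l2 f) (to_l2 h) = inner (to_l2 g) (to_l2 h)"
  shows "f = g"
proof -
  have "inner (to_l2 f - to_l2 g) (to_l2 (\<lambda>z. f z - g z)) = 0"
    using eq[OF test_diff[OF f g]] by (simp add: inner_diff_left)
  then have "to_l2 f = to_l2 g"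
    using f g by (simp add: to_l2_diff test_sq_integrable)
  then show ?thesis by (rule to_l2_test_inject[OF f g])
qed

lemma dir_deriv_translate:
  assumes "smooth_on UNIV f"
  shows "dir_deriv v (flow (\<lambda>z. w) s f) = flow (\<lambda>z. w) s (dir_deriv v f)"
  using dir_deriv_affine[OF smooth_differentiable[OF assms] bounded_linear_ident, of v "s *\<^sub>R w"]
  by (simp add: flow_def[abs_def] add.commute)

text \<open>Second derivatives are compared weakly. Translation along \<open>w\<close> commutes with
  \<open>dir_deriv v\<close>, so moving \<open>dir_deriv v\<close> onto \<open>h\<close> commutes
  with translating \<open>f\<close>. Differentiating in the translation parameter at 0 and
  integrating by parts once more gives the identity against every test function \<open>h\<close>,
  and continuity makes it pointwise.\<close>

lemma dir_deriv_commute: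
  assumes f: "f \<in> test_functions UNIV"
  shows "dir_deriv v (dir_deriv w f) = dir_deriv w (dir_deriv v f)"
proof (rule test_weak_eqI)
  fix h :: "'a \<Rightarrow> real" assume h: "h \<in> test_functions UNIV"
  let ?W = "\<lambda>z. w" and ?V = "\<lambda>z. v"
  note W = shear_field_const[of w] and V = shear_field_const[of v]
  note dv = test_dir_deriv
  have inner_deriv: "((\<lambda>s. inner (to_l2 (flow ?W s g)) (to_l2 k)) has_real_derivative
      inner (to_l2 (dir_deriv w g)) (to_l2 k)) (at 0)" if "g \<in> test_functions UNIV" for g k
    using bounded_linear.has_vector_derivative[OF bounded_linear_inner_left
        flow_has_vector_derivative_0[OF W that]]
    by (simp add: along_const has_real_derivative_iff_has_vector_derivative)
  have "inner (to_l2 (flow ?W s (dir_deriv v f))) (to_l2 h)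
      = - inner (to_l2 (flow ?W s f)) (to_l2 (dir_deriv v h))" for s
    using inner_along[OF V test_flow[OF W f] h, of s]
    by (simp add: along_const dir_deriv_translate[OF test_smooth[OF f]])
  then have "((\<lambda>s. - inner (to_l2 (flow ?W s f)) (to_l2 (dir_deriv v h))) has_real_derivative
      inner (to_l2 (dir_deriv w (dir_deriv v f))) (to_l2 h)) (at 0)"
    using inner_deriv[OF dv[OF f], of v h] by simp
  moreover have "((\<lambda>s. - inner (to_l2 (flow ?W s f)) (to_l2 (dir_deriv v h))) has_real_derivative
      - inner (to_l2 (dir_deriv w f)) (to_l2 (dir_deriv v h))) (at 0)"
    by (rule DERIV_minus[OF inner_deriv[OF f]])
  ultimately have "inner (to_l2 (dir_deriv w (dir_deriv v f))) (to_l2 h)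
      = - inner (to_l2 (dir_deriv w f)) (to_l2 (dir_deriv v h))"
    by (rule DERIV_unique)
  also have "\<dots> = inner (to_l2 (dir_deriv v (dir_deriv w f))) (to_l2 h)"
    using inner_along[OF V dv[OF f] h] by (simp add: along_const)
  finally show "inner (to_l2 (dir_deriv v (dir_deriv w f))) (to_l2 h)
      = inner (to_l2 (dir_deriv w (dir_deriv v f))) (to_l2 h)" ..
qed (intro test_dir_deriv f)+

subsection \<open>Horizontal fields\<close>

text \<open>The sum type indexes the 2n horizontal fields uniformly: \<open>Inl p\<close> stands for
  \<open>X_field p\<close>, \<open>Inr p\<close> for \<open>Y_field p\<close>. In the companion
  functions, \<open>hbase j\<close> is the constant horizontal part of the field,
  \<open>hslope j\<close> its vertical coefficient, and \<open>hcoord j\<close> the coordinate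
  conjugate to it.\<close>

fun hfield :: "'n::finite + 'n \<Rightarrow> 'n heis \<Rightarrow> 'n heis" where
  "hfield (Inl p) = X_field p"
| "hfield (Inr p) = Y_field p"

fun hcoord :: "'n::finite + 'n \<Rightarrow> 'n heis \<Rightarrow> real" where
  "hcoord (Inl p) z = fst z $ p"
| "hcoord (Inr p) z = fst (snd z) $ p"

fun hbase :: "'n::finite + 'n \<Rightarrow> 'n heis" where
  "hbase (Inl p) = (axis p 1, 0, 0)"
| "hbase (Inr p) = (0, axis p 1, 0)"

fun hslope :: "'n::finite + 'n \<Rightarrow> 'n heis \<Rightarrow> real" where
  "hslope (Inl p) z = fst (snd z) $ p / 2"
| "hslope (Inr p) z = - (fst z $ p) / 2"

definition tbase :: "'n::finite heis" where "tbase = (0, 0, 1)"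

text \<open>These are the structure constants of the Lie algebra: the commutator of
  \<open>hderiv j\<close> and \<open>hderiv k\<close> is \<open>hsymp j k\<close> times the vertical
  derivative, because only the slopes of the fields vary. Up to normalisation this is the standard
  symplectic form.\<close>

definition hsymp :: "'n::finite + 'n \<Rightarrow> 'n + 'n \<Rightarrow> real" where
  "hsymp j k = hslope k (hbase j) - hslope j (hbase k)"

lemma hfield_eq: "hfield j = (\<lambda>z. hbase j + hslope j z *\<^sub>R tbase)"
  by (cases j) (auto simp: X_field_def Y_field_def tbase_def fun_eq_iff)

lemma bounded_linear_hcoord: "bounded_linear (hcoord j)"
proof (cases j)
  case (Inl p)
  have "bounded_linear (\<lambda>z::'a heis. fst z $ p)"
    by (intro bounded_linear_compose[OF bounded_linear_vec_nth bounded_linear_fst])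
  then show ?thesis by (simp add: Inl hcoord.simps[abs_def])
next
  case (Inr p)
  have "bounded_linear (\<lambda>z::'a heis. fst (snd z) $ p)"
    by (intro bounded_linear_compose[OF bounded_linear_vec_nth]
        bounded_linear_compose[OF bounded_linear_fst bounded_linear_snd])
  then show ?thesis by (simp add: Inr hcoord.simps[abs_def])
qed

lemma hslope_eq: "\<exists>k c. hslope j = (\<lambda>z. c * hcoord k z)"
proof (cases j)
  case (Inl p)
  then show ?thesis by (intro exI[of _ "Inr p"] exI[of _ "1/2"]) auto
next
  case (Inr p)
  then show ?thesis by (intro exI[of _ "Inl p"] exI[of _ "-1/2"]) auto
qed

lemma bounded_linear_hslope: "bounded_linear (hslope j)"
  using hslope_eq[of j] bounded_linear_compose[OF bounded_linear_mult_right bounded_linear_hcoord]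
  by metis

lemma hslope_tbase [simp]: "hslope j tbase = 0"
  by (cases j) (auto simp: tbase_def)

lemma hcoord_tbase [simp]: "hcoord j tbase = 0"
  by (cases j) (auto simp: tbase_def)

lemma hslope_hbase_self [simp]: "hslope j (hbase j) = 0"
  by (cases j) auto

lemma hcoord_hbase: "hcoord j (hbase k) = (if j = k then 1 else 0)"
  by (cases j; cases k) (auto simp: axis_def)

lemma shear_field_hfield: "shear_field (hfield j)"
  unfolding shear_field_def
proof (intro exI conjI)
  note lin = bounded_linear.linear[OF bounded_linear_hslope[of j]]
  show "bounded_linear (\<lambda>z. hslope j z *\<^sub>R (tbase :: 'a heis))"
    by (rule bounded_linear_scaleR_const[OF bounded_linear_hslope])
  show "hfield j = (\<lambda>z. hbase j + hslope j z *\<^sub>R tbase)" by (rule hfield_eq)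
  show "\<forall>z. hslope j (hfield j z) *\<^sub>R (tbase :: 'a heis) = 0"
    by (simp add: hfield_eq linear_add[OF lin] linear_cmul[OF lin])
  show "\<forall>b\<in>Basis. hslope j b *\<^sub>R tbase \<bullet> b = 0"
  proof
    fix b :: "'a heis" assume "b \<in> Basis"
    then consider (t) "b = tbase" | (o) "tbase \<bullet> b = 0"
      unfolding Basis_prod_def tbase_def by fastforce
    then show "hslope j b *\<^sub>R tbase \<bullet> b = 0" by cases auto
  qed
qed

abbreviation hderiv :: "'n::finite + 'n \<Rightarrow> ('n heis \<Rightarrow> real) \<Rightarrow> 'n heis \<Rightarrow> real" where
  "hderiv j \<equiv> along (hfield j)"

lemma hderiv_eq:
  assumes "smooth_on UNIV f"
  shows "hderiv j f = (\<lambda>z. dir_deriv (hbase j) f z + hslope j z * dir_deriv tbase f z)"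
  using linear_add[OF linear_frechet_derivative[OF smooth_differentiable[OF assms]]]
    linear_cmul[OF linear_frechet_derivative[OF smooth_differentiable[OF assms]]]
  by (simp add: along_def dir_deriv_def hfield_eq fun_eq_iff)

lemma hderiv_hcoord: "hderiv k (hcoord j) = (\<lambda>z. if j = k then 1 else 0)"
proof -
  note lin = bounded_linear.linear[OF bounded_linear_hcoord[of j]]
  show ?thesis
    by (simp add: along_linear[OF bounded_linear_hcoord] hfield_eq linear_add[OF lin]
        linear_cmul[OF lin] hcoord_hbase)
qed

lemma dir_deriv_hslope_mult:
  assumes "smooth_on UNIV f"
  shows "dir_deriv v (\<lambda>z. hslope j z * f z) = (\<lambda>z. hslope j z * dir_deriv v f z + hslope j v * f z)"
proof -
  have "hslope j differentiable at z" for z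
    by (rule bounded_linear_imp_differentiable[OF bounded_linear_hslope])
  from dir_deriv_mult[OF this smooth_differentiable[OF assms], of v]
  show ?thesis by (simp add: dir_deriv_linear[OF bounded_linear_hslope])
qed

lemma smooth_hslope_mult: "smooth_on UNIV f \<Longrightarrow> smooth_on UNIV (\<lambda>z. hslope j z * f z)"
  by (rule smooth_mult[OF smooth_linear[OF bounded_linear_hslope]])

lemma dir_deriv_hderiv:
  assumes "f \<in> test_functions UNIV"
  shows "dir_deriv v (hderiv k f) = (\<lambda>z. dir_deriv v (dir_deriv (hbase k) f) z +
      hslope k z * dir_deriv v (dir_deriv tbase f) z + hslope k v * dir_deriv tbase f z)"
proof -
  have s: "smooth_on UNIV (dir_deriv w f)" for w
    by (rule smooth_dir_deriv[OF test_smooth[OF assms]])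
  show ?thesis
    unfolding hderiv_eq[OF test_smooth[OF assms]]
    by (simp add: dir_deriv_add smooth_differentiable s smooth_hslope_mult dir_deriv_hslope_mult add_ac)
qed

lemma tderiv_hderiv:
  assumes "f \<in> test_functions UNIV"
  shows "dir_deriv tbase (hderiv k f) = hderiv k (dir_deriv tbase f)"
  by (simp add: dir_deriv_hderiv[OF assms] hderiv_eq[OF smooth_dir_deriv[OF test_smooth[OF assms]]]
      dir_deriv_commute[OF assms, of tbase "hbase k"])

lemma hderiv_commutator:
  assumes f: "f \<in> test_functions UNIV"
  shows "hderiv j (hderiv k f) z = hderiv k (hderiv j f) z + hsymp j k * dir_deriv tbase f z"
proof -
  have s: "smooth_on UNIV (hderiv i f)" for i
    by (rule smooth_along[OF shear_field_hfield test_smooth[OF f]])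
  show ?thesis
    unfolding hderiv_eq[OF s] dir_deriv_hderiv[OF f] hsymp_def
      dir_deriv_commute[OF f, of "hbase j" "hbase k"]
      dir_deriv_commute[OF f, of tbase "hbase j"] dir_deriv_commute[OF f, of tbase "hbase k"]
    by (simp add: algebra_simps)
qed

lemma hsymp_eq:
  "hsymp (Inl p) (Inl q) = 0" "hsymp (Inr p) (Inr q) = 0"
  "hsymp (Inl p) (Inr q) = (if p = q then - 1 else 0)"
  "hsymp (Inr p) (Inl q) = (if p = q then 1 else 0)"
  by (auto simp: hsymp_def axis_def)

lemma sum_hsymp_sq:
  "(\<Sum>j\<in>(UNIV :: ('n::finite + 'n) set). \<Sum>k\<in>UNIV. (hsymp j k)\<^sup>2) = 2 * real CARD('n)"
proof -
  have split: "(\<Sum>j\<in>UNIV. g j) = (\<Sum>p\<in>UNIV. g (Inl p)) + (\<Sum>p\<in>UNIV. g (Inr p))"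
    for g :: "'n + 'n \<Rightarrow> real"
    unfolding UNIV_Plus_UNIV[symmetric] by (subst sum.Plus) auto
  show ?thesis unfolding split hsymp_eq by (simp add: if_distrib[of "\<lambda>x. x\<^sup>2"] cong: if_cong)
qed

lemma kohn_laplacian_eq: "kohn_laplacian f = (\<lambda>z. \<Sum>j\<in>UNIV. hderiv j (hderiv j f) z)"
proof -
  have split: "(\<Sum>j\<in>UNIV. g j) = (\<Sum>p\<in>UNIV. g (Inl p)) + (\<Sum>p\<in>UNIV. g (Inr p))"
    for g :: "'a + 'a \<Rightarrow> real"
    unfolding UNIV_Plus_UNIV[symmetric] by (subst sum.Plus) auto
  show ?thesis
    by (simp add: kohn_laplacian_def[abs_def] split sum.distrib numeral_2_eq_2)
qed

definition sublap :: "('n::finite heis \<Rightarrow> real) \<Rightarrow> 'n heis \<Rightarrow> real" where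
  "sublap f z = - (\<Sum>j\<in>UNIV. hderiv j (hderiv j f) z)"

lemma sublap_eq: "sublap f = (\<lambda>z. - kohn_laplacian f z)"
  by (simp add: sublap_def[abs_def] kohn_laplacian_eq)

lemma test_hderiv: "f \<in> test_functions \<Omega> \<Longrightarrow> hderiv j f \<in> test_functions \<Omega>"
  by (rule test_along[OF shear_field_hfield])

lemma test_sublap: "f \<in> test_functions \<Omega> \<Longrightarrow> sublap f \<in> test_functions \<Omega>"
  unfolding sublap_def[abs_def]
  by (intro test_uminus test_sum test_hderiv)

lemmas test_sq = test_sq_integrable[of _ UNIV]

lemma to_l2_sublap:
  assumes "f \<in> test_functions UNIV"
  shows "to_l2 (sublap f) = - (\<Sum>j\<in>UNIV. to_l2 (hderiv j (hderiv j f)))"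
proof -
  have "to_l2 (\<lambda>z. \<Sum>j\<in>J. hderiv j (hderiv j f) z) = (\<Sum>j\<in>J. to_l2 (hderiv j (hderiv j f)))" for J
    by (induction J rule: infinite_finite_induct)
      (simp_all add: to_l2_zero to_l2_add test_sq test_sum test_hderiv assms)
  then show ?thesis
    unfolding sublap_def[abs_def]
    by (simp add: to_l2_uminus test_sq test_sum test_hderiv assms)
qed

lemmas inner_hderiv = inner_along[OF shear_field_hfield]

lemma inner_sublap:
  assumes "f \<in> test_functions UNIV" "g \<in> test_functions UNIV"
  shows "inner (to_l2 (sublap f)) (to_l2 g) = (\<Sum>j\<in>UNIV. inner (to_l2 (hderiv j f)) (to_l2 (hderiv j g)))"
  by (simp add: to_l2_sublap assms inner_sum_left inner_hderiv test_hderiv sum_negf)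

text \<open>One derivative of each square is moved to the other side, at the price of commutators.
  This gives \<open>half\<close>, an expression that is not symmetric in \<open>j\<close> and
  \<open>k\<close>. Averaging it over both orders combines the two linear commutator terms, since
  \<open>hsymp\<close> is antisymmetric, into a multiple of the squared vertical derivative, the
  only negative contribution.\<close>

lemma inner_hderiv_square:
  assumes f: "f \<in> test_functions UNIV"
  shows "2 * inner (to_l2 (hderiv j (hderiv j f))) (to_l2 (hderiv k (hderiv k f)))
    = (norm (to_l2 (hderiv j (hderiv k f))))\<^sup>2 + (norm (to_l2 (hderiv k (hderiv j f))))\<^sup>2
      - 2 * (hsymp j k)\<^sup>2 * (norm (to_l2 (dir_deriv tbase f)))\<^sup>2"
proof -
  let ?Z = "dir_deriv tbase"
  note tf = test_hderiv test_dir_deriv f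
  have comm: "to_l2 (hderiv j (hderiv k g)) = to_l2 (hderiv k (hderiv j g)) + hsymp j k *\<^sub>R to_l2 (?Z g)"
    if "g \<in> test_functions UNIV" for j k and g :: "'a heis \<Rightarrow> real"
  proof -
    have "hderiv j (hderiv k g) = (\<lambda>z. hderiv k (hderiv j g) z + hsymp j k * ?Z g z)"
      by (rule ext, rule hderiv_commutator[OF that])
    then show ?thesis
      by (simp only:) (simp add: to_l2_add to_l2_scale test_sq test_hderiv
          test_dir_deriv test_scale that)
  qed
  have half: "inner (to_l2 (hderiv j (hderiv j f))) (to_l2 (hderiv k (hderiv k f)))
      = (norm (to_l2 (hderiv k (hderiv j f))))\<^sup>2
        + 2 * hsymp j k * inner (to_l2 (hderiv k (hderiv j f))) (to_l2 (?Z f))" for j k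
  proof -
    have "inner (to_l2 (hderiv j (hderiv j f))) (to_l2 (hderiv k (hderiv k f)))
        = - inner (to_l2 (hderiv j f)) (to_l2 (hderiv j (hderiv k (hderiv k f))))"
      by (rule inner_hderiv; intro tf)
    also have "to_l2 (hderiv j (hderiv k (hderiv k f)))
        = to_l2 (hderiv k (hderiv j (hderiv k f))) + hsymp j k *\<^sub>R to_l2 (hderiv k (?Z f))"
      unfolding tderiv_hderiv[OF f, symmetric] by (rule comm) (intro tf)
    also have "inner (to_l2 (hderiv j f)) (to_l2 (hderiv k (hderiv j (hderiv k f)))
          + hsymp j k *\<^sub>R to_l2 (hderiv k (?Z f)))
        = - inner (to_l2 (hderiv k (hderiv j f))) (to_l2 (hderiv j (hderiv k f)))
          - hsymp j k * inner (to_l2 (hderiv k (hderiv j f))) (to_l2 (?Z f))"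
      using inner_hderiv[of "hderiv j f" "hderiv j (hderiv k f)" k]
        inner_hderiv[of "hderiv j f" "?Z f" k] by (simp add: tf inner_add_right)
    also have "to_l2 (hderiv j (hderiv k f)) = to_l2 (hderiv k (hderiv j f)) + hsymp j k *\<^sub>R to_l2 (?Z f)"
      by (rule comm[OF f])
    finally show ?thesis by (simp add: inner_add_right power2_norm_eq_inner)
  qed
  have anti: "hsymp k j = - hsymp j k" by (simp add: hsymp_def)
  have "2 * inner (to_l2 (hderiv j (hderiv j f))) (to_l2 (hderiv k (hderiv k f)))
      = (norm (to_l2 (hderiv j (hderiv k f))))\<^sup>2 + (norm (to_l2 (hderiv k (hderiv j f))))\<^sup>2
        - 2 * hsymp j k * inner (to_l2 (hderiv j (hderiv k f)) - to_l2 (hderiv k (hderiv j f))) (to_l2 (?Z f))"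
    using half[of j k] half[of k j] anti by (simp add: inner_commute inner_diff_left algebra_simps)
  also have "to_l2 (hderiv j (hderiv k f)) - to_l2 (hderiv k (hderiv j f)) = hsymp j k *\<^sub>R to_l2 (?Z f)"
    by (simp add: comm[OF f, of j k])
  finally show ?thesis by (simp add: dot_square_norm) (simp add: power2_eq_square)
qed

text \<open>Summing \<open>inner_hderiv_square\<close> over all pairs expresses
  \<open>norm (L f)^2\<close> as the sum of all squared second derivatives minus the vertical term;
  its coefficient is 2n because each index has exactly one conjugate partner. Of the second
  derivatives only the diagonal ones are kept. The pure squares are thus controlled as soon as the
  vertical derivative is.\<close>

lemma sum_hderiv_square_le:
  fixes f :: "'n::finite heis \<Rightarrow> real"
  assumes f: "f \<in> test_functions UNIV"
  shows "(\<Sum>j\<in>UNIV. (norm (to_l2 (hderiv j (hderiv j f))))\<^sup>2)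
    \<le> (norm (to_l2 (sublap f)))\<^sup>2 + 2 * real CARD('n) * (norm (to_l2 (dir_deriv tbase f)))\<^sup>2"
proof -
  let ?z = "(norm (to_l2 (dir_deriv tbase f)))\<^sup>2"
  let ?n = "\<lambda>j k. (norm (to_l2 (hderiv j (hderiv k f))))\<^sup>2"
  have "(norm (to_l2 (sublap f)))\<^sup>2
      = (\<Sum>j\<in>UNIV. \<Sum>k\<in>UNIV. inner (to_l2 (hderiv j (hderiv j f))) (to_l2 (hderiv k (hderiv k f))))"
    unfolding to_l2_sublap[OF f] power2_norm_eq_inner
    by (simp add: inner_sum_left inner_sum_right sum_negf) (rule sum.swap)
  also have "\<dots> = (\<Sum>j\<in>UNIV. \<Sum>k\<in>UNIV. (?n j k + ?n k j) / 2 - (hsymp j k)\<^sup>2 * ?z)"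
    using inner_hderiv_square[OF f] by (intro sum.cong refl) (simp add: field_simps)
  also have "\<dots> = (\<Sum>j\<in>UNIV. \<Sum>k\<in>UNIV. (?n j k + ?n k j) / 2) - 2 * real CARD('n) * ?z"
    by (simp add: sum_subtractf sum_hsymp_sq flip: sum_distrib_right)
  finally have e: "(\<Sum>j\<in>UNIV. \<Sum>k\<in>UNIV. (?n j k + ?n k j) / 2)
      = (norm (to_l2 (sublap f)))\<^sup>2 + 2 * real CARD('n) * ?z" by simp
  have "(\<Sum>j\<in>UNIV. ?n j j) \<le> (\<Sum>j\<in>UNIV. \<Sum>k\<in>UNIV. (?n j k + ?n k j) / 2)"
  proof (rule sum_mono)
    fix j
    show "?n j j \<le> (\<Sum>k\<in>UNIV. (?n j k + ?n k j) / 2)"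
      using member_le_sum[of j UNIV "\<lambda>k. (?n j k + ?n k j) / 2"] by simp
  qed
  then show ?thesis unfolding e .
qed

subsection \<open>Vertical regularity\<close>

abbreviation tflow :: "real \<Rightarrow> ('n::finite heis \<Rightarrow> real) \<Rightarrow> 'n heis \<Rightarrow> real" where
  "tflow \<equiv> flow (\<lambda>z. tbase)"

definition tdiff :: "real \<Rightarrow> ('n::finite heis \<Rightarrow> real) \<Rightarrow> 'n heis \<Rightarrow> real" where
  "tdiff s f z = tflow s f z - f z"

lemmas shear_field_tbase = shear_field_const[of tbase]

lemma test_tflow: "f \<in> test_functions UNIV \<Longrightarrow> tflow s f \<in> test_functions UNIV"
  by (rule test_flow[OF shear_field_tbase])

lemma test_tdiff: "f \<in> test_functions UNIV \<Longrightarrow> tdiff s f \<in> test_functions UNIV"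
  unfolding tdiff_def[abs_def] by (intro test_diff test_tflow)

lemma to_l2_tdiff: "f \<in> test_functions UNIV \<Longrightarrow> to_l2 (tdiff s f) = to_l2 (tflow s f) - to_l2 f"
  unfolding tdiff_def[abs_def] by (intro to_l2_diff test_sq test_tflow)

lemma norm_tflow: "f \<in> test_functions UNIV \<Longrightarrow> norm (to_l2 (tflow s f)) = norm (to_l2 f)"
  by (rule norm_flow[OF shear_field_tbase])

lemma norm_tdiff_le: "f \<in> test_functions UNIV \<Longrightarrow> norm (to_l2 (tdiff s f)) \<le> 2 * norm (to_l2 f)"
  using norm_triangle_ineq4[of "to_l2 (tflow s f)" "to_l2 f"] by (simp add: to_l2_tdiff norm_tflow)

lemma tdiff_commute: "tdiff s (tdiff r f) = tdiff r (tdiff s f)"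
  by (simp add: tdiff_def flow_def fun_eq_iff algebra_simps)

lemma inner_tflow:
  assumes "f \<in> test_functions UNIV" "g \<in> test_functions UNIV"
  shows "inner (to_l2 (tflow s f)) (to_l2 g) = inner (to_l2 f) (to_l2 (tflow (- s) g))"
  using inner_flow[OF shear_field_tbase assms(1) test_tflow[OF assms(2)], of s "- s"]
  by (simp add: flow_flow[OF shear_field_tbase] flow_0)

lemma inner_tdiff:
  assumes "f \<in> test_functions UNIV" "g \<in> test_functions UNIV"
  shows "inner (to_l2 (tdiff s f)) (to_l2 g) = inner (to_l2 f) (to_l2 (tdiff (- s) g))"
  by (simp add: to_l2_tdiff assms inner_diff_left inner_diff_right inner_tflow)

text \<open>With \<open>T\<close> the translation by \<open>s\<close>, the operator
  \<open>T^2 - 1\<close> factors as \<open>(T + 1) (T - 1)\<close>. The identity is the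
  parallelogram law for \<open>T g\<close> and \<open>g\<close>, where \<open>g = tdiff s f\<close>
  and \<open>T\<close> is isometric.\<close>

lemma norm_tdiff_double:
  assumes f: "f \<in> test_functions UNIV"
  shows "(norm (to_l2 (tdiff (2 * s) f)))\<^sup>2
    = 4 * (norm (to_l2 (tdiff s f)))\<^sup>2 - (norm (to_l2 (tdiff s (tdiff s f))))\<^sup>2"
proof -
  let ?g = "tdiff s f"
  have g: "?g \<in> test_functions UNIV" by (rule test_tdiff[OF f])
  have "tdiff (2 * s) f = (\<lambda>z. tflow s ?g z + ?g z)"
    by (simp add: tdiff_def flow_def fun_eq_iff algebra_simps flip: scaleR_add_left)
  then have 1: "to_l2 (tdiff (2 * s) f) = to_l2 (tflow s ?g) + to_l2 ?g"
    by (simp add: to_l2_add test_sq test_tflow g)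
  have par: "(norm (x + y))\<^sup>2 + (norm (x - y))\<^sup>2 = 2 * (norm x)\<^sup>2 + 2 * (norm y)\<^sup>2" for x y :: "'a heis l2"
    by (simp add: power2_norm_eq_inner algebra_simps inner_commute)
  show ?thesis
    using par[of "to_l2 (tflow s ?g)" "to_l2 ?g"]
    unfolding 1 to_l2_tdiff[OF g] norm_tflow[OF g] by simp
qed

lemma hslope_translate: "hslope j (z + s *\<^sub>R tbase) = hslope j z"
  using linear_add[OF bounded_linear.linear[OF bounded_linear_hslope[of j]]]
    linear_cmul[OF bounded_linear.linear[OF bounded_linear_hslope[of j]]] by simp

lemma hderiv_tflow:
  assumes "smooth_on UNIV f" shows "hderiv j (tflow s f) = tflow s (hderiv j f)"
  unfolding hderiv_eq[OF assms] hderiv_eq[OF smooth_flow[OF shear_field_tbase assms]]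
  by (simp add: dir_deriv_translate[OF assms] flow_def fun_eq_iff hslope_translate)

lemma hderiv_tdiff:
  assumes "smooth_on UNIV f" shows "hderiv j (tdiff s f) = tdiff s (hderiv j f)"
  unfolding tdiff_def[abs_def]
  by (simp add: along_diff[OF smooth_flow[OF shear_field_tbase assms] assms] hderiv_tflow[OF assms])

lemma sublap_tdiff:
  assumes "f \<in> test_functions UNIV" shows "sublap (tdiff s f) = tdiff s (sublap f)"
proof -
  have s: "smooth_on UNIV f" "smooth_on UNIV (hderiv j f)" for j
    using assms by (auto intro: test_smooth test_hderiv)
  show ?thesis
    by (simp add: sublap_def[abs_def] hderiv_tdiff s)
      (simp add: tdiff_def flow_def fun_eq_iff sum_subtractf)
qed

text \<open>The horizontal flows are right translations by one-parameter subgroups. In a group of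
  step two their commutator has no terms of higher order, so the formula is exact and not merely
  asymptotic.\<close>

lemma tflow_eq_commutator:
  "tflow (r\<^sup>2) f = flow (Y_field p) r (flow (X_field p) r (flow (Y_field p) (- r) (flow (X_field p) (- r) f)))"
proof
  fix z :: "'a heis"
  obtain x y t where z: "z = (x, y, t)" by (cases z)
  show "tflow (r\<^sup>2) f z = flow (Y_field p) r (flow (X_field p) r
      (flow (Y_field p) (- r) (flow (X_field p) (- r) f))) z"
    by (simp add: flow_def X_field_def Y_field_def z tbase_def power2_eq_square algebra_simps
        add_divide_distrib diff_divide_distrib)
qed

text \<open>The four flows of the commutator are peeled off one at a time. Each is an isometry, so
  removing it costs only the displacement of \<open>f\<close> itself, at most \<open>r\<close> times
  the norm of one horizontal derivative. The time \<open>r\<close> is the square root of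
  \<open>s\<close>: a horizontal derivative is worth half a vertical one.\<close>

lemma norm_tdiff_le_hderiv:
  assumes f: "f \<in> test_functions UNIV" and "s \<ge> 0"
  shows "norm (to_l2 (tdiff s f))
    \<le> 2 * sqrt s * (norm (to_l2 (hderiv (Inl p) f)) + norm (to_l2 (hderiv (Inr p) f)))"
proof -
  define r where "r = sqrt s"
  have r: "r \<ge> 0" "s = r\<^sup>2" using assms(2) by (auto simp: r_def)
  note V = shear_field_hfield[of "Inl p"] shear_field_hfield[of "Inr p"]
  let ?x = "r * norm (to_l2 (hderiv (Inl p) f))" and ?y = "r * norm (to_l2 (hderiv (Inr p) f))"
  have step: "norm (to_l2 (flow (hfield j) q g) - to_l2 f)
      \<le> \<bar>q\<bar> * norm (to_l2 (hderiv j f)) + norm (to_l2 g - to_l2 f)"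
    if "g \<in> test_functions UNIV" for j q g
  proof -
    note W = shear_field_hfield[of j]
    have "(\<lambda>z. flow (hfield j) q g z - flow (hfield j) q f z) = flow (hfield j) q (\<lambda>z. g z - f z)"
      by (simp add: flow_def fun_eq_iff)
    then have "to_l2 (flow (hfield j) q g) - to_l2 (flow (hfield j) q f)
        = to_l2 (flow (hfield j) q (\<lambda>z. g z - f z))"
      by (simp add: test_sq test_flow[OF W] that f flip: to_l2_diff)
    then have "norm (to_l2 (flow (hfield j) q g) - to_l2 (flow (hfield j) q f)) = norm (to_l2 g - to_l2 f)"
      by (simp add: norm_flow[OF W] test_diff that f to_l2_diff test_sq)
    then show ?thesis
      using norm_triangle_ineq[of "to_l2 (flow (hfield j) q g) - to_l2 (flow (hfield j) q f)"
          "to_l2 (flow (hfield j) q f) - to_l2 f"] norm_flow_diff[OF W f, of q] by simp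
  qed
  let ?f1 = "flow (hfield (Inl p)) (- r) f"
  let ?f2 = "flow (hfield (Inr p)) (- r) ?f1"
  let ?f3 = "flow (hfield (Inl p)) r ?f2"
  have t: "?f1 \<in> test_functions UNIV" "?f2 \<in> test_functions UNIV" "?f3 \<in> test_functions UNIV"
    by (intro test_flow V f)+
  have "norm (to_l2 ?f1 - to_l2 f) \<le> ?x" using norm_flow_diff[OF V(1) f, of "- r"] r by simp
  moreover have "norm (to_l2 ?f2 - to_l2 f) \<le> ?y + norm (to_l2 ?f1 - to_l2 f)"
    using step[OF t(1), of "Inr p" "- r"] r by simp
  moreover have "norm (to_l2 ?f3 - to_l2 f) \<le> ?x + norm (to_l2 ?f2 - to_l2 f)"
    using step[OF t(2), of "Inl p" r] r by simp
  moreover have "norm (to_l2 (tflow s f) - to_l2 f) \<le> ?y + norm (to_l2 ?f3 - to_l2 f)"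
    using step[OF t(3), of "Inr p" r] r tflow_eq_commutator[of r f p] by simp
  ultimately have "norm (to_l2 (tflow s f) - to_l2 f) \<le> 2 * ?x + 2 * ?y" by linarith
  then show ?thesis
    unfolding to_l2_tdiff[OF f] r_def[symmetric] by (simp add: algebra_simps)
qed

text \<open>A single conjugate pair \<open>Inl p\<close>, \<open>Inr p\<close> is enough, as the
  remaining fields contribute nonnegative terms to \<open><L f, f>\<close>. The factor 8 is
  \<open>2^2\<close> from the commutator bound times 2 from
  \<open>(a + b)^2 \<le> 2 (a^2 + b^2)\<close>.\<close>

lemma norm_tdiff_sq_le_sublap:
  assumes f: "f \<in> test_functions UNIV" and "s \<ge> 0"
  shows "(norm (to_l2 (tdiff s f)))\<^sup>2 \<le> 8 * s * inner (to_l2 (sublap f)) (to_l2 f)"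
proof -
  fix p :: 'a
  let ?X = "norm (to_l2 (hderiv (Inl p) f))" and ?Y = "norm (to_l2 (hderiv (Inr p) f))"
  have "(norm (to_l2 (tdiff s f)))\<^sup>2 \<le> (2 * sqrt s * (?X + ?Y))\<^sup>2"
    by (intro power_mono norm_tdiff_le_hderiv assms) auto
  also have "\<dots> = 4 * s * (?X + ?Y)\<^sup>2" using assms(2) by (simp add: power_mult_distrib)
  also have "\<dots> \<le> 4 * s * (2 * (?X\<^sup>2 + ?Y\<^sup>2))"
    using assms(2) sum_squares_bound[of ?X ?Y] by (intro mult_left_mono) (auto simp: power2_sum)
  also have "\<dots> \<le> 4 * s * (2 * inner (to_l2 (sublap f)) (to_l2 f))"
  proof -
    have "(\<Sum>j\<in>{Inl p, Inr p}. (norm (to_l2 (hderiv j f)))\<^sup>2) \<le> (\<Sum>j\<in>UNIV. (norm (to_l2 (hderiv j f)))\<^sup>2)"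
      by (intro sum_mono2) auto
    then show ?thesis using assms(2)
      by (intro mult_left_mono) (auto simp: inner_sublap[OF f f] power2_norm_eq_inner)
  qed
  finally show ?thesis by simp
qed

section \<open>Dyadic vertical differences and their almost orthogonality\<close>

definition ddiff :: "nat \<Rightarrow> ('n::finite heis \<Rightarrow> real) \<Rightarrow> 'n heis \<Rightarrow> real" where
  "ddiff m = tdiff (1 / 2 ^ m)"

lemma test_ddiff: "f \<in> test_functions UNIV \<Longrightarrow> ddiff m f \<in> test_functions UNIV"
  unfolding ddiff_def by (rule test_tdiff)

lemma norm_ddiff_Suc:
  assumes f: "f \<in> test_functions UNIV"
  shows "4 * (norm (to_l2 (ddiff (Suc m) f)))\<^sup>2
    = (norm (to_l2 (ddiff m f)))\<^sup>2 + (norm (to_l2 (ddiff (Suc m) (ddiff (Suc m) f))))\<^sup>2"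
  using norm_tdiff_double[OF f, of "1 / 2 ^ Suc m"] by (simp add: ddiff_def)

text \<open>A square function for the vertical derivative. At vertical frequency \<tau> it
  multiplies the squared norm by \<open>4^m * \<bar>exp (i \<tau> / 2^m) - 1\<bar>^4\<close>, which
  is concentrated at the scales where \<open>2^m\<close> is comparable to
  \<open>\<bar>\<tau>\<bar>\<close>. For \<open>\<bar>\<tau>\<bar> \<ge> 1\<close> the sum over
  \<open>m\<close> is therefore comparable to \<open>\<tau>^2\<close>.\<close>

definition sqfun :: "('n::finite heis \<Rightarrow> real) \<Rightarrow> nat \<Rightarrow> real" where
  "sqfun f m = 4 ^ m * (norm (to_l2 (ddiff m (ddiff m f))))\<^sup>2"

text \<open>A dyadic substitute for \<open>\<bar>\<partial>\<^sub>t\<bar>\<close>.\<close>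

definition absder :: "nat \<Rightarrow> ('n::finite heis \<Rightarrow> real) \<Rightarrow> 'n heis l2" where
  "absder M f = (\<Sum>m<M. 2 ^ m *\<^sub>R to_l2 (tdiff (- (1 / 2 ^ m)) (ddiff m f)))"

lemma sqfun_nonneg: "sqfun f m \<ge> 0"
  by (simp add: sqfun_def)

text \<open>The half derivative bound is applied to \<open>ddiff m f\<close> with step
  \<open>1 / 2^m\<close>. Since \<open>sublap\<close> commutes with vertical translations and the
  adjoint of \<open>tdiff s\<close> is \<open>tdiff (- s)\<close>, one difference can be moved to
  the other side. All scales then pair with the same function \<open>sublap f\<close>, and the sum
  over \<open>m\<close> becomes a single inner product.\<close>

lemma sum_sqfun_le_inner:
  assumes f: "f \<in> test_functions UNIV"
  shows "(\<Sum>m<M. sqfun f m) \<le> 8 * inner (to_l2 (sublap f)) (absder M f)"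
proof -
  have "sqfun f m \<le> 8 * (2 ^ m * inner (to_l2 (sublap f)) (to_l2 (tdiff (- (1 / 2 ^ m)) (ddiff m f))))" for m
  proof -
    have "(norm (to_l2 (ddiff m (ddiff m f))))\<^sup>2
        \<le> 8 * (1 / 2 ^ m) * inner (to_l2 (sublap (ddiff m f))) (to_l2 (ddiff m f))"
      unfolding ddiff_def by (intro norm_tdiff_sq_le_sublap test_tdiff f) simp
    also have "inner (to_l2 (sublap (ddiff m f))) (to_l2 (ddiff m f))
        = inner (to_l2 (sublap f)) (to_l2 (tdiff (- (1 / 2 ^ m)) (ddiff m f)))" (is "_ = ?i")
      unfolding ddiff_def sublap_tdiff[OF f]
      by (intro inner_tdiff test_sublap test_tdiff f)
    finally have "4 ^ m * (norm (to_l2 (ddiff m (ddiff m f))))\<^sup>2 \<le> 4 ^ m * (8 * (1 / 2 ^ m) * ?i)"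
      by (intro mult_left_mono) auto
    also have "4 ^ m * (8 * (1 / 2 ^ m) * ?i) = 8 * (2 ^ m * ?i)"
    proof -
      have "(4::real) ^ m = 2 ^ m * 2 ^ m" unfolding power_mult_distrib[symmetric] by simp
      then show ?thesis by simp
    qed
    finally show ?thesis by (simp add: sqfun_def)
  qed
  then have "(\<Sum>m<M. sqfun f m)
      \<le> (\<Sum>m<M. 8 * (2 ^ m * inner (to_l2 (sublap f)) (to_l2 (tdiff (- (1 / 2 ^ m)) (ddiff m f)))))"
    by (intro sum_mono)
  then show ?thesis
    by (simp add: absder_def inner_sum_right sum_distrib_left)
qed

text \<open>Almost orthogonality. The inner product of the terms of \<open>absder\<close> at scales
  \<open>m\<close> and \<open>l\<close> is, without the weights, the squared norm of
  \<open>ddiff l (ddiff m f)\<close>, because vertical differences commute. The cross sums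
  \<open>c M\<close> between scale \<open>M\<close> and all coarser ones obey a recursion that
  contracts by one half up to diagonal terms.\<close>

lemma norm_absder_sq_le:
  assumes f: "f \<in> test_functions UNIV"
  shows "(norm (absder (Suc M) f))\<^sup>2 \<le> 7 * (\<Sum>m<Suc M. sqfun f m)"
proof -
  define r where "r M = (norm (absder M f))\<^sup>2" for M
  define c where "c M = (\<Sum>m<M. 2 ^ (m + M) * (norm (to_l2 (ddiff M (ddiff m f))))\<^sup>2)" for M
  define e where "e = sqfun f"
  have tf: "ddiff m f \<in> test_functions UNIV" "ddiff m (ddiff l f) \<in> test_functions UNIV" for m l
    by (intro test_ddiff f)+
  have inn: "inner (to_l2 (tdiff (- (1 / 2 ^ m)) (ddiff m f))) (to_l2 (tdiff (- (1 / 2 ^ l)) (ddiff l f)))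
      = (norm (to_l2 (ddiff l (ddiff m f))))\<^sup>2" for m l
  proof -
    have "inner (to_l2 (tdiff (- (1 / 2 ^ m)) (ddiff m f))) (to_l2 (tdiff (- (1 / 2 ^ l)) (ddiff l f)))
        = inner (to_l2 (ddiff l (tdiff (- (1 / 2 ^ m)) (ddiff m f)))) (to_l2 (ddiff l f))"
      unfolding ddiff_def by (rule inner_tdiff[symmetric]; intro test_tdiff f)
    also have "ddiff l (tdiff (- (1 / 2 ^ m)) (ddiff m f)) = tdiff (- (1 / 2 ^ m)) (ddiff l (ddiff m f))"
      unfolding ddiff_def by (rule tdiff_commute)
    also have "inner (to_l2 (tdiff (- (1 / 2 ^ m)) (ddiff l (ddiff m f)))) (to_l2 (ddiff l f))
        = inner (to_l2 (ddiff l (ddiff m f))) (to_l2 (tdiff (- (- (1 / 2 ^ m))) (ddiff l f)))"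
      by (rule inner_tdiff; intro tf)
    also have "tdiff (- (- (1 / 2 ^ m))) (ddiff l f) = ddiff l (ddiff m f)"
      unfolding ddiff_def minus_minus by (rule tdiff_commute)
    finally show ?thesis by (simp add: power2_norm_eq_inner)
  qed
  have r_Suc: "r (Suc M) = r M + 2 * c M + e M" for M
  proof -
    let ?b = "to_l2 (tdiff (- (1 / 2 ^ M)) (ddiff M f))"
    have "(norm (x + q *\<^sub>R y))\<^sup>2 = (norm x)\<^sup>2 + 2 * inner x (q *\<^sub>R y) + q\<^sup>2 * inner y y"
      for x y :: "'a heis l2" and q
      unfolding power2_norm_eq_inner
      by (simp add: inner_add_left inner_add_right inner_commute power2_eq_square)
    moreover have "absder (Suc M) f = absder M f + 2 ^ M *\<^sub>R ?b"
      by (simp add: absder_def)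
    ultimately have "r (Suc M) = r M + 2 * inner (absder M f) (2 ^ M *\<^sub>R ?b) + (2 ^ M)\<^sup>2 * inner ?b ?b"
      by (simp only: r_def)
    also have "inner (absder M f) (2 ^ M *\<^sub>R ?b) = c M"
      by (simp add: absder_def inner_sum_left inn c_def sum_distrib_left power_add mult_ac)
    also have "(2 ^ M)\<^sup>2 * inner ?b ?b = e M"
    proof -
      have "((2::real) ^ M)\<^sup>2 = 4 ^ M" unfolding power2_eq_square power_mult_distrib[symmetric] by simp
      then show ?thesis by (simp add: inn e_def sqfun_def)
    qed
    finally show ?thesis .
  qed
  have c_nonneg: "c M \<ge> 0" for M
    unfolding c_def by (intro sum_nonneg) auto
  \<comment> \<open>The contraction comes from \<open>norm_ddiff_Suc\<close> applied to
    \<open>ddiff m f\<close>: halving the step divides the squared norm by 4, while the weight only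
    doubles. In the error term \<open>ddiff m\<close> is pulled to the outside, where it has norm at
    most 2; the weights \<open>2^m / 2^(Suc M)\<close> that remain sum to at most 1.\<close>
  have c_Suc: "c (Suc M) \<le> c M / 2 + e M / 2 + e (Suc M)" for M
  proof -
    have "c (Suc M) \<le> (\<Sum>m<Suc M. 2 ^ (m + M) * (norm (to_l2 (ddiff M (ddiff m f))))\<^sup>2 / 2
        + 2 ^ m / 2 ^ Suc M * e (Suc M))"
      unfolding c_def
    proof (rule sum_mono)
      fix m
      let ?d = "ddiff (Suc M) (ddiff (Suc M) f)"
      have "ddiff (Suc M) (ddiff (Suc M) (ddiff m f)) = ddiff m ?d"
        unfolding ddiff_def by (metis tdiff_commute)
      then have "norm (to_l2 (ddiff (Suc M) (ddiff (Suc M) (ddiff m f)))) \<le> 2 * norm (to_l2 ?d)"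
        unfolding ddiff_def[of m] by (simp add: norm_tdiff_le[OF tf(2)])
      then have "(norm (to_l2 (ddiff (Suc M) (ddiff (Suc M) (ddiff m f)))))\<^sup>2 \<le> (2 * norm (to_l2 ?d))\<^sup>2"
        by (intro power_mono) auto
      then have "(norm (to_l2 (ddiff (Suc M) (ddiff m f))))\<^sup>2
          \<le> (norm (to_l2 (ddiff M (ddiff m f))))\<^sup>2 / 4 + (norm (to_l2 ?d))\<^sup>2"
        using norm_ddiff_Suc[OF tf(1), of M m] by (simp add: power_mult_distrib)
      then have "2 ^ (m + Suc M) * (norm (to_l2 (ddiff (Suc M) (ddiff m f))))\<^sup>2
          \<le> 2 ^ (m + Suc M) * ((norm (to_l2 (ddiff M (ddiff m f))))\<^sup>2 / 4 + (norm (to_l2 ?d))\<^sup>2)"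
        by (intro mult_left_mono) auto
      also have "\<dots> = 2 ^ (m + M) * (norm (to_l2 (ddiff M (ddiff m f))))\<^sup>2 / 2
          + 2 ^ m / 2 ^ Suc M * e (Suc M)"
      proof -
        have "(4::real) ^ Suc M = 2 ^ Suc M * 2 ^ Suc M" unfolding power_mult_distrib[symmetric] by simp
        then have "2 ^ (m + Suc M) * (norm (to_l2 ?d))\<^sup>2 = 2 ^ m / 2 ^ Suc M * e (Suc M)"
          unfolding e_def sqfun_def by (simp add: power_add)
        then show ?thesis by (simp add: distrib_left)
      qed
      finally show "2 ^ (m + Suc M) * (norm (to_l2 (ddiff (Suc M) (ddiff m f))))\<^sup>2
          \<le> 2 ^ (m + M) * (norm (to_l2 (ddiff M (ddiff m f))))\<^sup>2 / 2 + 2 ^ m / 2 ^ Suc M * e (Suc M)" .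
    qed
    also have "\<dots> = (\<Sum>m<Suc M. 2 ^ (m + M) * (norm (to_l2 (ddiff M (ddiff m f))))\<^sup>2) / 2
        + (\<Sum>m<Suc M. 2 ^ m) / 2 ^ Suc M * e (Suc M)"
      by (simp only: sum.distrib sum_divide_distrib sum_distrib_right)
    also have "(\<Sum>m<Suc M. 2 ^ (m + M) * (norm (to_l2 (ddiff M (ddiff m f))))\<^sup>2) = c M + e M"
    proof -
      have "(2::real) ^ (M + M) = 4 ^ M" unfolding power_add power_mult_distrib[symmetric] by simp
      then show ?thesis by (simp add: c_def e_def sqfun_def)
    qed
    finally have "c (Suc M) \<le> (c M + e M) / 2 + (\<Sum>m<Suc M. 2 ^ m) / 2 ^ Suc M * e (Suc M)" .
    moreover have "(\<Sum>m<Suc M. (2::real) ^ m) / 2 ^ Suc M \<le> 1"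
      using geometric_sum[of "2::real" "Suc M"] by simp
    then have "(\<Sum>m<Suc M. (2::real) ^ m) / 2 ^ Suc M * e (Suc M) \<le> 1 * e (Suc M)"
      by (rule mult_right_mono) (simp add: e_def sqfun_nonneg)
    ultimately show ?thesis by (simp add: add_divide_distrib)
  qed
  \<comment> \<open>The coefficient 4 is chosen so that the \<open>2 * c M\<close> gained by
    \<open>r\<close> is exactly what halving \<open>4 * c M\<close> sets free. What is left per step
    is \<open>3 * e M + 4 * e (Suc M)\<close>, whence the 7 and the trailing 4.\<close>
  have "r M + 4 * c M \<le> 7 * (\<Sum>m<M. e m) + 4 * e M" for M
  proof (induction M)
    case 0
    then show ?case by (simp add: r_def c_def absder_def e_def sqfun_nonneg)
  next
    case (Suc M)
    then show ?case using c_Suc[of M] by (simp add: r_Suc)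
  qed
  from this[of M] have "r (Suc M) \<le> 7 * (\<Sum>m<Suc M. e m)"
    using c_nonneg[of M] sqfun_nonneg[of f M] unfolding e_def[symmetric] by (simp add: r_Suc)
  then show ?thesis by (simp add: r_def e_def)
qed

text \<open>The two preceding estimates feed into each other: Cauchy--Schwarz gives
  \<open>S^2 \<le> 64 * norm (L f)^2 * (7 * S)\<close>, and cancelling one factor \<open>S\<close>
  leaves 448.\<close>

lemma sum_sqfun_le:
  assumes f: "f \<in> test_functions UNIV"
  shows "(\<Sum>m<Suc M. sqfun f m) \<le> 448 * (norm (to_l2 (sublap f)))\<^sup>2"
proof -
  let ?S = "\<Sum>m<Suc M. sqfun f m" and ?L = "norm (to_l2 (sublap f))" and ?R = "norm (absder (Suc M) f)"
  have S0: "?S \<ge> 0" by (intro sum_nonneg sqfun_nonneg)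
  have "?S \<le> 8 * inner (to_l2 (sublap f)) (absder (Suc M) f)" by (rule sum_sqfun_le_inner[OF f])
  also have "\<dots> \<le> 8 * (?L * ?R)" by (intro mult_left_mono norm_cauchy_schwarz) auto
  finally have "?S\<^sup>2 \<le> (8 * (?L * ?R))\<^sup>2" using S0 by (intro power_mono) auto
  also have "\<dots> = 64 * ?L\<^sup>2 * ?R\<^sup>2" by (simp add: power_mult_distrib)
  also have "\<dots> \<le> 64 * ?L\<^sup>2 * (7 * ?S)" by (intro mult_left_mono norm_absder_sq_le f) auto
  finally have "?S * ?S \<le> (448 * ?L\<^sup>2) * ?S" by (simp add: power2_eq_square mult_ac)
  then show ?thesis using S0 by (cases "?S = 0") (auto dest: mult_right_le_imp_le)
qed

text \<open>By the doubling identity, \<open>4^m * norm (ddiff m f)^2\<close> grows from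
  \<open>m\<close> to \<open>Suc m\<close> by exactly \<open>sqfun f (Suc m) / 4\<close>. It
  therefore stays bounded, with \<open>112 = 448 / 4\<close> and a factor 4 from the coarsest
  difference, and its limit is the squared norm of the vertical derivative.\<close>

lemma norm_tderiv_le:
  assumes f: "f \<in> test_functions UNIV"
  shows "(norm (to_l2 (dir_deriv tbase f)))\<^sup>2
    \<le> 4 * (norm (to_l2 f))\<^sup>2 + 112 * (norm (to_l2 (sublap f)))\<^sup>2" (is "_ \<le> ?B")
proof -
  let ?d = "\<lambda>m. 4 ^ m * (norm (to_l2 (ddiff m f)))\<^sup>2"
  have d: "?d M \<le> (norm (to_l2 (ddiff 0 f)))\<^sup>2 + (\<Sum>m<Suc M. sqfun f m) / 4" for M
  proof (induction M)
    case 0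
    then show ?case by (simp add: sqfun_nonneg)
  next
    case (Suc M)
    have "?d (Suc M) = ?d M + sqfun f (Suc M) / 4"
      using arg_cong[OF norm_ddiff_Suc[OF f, of M], of "\<lambda>x. 4 ^ M * x"]
      by (simp add: sqfun_def distrib_left mult.left_commute)
    then show ?case using Suc by (simp add: add_divide_distrib)
  qed
  have "(norm (to_l2 (ddiff 0 f)))\<^sup>2 \<le> (2 * norm (to_l2 f))\<^sup>2"
    unfolding ddiff_def by (intro power_mono norm_tdiff_le f) auto
  then have bound: "?d M \<le> ?B" for M
    using d[of M] sum_sqfun_le[OF f, of M] unfolding power_mult_distrib by (simp, linarith)
  have "((\<lambda>s. to_l2 (tflow s f)) has_vector_derivative to_l2 (dir_deriv tbase f)) (at 0)"
    using flow_has_vector_derivative_0[OF shear_field_tbase f] by (simp add: along_const)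
  then have "((\<lambda>h. norm (to_l2 (tflow h f) - to_l2 f - h *\<^sub>R to_l2 (dir_deriv tbase f)) / norm h) \<longlongrightarrow> 0) (at 0)"
    by (simp add: has_vector_derivative_def has_derivative_at flow_0)
  then have "(\<lambda>m. norm (to_l2 (tflow (1 / 2 ^ m) f) - to_l2 f - (1 / 2 ^ m) *\<^sub>R to_l2 (dir_deriv tbase f))
      / norm (1 / 2 ^ m :: real)) \<longlonglongrightarrow> 0"
    unfolding tendsto_at_iff_sequentially comp_def
    by (elim allE[of _ "\<lambda>m. 1 / 2 ^ m"]) (use LIMSEQ_realpow_zero[of "1/2"] in \<open>auto simp: power_one_over\<close>)
  moreover have "norm (to_l2 (tflow (1 / 2 ^ m) f) - to_l2 f - (1 / 2 ^ m) *\<^sub>R to_l2 (dir_deriv tbase f))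
      / norm (1 / 2 ^ m :: real) = norm (2 ^ m *\<^sub>R to_l2 (ddiff m f) - to_l2 (dir_deriv tbase f))" for m
  proof -
    have "2 ^ m *\<^sub>R to_l2 (ddiff m f) - to_l2 (dir_deriv tbase f)
        = 2 ^ m *\<^sub>R (to_l2 (tflow (1 / 2 ^ m) f) - to_l2 f - (1 / 2 ^ m) *\<^sub>R to_l2 (dir_deriv tbase f))"
      by (simp add: ddiff_def to_l2_tdiff[OF f] scaleR_diff_right)
    then show ?thesis by simp
  qed
  ultimately have "(\<lambda>m. 2 ^ m *\<^sub>R to_l2 (ddiff m f) - to_l2 (dir_deriv tbase f)) \<longlonglongrightarrow> 0"
    by (simp add: tendsto_norm_zero_iff)
  then have "(\<lambda>m. 2 ^ m *\<^sub>R to_l2 (ddiff m f)) \<longlonglongrightarrow> to_l2 (dir_deriv tbase f)"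
    by (simp add: Lim_null[symmetric])
  then have "(\<lambda>m. (norm (2 ^ m *\<^sub>R to_l2 (ddiff m f)))\<^sup>2) \<longlonglongrightarrow> (norm (to_l2 (dir_deriv tbase f)))\<^sup>2"
    by (intro tendsto_intros)
  moreover have "(norm (2 ^ m *\<^sub>R to_l2 (ddiff m f)))\<^sup>2 = ?d m" for m
  proof -
    have "((2::real) ^ m)\<^sup>2 = 4 ^ m" unfolding power2_eq_square power_mult_distrib[symmetric] by simp
    then show ?thesis by (simp add: power_mult_distrib)
  qed
  ultimately show ?thesis
    using bound by (intro LIMSEQ_le_const2) auto
qed

subsection \<open>Compactness\<close>

lemma norm_to_l2_mono:
  assumes f: "sq_integrable f" and g: "sq_integrable g" and "B \<ge> 0" "\<And>z. \<bar>f z\<bar> \<le> B * \<bar>g z\<bar>"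
  shows "norm (to_l2 f) \<le> B * norm (to_l2 g)"
proof -
  have "(\<integral>z. (f z)\<^sup>2 \<partial>lebesgue) \<le> (\<integral>z. B\<^sup>2 * (g z)\<^sup>2 \<partial>lebesgue)"
  proof (rule integral_mono)
    show "integrable lebesgue (\<lambda>z. (f z)\<^sup>2)" "integrable lebesgue (\<lambda>z. B\<^sup>2 * (g z)\<^sup>2)"
      using f g by (auto simp: sq_integrable_def)
    show "(f z)\<^sup>2 \<le> B\<^sup>2 * (g z)\<^sup>2" for z
      using power_mono[OF assms(4)[of z] abs_ge_zero, of 2] by (simp add: power_mult_distrib)
  qed
  then have "(norm (to_l2 f))\<^sup>2 \<le> (B * norm (to_l2 g))\<^sup>2"
    by (simp add: norm_to_l2_sq f g power_mult_distrib)
  then show ?thesis by (rule power2_le_imp_le) (simp add: assms(3))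
qed

lemma sq_integrable_indicator_compact:
  fixes K :: "'a::euclidean_space set"
  assumes "compact K" shows "sq_integrable (indicator K :: 'a \<Rightarrow> real)"
proof -
  have "(\<lambda>z. (indicator K z :: real)\<^sup>2) = (\<lambda>z. 1 * indicator K z)"
    by (auto simp: indicator_def)
  moreover have "integrable lebesgue (\<lambda>z. 1 * indicator K z :: real)"
    using integrable_indicator_compact[OF assms, of 1]
    by (subst integrable_completion) auto
  moreover have "indicator K \<in> borel_measurable (lebesgue :: 'a measure)"
    using assms by (intro borel_measurable_indicator) (auto simp: borel_compact)
  ultimately show ?thesis unfolding sq_integrable_def by simp
qed

text \<open>Rellich--Kondrachov in the form of a finite codimension estimate: \<open>\<psi>\<close> is compared with its
  average against the Lipschitz kernel \<open>(\<delta> - \<bar>v\<bar>)\<^sub>+\<close>, which is the inner product of \<open>\<psi>\<close> with an element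
  of a compact subset of \<open>L\<^sup>2\<close>.\<close>

lemma l2_translation_compactness:
  fixes \<Omega> :: "'a::euclidean_space set"
  assumes "bounded \<Omega>" and \<delta>: "\<delta> > 0"
  obtains F C where "finite F" "C \<ge> 0"
    "\<And>\<psi> D. \<psi> \<in> test_functions \<Omega> \<Longrightarrow> D \<ge> 0 \<Longrightarrow>
      (\<And>v. norm v \<le> \<delta> \<Longrightarrow> (norm (to_l2 (flow (\<lambda>z. v) 1 \<psi>) - to_l2 \<psi>))\<^sup>2 \<le> D) \<Longrightarrow>
      (norm (to_l2 \<psi>))\<^sup>2 \<le> 4 * D + C * (\<Sum>g\<in>F. (inner (to_l2 \<psi>) g)\<^sup>2)"
proof -
  obtain R where "\<forall>x\<in>\<Omega>. norm x \<le> R"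
    using assms(1) by (auto simp: bounded_iff)
  then have R: "\<Omega> \<subseteq> cball 0 R" by auto
  let ?B = "cball (0::'a) R"
  define k where "k v = max 0 (\<delta> - norm v)" for v :: 'a
  have k_nonneg: "k v \<ge> 0" and k_le: "k v \<le> \<delta>" for v
    using \<delta> by (auto simp: k_def)
  have k_zero: "k v = 0" if "v \<notin> cball 0 \<delta>" for v
    using that by (auto simp: k_def)
  have k_lip: "\<bar>k v - k w\<bar> \<le> norm (v - w)" for v w
    using norm_triangle_ineq3[of v w] by (auto simp: k_def max_def)
  have k_cont: "continuous_on UNIV k"
    unfolding k_def by (intro continuous_intros)
  have k_int: "integrable lborel (\<lambda>v. k v * q v)" if "continuous_on UNIV q" for q
    by (rule compact_support_integrable(1)[of _ "cball 0 \<delta>"])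
      (auto intro!: continuous_intros k_cont that simp: k_zero)
  have [measurable]: "k \<in> borel_measurable borel"
    by (rule borel_measurable_continuous_onI[OF k_cont])
  define c where "c = (\<integral>v. k v \<partial>lborel)"
  have "c > 0"
  proof -
    have "(\<integral>v. (\<delta> / 2) * indicator (cball 0 (\<delta> / 2)) v \<partial>(lborel::'a measure)) \<le> c"
      unfolding c_def
    proof (rule integral_mono)
      show "integrable lborel (\<lambda>v::'a. (\<delta> / 2) * indicator (cball 0 (\<delta> / 2)) v)"
        by (rule integrable_indicator_compact) simp
      show "integrable lborel k" using k_int[of "\<lambda>v. 1"] by simp
      show "(\<delta> / 2) * indicator (cball 0 (\<delta> / 2)) v \<le> k v" for v :: 'a
        using \<delta> by (auto simp: k_def indicator_def)
    qed
    moreover have "(\<integral>v. (\<delta> / 2) * indicator (cball 0 (\<delta> / 2)) v \<partial>(lborel::'a measure))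
        = (\<delta> / 2) * measure lborel (cball (0::'a) (\<delta> / 2))"
      by simp
    moreover have "measure lborel (cball (0::'a) (\<delta> / 2)) > 0"
      using \<delta> content_cball_pos[of "\<delta> / 2" "0::'a"] by simp
    ultimately show ?thesis using \<delta> by (smt (verit) mult_pos_pos half_gt_zero)
  qed
  define m where "m = norm (to_l2 (indicator ?B :: 'a \<Rightarrow> real))"
  have indB: "sq_integrable (indicator ?B :: 'a \<Rightarrow> real)"
    by (rule sq_integrable_indicator_compact) simp
  \<comment> \<open>The inner product of \<open>\<psi>\<close> with \<open>G x\<close> is the
    average of \<open>\<psi>\<close> around \<open>x\<close> with kernel \<open>k / c\<close>. The
    cut-off to \<open>?B\<close> does not affect it, because \<open>\<psi>\<close> vanishes outside
    \<open>?B\<close>.\<close>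
  define G where "G x z = k (z - x) / c * indicator ?B z" for x z :: 'a
  have sqG: "sq_integrable (G x)" for x
    unfolding G_def[abs_def]
  proof (rule sq_integrable_bounded_mult[OF _ _ indB])
    show "(\<lambda>z. k (z - x) / c) \<in> borel_measurable lebesgue"
      by (intro measurable_completion) measurable
    show "\<bar>k (z - x) / c\<bar> \<le> \<delta> / c" for z
      using \<open>c > 0\<close> k_nonneg[of "z - x"] k_le[of "z - x"] by (simp add: divide_right_mono)
  qed
  have G_lip: "norm (to_l2 (G x) - to_l2 (G y)) \<le> m / c * norm (x - y)" for x y
  proof -
    have "norm (to_l2 (\<lambda>z. G x z - G y z)) \<le> (norm (x - y) / c) * norm (to_l2 (indicator ?B :: 'a \<Rightarrow> real))"
    proof (rule norm_to_l2_mono[OF sq_integrable_diff[OF sqG sqG] indB])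
      show "0 \<le> norm (x - y) / c" using \<open>c > 0\<close> by simp
      have "\<bar>k (z - x) - k (z - y)\<bar> / c \<le> norm (x - y) / c" for z
        using k_lip[of "z - x" "z - y"] \<open>c > 0\<close>
        by (intro divide_right_mono) (auto simp: norm_minus_commute)
      then show "\<bar>G x z - G y z\<bar> \<le> norm (x - y) / c * \<bar>indicator ?B z\<bar>" for z
        using \<open>c > 0\<close> by (auto simp: G_def indicator_def diff_divide_distrib[symmetric] abs_divide)
    qed
    then show ?thesis by (simp add: to_l2_diff sqG m_def mult.commute)
  qed
  have "continuous_on ?B (\<lambda>x. to_l2 (G x))"
  proof (rule lipschitz_on_continuous_on[OF lipschitz_onI])
    show "dist (to_l2 (G x)) (to_l2 (G y)) \<le> m / c * dist x y" for x y
      unfolding dist_norm by (rule G_lip)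
    show "0 \<le> m / c" using \<open>c > 0\<close> by (simp add: m_def)
  qed
  then have compG: "compact ((\<lambda>x. to_l2 (G x)) ` ?B)"
    by (rule compact_continuous_image) simp
  \<comment> \<open>With this choice \<open>\<epsilon> * m \<le> 1 / 4\<close>, so replacing
    \<open>G x\<close> by a member of the finite net costs at most a quarter of the squared norm of
    \<open>\<psi>\<close>, which is absorbed on the left. The summand 1 avoids division by
    zero.\<close>
  define \<epsilon> where "\<epsilon> = 1 / (4 * (m + 1))"
  have m0: "m \<ge> 0" by (simp add: m_def)
  have "\<epsilon> > 0" using m0 by (simp add: \<epsilon>_def)
  then have "(\<lambda>x. to_l2 (G x)) ` ?B \<subseteq> (\<Union>g\<in>(\<lambda>x. to_l2 (G x)) ` ?B. ball g \<epsilon>)" by auto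
  then obtain F where F: "finite F" "(\<lambda>x. to_l2 (G x)) ` ?B \<subseteq> (\<Union>g\<in>F. ball g \<epsilon>)"
    using compactE_image[OF compG, of "(\<lambda>x. to_l2 (G x)) ` ?B" "\<lambda>g. ball g \<epsilon>"] open_ball by metis
  show thesis
  proof (rule that[OF F(1)])
    show "8 * m\<^sup>2 \<ge> 0" by simp
    fix \<psi> :: "'a \<Rightarrow> real" and D :: real
    assume \<psi>: "\<psi> \<in> test_functions \<Omega>" and "D \<ge> 0"
      and D: "\<And>v. norm v \<le> \<delta> \<Longrightarrow> (norm (to_l2 (flow (\<lambda>z. v) 1 \<psi>) - to_l2 \<psi>))\<^sup>2 \<le> D"
    have \<psi>U: "\<psi> \<in> test_functions UNIV" by (rule test_mono[OF _ \<psi>]) simp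
    have c\<psi>: "continuous_on UNIV \<psi>" by (rule smooth_continuous_on[OF test_smooth[OF \<psi>]])
    have [measurable]: "\<psi> \<in> borel_measurable borel"
      by (rule borel_measurable_continuous_onI[OF c\<psi>])
    have c\<psi>x: "continuous_on UNIV (\<lambda>v. \<psi> (x + v))" for x
      by (rule continuous_on_compose2[OF c\<psi>]) (auto intro!: continuous_intros)
    have \<psi>0: "\<psi> z = 0" if "z \<notin> ?B" for z
      using test_outside[OF \<psi>] R that by blast
    let ?N = "norm (to_l2 \<psi>)" and ?S = "\<Sum>g\<in>F. (inner (to_l2 \<psi>) g)\<^sup>2"
    have G_inner: "c * inner (to_l2 \<psi>) (to_l2 (G x)) = (\<integral>v. k v * \<psi> (x + v) \<partial>lborel)" for x
    proof -
      have "inner (to_l2 \<psi>) (to_l2 (G x)) = (\<integral>z. \<psi> z * G x z \<partial>lebesgue)"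
        by (rule inner_to_l2[OF test_sq[OF \<psi>U] sqG])
      also have "(\<lambda>z. \<psi> z * G x z) = (\<lambda>z. k (z - x) * \<psi> z / c)"
        using \<psi>0 by (auto simp: G_def fun_eq_iff indicator_def)
      also have "(\<integral>z. k (z - x) * \<psi> z / c \<partial>lebesgue) = (\<integral>z. k (z - x) * \<psi> z / c \<partial>lborel)"
        by (rule integral_completion) measurable
      also have "\<dots> = (\<integral>z. k ((z + x) - x) * \<psi> (z + x) / c \<partial>lborel)"
        by (rule integral_translate[symmetric]) measurable
      finally show ?thesis using \<open>c > 0\<close> by (simp add: add.commute)
    qed
    have G_small: "(inner (to_l2 \<psi>) (to_l2 (G x)))\<^sup>2 \<le> 2 * ?S + 2 * \<epsilon>\<^sup>2 * ?N\<^sup>2" if "x \<in> ?B" for x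
    proof -
      have "to_l2 (G x) \<in> (\<Union>g\<in>F. ball g \<epsilon>)" using F(2) that by blast
      then obtain g where g: "g \<in> F" "dist g (to_l2 (G x)) < \<epsilon>" by auto
      let ?a = "inner (to_l2 \<psi>) g" and ?b = "inner (to_l2 \<psi>) (to_l2 (G x) - g)"
      have "\<bar>?b\<bar> \<le> ?N * norm (to_l2 (G x) - g)" by (rule Cauchy_Schwarz_ineq2)
      also have "\<dots> \<le> ?N * \<epsilon>"
        using g(2) by (intro mult_left_mono) (auto simp: dist_norm norm_minus_commute)
      finally have "\<bar>?b\<bar>\<^sup>2 \<le> (?N * \<epsilon>)\<^sup>2" by (intro power_mono) auto
      moreover have "?a\<^sup>2 \<le> ?S" by (rule member_le_sum[OF g(1)]) (auto simp: F)
      moreover have "(?a + ?b)\<^sup>2 \<le> 2 * ?a\<^sup>2 + 2 * ?b\<^sup>2"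
        using sum_squares_bound[of ?a ?b] by (simp add: power2_sum)
      moreover have "inner (to_l2 \<psi>) (to_l2 (G x)) = ?a + ?b"
        by (simp add: inner_diff_right)
      ultimately show ?thesis by (simp add: power_mult_distrib mult_ac)
    qed
    define M where "M = 2 * ?S + 2 * \<epsilon>\<^sup>2 * ?N\<^sup>2"
    have "M \<ge> 0" unfolding M_def by (intro add_nonneg_nonneg mult_nonneg_nonneg sum_nonneg) auto
    \<comment> \<open>Here \<open>?a\<close> is the mean of \<open>?q\<close> with respect to the
      weight \<open>k / c\<close>. The inequality is the nonnegativity of the variance, obtained by
      integrating \<open>k v * (?q v - ?a)^2\<close>.\<close>
    have jensen: "(\<psi> x - inner (to_l2 \<psi>) (to_l2 (G x)))\<^sup>2
        \<le> (\<integral>v. k v * (\<psi> x - \<psi> (x + v))\<^sup>2 \<partial>lborel) / c" for x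
    proof -
      let ?q = "\<lambda>v. \<psi> x - \<psi> (x + v)" and ?a = "\<psi> x - inner (to_l2 \<psi>) (to_l2 (G x))"
      have i: "integrable lborel k" "integrable lborel (\<lambda>v. k v * ?q v)"
        "integrable lborel (\<lambda>v. k v * (?q v)\<^sup>2)" "integrable lborel (\<lambda>v. k v * \<psi> (x + v))"
        using k_int[of "\<lambda>v. 1"] k_int[OF c\<psi>x]
        by (auto intro!: k_int continuous_intros c\<psi>x)
      have q: "(\<integral>v. k v * ?q v \<partial>lborel) = c * ?a"
        using i by (simp add: right_diff_distrib G_inner c_def[symmetric] mult.commute)
      have "0 \<le> (\<integral>v. k v * (?q v - ?a)\<^sup>2 \<partial>lborel)"
        by (rule Bochner_Integration.integral_nonneg) (simp add: k_nonneg)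
      also have "(\<lambda>v. k v * (?q v - ?a)\<^sup>2) = (\<lambda>v. k v * (?q v)\<^sup>2 - 2 * ?a * (k v * ?q v) + ?a\<^sup>2 * k v)"
        by (auto simp: power2_eq_square algebra_simps)
      also have "(\<integral>v. k v * (?q v)\<^sup>2 - 2 * ?a * (k v * ?q v) + ?a\<^sup>2 * k v \<partial>lborel)
          = (\<integral>v. k v * (?q v)\<^sup>2 \<partial>lborel) - 2 * ?a * (\<integral>v. k v * ?q v \<partial>lborel) + ?a\<^sup>2 * c"
        using i by (simp add: c_def)
      also have "\<dots> = (\<integral>v. k v * (?q v)\<^sup>2 \<partial>lborel) - ?a\<^sup>2 * c"
        unfolding q by (simp add: power2_eq_square)
      finally show ?thesis using \<open>c > 0\<close> by (simp add: pos_le_divide_eq)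
    qed
    have pointwise: "ennreal ((\<psi> x)\<^sup>2) \<le> (\<integral>\<^sup>+v. ennreal (2 / c * (k v * (\<psi> x - \<psi> (x + v))\<^sup>2)) \<partial>lborel)
        + ennreal (2 * M) * indicator ?B x" for x
    proof (cases "x \<in> ?B")
      case False
      then show ?thesis by (simp add: \<psi>0)
    next
      case True
      let ?i = "inner (to_l2 \<psi>) (to_l2 (G x))"
      have "(\<psi> x)\<^sup>2 \<le> 2 * (\<psi> x - ?i)\<^sup>2 + 2 * ?i\<^sup>2"
        using sum_squares_bound[of "\<psi> x - ?i" ?i] by (simp add: power2_diff power2_eq_square algebra_simps)
      also have "\<dots> \<le> (\<integral>v. 2 / c * (k v * (\<psi> x - \<psi> (x + v))\<^sup>2) \<partial>lborel) + 2 * M"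
        using jensen[of x] G_small[OF True] by (simp add: M_def)
      finally have "ennreal ((\<psi> x)\<^sup>2) \<le> ennreal ((\<integral>v. 2 / c * (k v * (\<psi> x - \<psi> (x + v))\<^sup>2) \<partial>lborel) + 2 * M)"
        by (rule ennreal_leI)
      also have "\<dots> = ennreal (\<integral>v. 2 / c * (k v * (\<psi> x - \<psi> (x + v))\<^sup>2) \<partial>lborel) + ennreal (2 * M)"
        using \<open>M \<ge> 0\<close> \<open>c > 0\<close> k_nonneg
        by (intro ennreal_plus Bochner_Integration.integral_nonneg) auto
      also have "ennreal (\<integral>v. 2 / c * (k v * (\<psi> x - \<psi> (x + v))\<^sup>2) \<partial>lborel)
          = (\<integral>\<^sup>+v. ennreal (2 / c * (k v * (\<psi> x - \<psi> (x + v))\<^sup>2)) \<partial>lborel)"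
        using \<open>c > 0\<close> k_nonneg
        by (intro nn_integral_eq_integral[symmetric] integrable_mult_right k_int continuous_intros c\<psi>x) auto
      finally show ?thesis using True by simp
    qed
    have trans: "(\<integral>\<^sup>+x. ennreal (2 / c * (k v * (\<psi> x - \<psi> (x + v))\<^sup>2)) \<partial>lborel) \<le> ennreal (2 / c * D * k v)" for v
    proof (cases "norm v \<le> \<delta>")
      case False
      then show ?thesis using k_zero[of v] by simp
    next
      case True
      let ?d = "\<lambda>x. flow (\<lambda>z. v) 1 \<psi> x - \<psi> x"
      have d: "?d \<in> test_functions UNIV"
        by (intro test_diff test_flow[OF shear_field_const] \<psi>U)
      have sq: "(\<psi> x - \<psi> (x + v))\<^sup>2 = ?d x * ?d x" for x
        by (simp add: flow_def power2_commute[of "\<psi> x"] flip: power2_eq_square)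
      have int: "integrable lborel (\<lambda>x. ?d x * ?d x)"
        by (rule test_integrable[OF test_smooth_mult[OF d test_smooth[OF d]]])
      have "(\<integral>\<^sup>+x. ennreal (2 / c * (k v * (\<psi> x - \<psi> (x + v))\<^sup>2)) \<partial>lborel)
          = ennreal (\<integral>x. 2 / c * (k v * (?d x * ?d x)) \<partial>lborel)"
        unfolding sq using \<open>c > 0\<close> k_nonneg[of v] int
        by (intro nn_integral_eq_integral integrable_mult_right) auto
      also have "(\<integral>x. 2 / c * (k v * (?d x * ?d x)) \<partial>lborel) = 2 / c * (k v * (norm (to_l2 ?d))\<^sup>2)"
        by (simp add: power2_norm_eq_inner inner_test_functions[OF d d])
      also have "\<dots> \<le> 2 / c * (k v * D)"
        using D[OF True] \<open>c > 0\<close> k_nonneg[of v]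
        by (intro mult_left_mono)
          (auto simp: to_l2_diff test_sq \<psi>U test_flow[OF shear_field_const])
      finally show ?thesis by (simp add: mult_ac ennreal_leI)
    qed
    have "ennreal (?N\<^sup>2) = (\<integral>\<^sup>+x. ennreal ((\<psi> x)\<^sup>2) \<partial>lborel)"
    proof -
      have i: "integrable lborel (\<lambda>x. \<psi> x * \<psi> x)"
        by (rule test_integrable[OF test_smooth_mult[OF \<psi> test_smooth[OF \<psi>]]])
      show ?thesis
        unfolding power2_norm_eq_inner inner_test_functions[OF \<psi> \<psi>]
        unfolding power2_eq_square by (rule nn_integral_eq_integral[OF i, symmetric]) simp
    qed
    also have "\<dots> \<le> (\<integral>\<^sup>+x. (\<integral>\<^sup>+v. ennreal (2 / c * (k v * (\<psi> x - \<psi> (x + v))\<^sup>2)) \<partial>lborel)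
        + ennreal (2 * M) * indicator ?B x \<partial>lborel)"
      by (intro nn_integral_mono pointwise)
    also have "\<dots> = (\<integral>\<^sup>+x. \<integral>\<^sup>+v. ennreal (2 / c * (k v * (\<psi> x - \<psi> (x + v))\<^sup>2)) \<partial>lborel \<partial>lborel)
        + ennreal (2 * M) * emeasure lborel ?B"
    proof -
      have [measurable]: "?B \<in> sets borel" by simp
      show ?thesis by (subst nn_integral_add) (measurable, simp add: nn_integral_cmult_indicator)
    qed
    \<comment> \<open>Once the order of integration is exchanged, the inner integral is, up to the
      weight, the squared L2 distance between \<open>\<psi>\<close> and its translate by
      \<open>v\<close>, which is at most \<open>D\<close> on the support of
      \<open>k\<close>.\<close>
    also have "(\<integral>\<^sup>+x. \<integral>\<^sup>+v. ennreal (2 / c * (k v * (\<psi> x - \<psi> (x + v))\<^sup>2)) \<partial>lborel \<partial>lborel)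
        = (\<integral>\<^sup>+v. \<integral>\<^sup>+x. ennreal (2 / c * (k v * (\<psi> x - \<psi> (x + v))\<^sup>2)) \<partial>lborel \<partial>lborel)"
      by (rule lborel_pair.Fubini') measurable
    also have "\<dots> \<le> (\<integral>\<^sup>+v. ennreal (2 / c * D * k v) \<partial>lborel)"
      by (intro nn_integral_mono trans)
    also have "\<dots> = ennreal (2 * D)"
    proof -
      have "(\<integral>\<^sup>+v. ennreal (2 / c * D * k v) \<partial>lborel) = ennreal (\<integral>v. 2 / c * D * k v \<partial>lborel)"
        using \<open>c > 0\<close> \<open>D \<ge> 0\<close> k_nonneg k_int[of "\<lambda>v. 1"]
        by (intro nn_integral_eq_integral integrable_mult_right) auto
      then show ?thesis using \<open>c > 0\<close> by (simp add: c_def[symmetric])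
    qed
    also have "emeasure lborel ?B = ennreal (m\<^sup>2)"
    proof -
      have "m\<^sup>2 = (\<integral>x. (indicator ?B x)\<^sup>2 \<partial>lebesgue)"
        unfolding m_def by (rule norm_to_l2_sq[OF indB])
      also have "(\<lambda>x::'a. (indicator ?B x :: real)\<^sup>2) = indicator ?B"
        by (auto simp: indicator_def)
      also have "(\<integral>x. indicator ?B x \<partial>lebesgue) = measure lborel ?B"
        by (simp add: measure_completion)
      finally show ?thesis
        using emeasure_bounded_finite[of ?B] by (simp add: emeasure_eq_ennreal_measure)
    qed
    finally have "ennreal (?N\<^sup>2) \<le> ennreal (2 * D) + ennreal (2 * M) * ennreal (m\<^sup>2)" by simp
    also have "\<dots> = ennreal (2 * D + 2 * M * m\<^sup>2)"
      using \<open>D \<ge> 0\<close> \<open>M \<ge> 0\<close> by (simp add: ennreal_mult ennreal_plus)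
    finally have "?N\<^sup>2 \<le> 2 * D + 2 * M * m\<^sup>2"
      using \<open>D \<ge> 0\<close> \<open>M \<ge> 0\<close> by (subst (asm) ennreal_le_iff) auto
    also have "2 * M * m\<^sup>2 = 4 * m\<^sup>2 * ?S + 4 * (\<epsilon> * m)\<^sup>2 * ?N\<^sup>2"
      by (simp add: M_def algebra_simps power_mult_distrib)
    also have "4 * (\<epsilon> * m)\<^sup>2 * ?N\<^sup>2 \<le> 1 / 4 * ?N\<^sup>2"
    proof -
      have "\<epsilon> * m \<le> 1 / 4" using m0 by (simp add: \<epsilon>_def field_simps)
      then have "(\<epsilon> * m)\<^sup>2 \<le> (1 / 4)\<^sup>2" using \<open>\<epsilon> > 0\<close> m0 by (intro power_mono) auto
      then have "4 * (\<epsilon> * m)\<^sup>2 \<le> 1 / 4" by (simp add: power2_eq_square)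
      then show ?thesis by (rule mult_right_mono) simp
    qed
    finally have "?N\<^sup>2 \<le> 2 * D + (4 * m\<^sup>2 * ?S + 1 / 4 * ?N\<^sup>2)" by simp
    moreover have "0 \<le> m\<^sup>2 * ?S" by (intro mult_nonneg_nonneg sum_nonneg) auto
    ultimately show "?N\<^sup>2 \<le> 4 * D + 8 * m\<^sup>2 * ?S" using \<open>D \<ge> 0\<close> by linarith
  qed
qed


section \<open>Euclidean derivatives and the compactness estimate for the sub-Laplacian\<close>

lemma heis_Basis: "b \<in> Basis \<Longrightarrow> b = tbase \<or> (\<exists>j. b = hbase j)"
  for b :: "'n::finite heis"
proof -
  assume "b \<in> Basis"
  then consider u where "u \<in> Basis" "b = (u, 0, 0)" | u where "u \<in> Basis" "b = (0, u, 0)" | "b = tbase"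
    unfolding Basis_prod_def tbase_def by (auto simp: zero_prod_def)
  then show ?thesis
  proof cases
    case 1
    then obtain p where "u = axis p 1" by (auto simp: Basis_vec_def)
    then have "b = hbase (Inl p)" using 1 by simp
    then show ?thesis by blast
  next
    case 2
    then obtain p where "u = axis p 1" by (auto simp: Basis_vec_def)
    then have "b = hbase (Inr p)" using 2 by simp
    then show ?thesis by blast
  qed blast
qed

definition graph_sq :: "('n::finite heis \<Rightarrow> real) \<Rightarrow> real" where
  "graph_sq f = (norm (to_l2 f))\<^sup>2 + (norm (to_l2 (sublap f)))\<^sup>2"

lemma norm_hderiv_le:
  assumes f: "f \<in> test_functions UNIV"
  shows "(norm (to_l2 (hderiv j f)))\<^sup>2 \<le> graph_sq f"
proof -
  have "(norm (to_l2 (hderiv j f)))\<^sup>2 \<le> (\<Sum>j\<in>UNIV. (norm (to_l2 (hderiv j f)))\<^sup>2)"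
    by (rule member_le_sum) auto
  also have "\<dots> = inner (to_l2 (sublap f)) (to_l2 f)"
    by (simp add: inner_sublap[OF f f] power2_norm_eq_inner)
  also have "\<dots> \<le> norm (to_l2 (sublap f)) * norm (to_l2 f)" by (rule norm_cauchy_schwarz)
  also have "\<dots> \<le> graph_sq f"
    unfolding graph_sq_def
    using sum_squares_bound[of "norm (to_l2 (sublap f))" "norm (to_l2 f)"]
      mult_nonneg_nonneg[OF norm_ge_zero norm_ge_zero, of "to_l2 (sublap f)" "to_l2 f"]
    unfolding mult.assoc by linarith
  finally show ?thesis .
qed

lemma norm_tderiv_le_graph:
  assumes f: "f \<in> test_functions UNIV"
  shows "(norm (to_l2 (dir_deriv tbase f)))\<^sup>2 \<le> 112 * graph_sq f"
  using norm_tderiv_le[OF f] zero_le_power2[of "norm (to_l2 f)"] unfolding graph_sq_def distrib_left by linarith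

text \<open>A horizontal Euclidean derivative is the corresponding field minus its slope times the
  vertical derivative. Slopes are linear functions, so boundedness of \<open>\<Omega>\<close> is
  what bounds them. The constant adds 112 for the vertical direction to
  \<open>2 + 2 * 112 * A^2\<close> for the horizontal ones.\<close>

lemma norm_dir_deriv_Basis_le:
  fixes \<Omega> :: "'n::finite heis set"
  assumes "bounded \<Omega>"
  obtains C where "C \<ge> 0"
    "\<And>f b. f \<in> test_functions \<Omega> \<Longrightarrow> b \<in> Basis \<Longrightarrow> (norm (to_l2 (dir_deriv b f)))\<^sup>2 \<le> C * graph_sq f"
proof -
  have "\<exists>B. \<forall>z\<in>\<Omega>. \<bar>hslope j z\<bar> \<le> B" for j :: "'n + 'n"
    using bounded_linear_image[OF assms bounded_linear_hslope] by (auto simp: bounded_iff)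
  then obtain B where B: "\<And>j z. z \<in> \<Omega> \<Longrightarrow> \<bar>hslope j z\<bar> \<le> B j" by metis
  define A where "A = (\<Sum>j\<in>UNIV. \<bar>B j\<bar>)"
  have A: "\<bar>hslope j z\<bar> \<le> A" if "z \<in> \<Omega>" for j z
    using B[OF that, of j] member_le_sum[of j UNIV "\<lambda>j. \<bar>B j\<bar>"] unfolding A_def by fastforce
  have A0: "A \<ge> 0" unfolding A_def by (intro sum_nonneg) auto
  show thesis
  proof (rule that[of "112 + 2 + 224 * A\<^sup>2"])
    show "0 \<le> 112 + 2 + 224 * A\<^sup>2" by simp
    fix f and b :: "'n heis" assume f: "f \<in> test_functions \<Omega>" and "b \<in> Basis"
    have fU: "f \<in> test_functions UNIV" by (rule test_mono[OF _ f]) simp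
    have g0: "graph_sq f \<ge> 0" by (simp add: graph_sq_def)
    consider "b = tbase" | j where "b = hbase j" using heis_Basis[OF \<open>b \<in> Basis\<close>] by blast
    then show "(norm (to_l2 (dir_deriv b f)))\<^sup>2 \<le> (112 + 2 + 224 * A\<^sup>2) * graph_sq f"
    proof cases
      case 1
      have "(norm (to_l2 (dir_deriv b f)))\<^sup>2 \<le> 112 * graph_sq f"
        unfolding 1 by (rule norm_tderiv_le_graph[OF fU])
      also have "\<dots> \<le> (112 + 2 + 224 * A\<^sup>2) * graph_sq f"
        using g0 by (intro mult_right_mono) auto
      finally show ?thesis .
    next
      case 2
      let ?Z = "dir_deriv tbase f" and ?s = "\<lambda>z. hslope j z * dir_deriv tbase f z"
      have Z: "?Z \<in> test_functions \<Omega>" by (rule test_dir_deriv[OF f])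
      have s: "?s \<in> test_functions UNIV"
        by (rule test_smooth_mult[OF test_dir_deriv[OF fU] smooth_linear[OF bounded_linear_hslope]])
      have "norm (to_l2 ?s) \<le> A * norm (to_l2 ?Z)"
      proof (rule norm_to_l2_mono[OF test_sq[OF s] test_sq_integrable[OF Z] A0])
        show "\<bar>?s z\<bar> \<le> A * \<bar>?Z z\<bar>" for z
          using A[of z j] test_outside[OF Z, of z]
          by (cases "z \<in> \<Omega>") (auto simp: abs_mult intro: mult_right_mono)
      qed
      then have "(norm (to_l2 ?s))\<^sup>2 \<le> (A * norm (to_l2 ?Z))\<^sup>2" by (intro power_mono) auto
      also have "\<dots> \<le> A\<^sup>2 * (112 * graph_sq f)"
        unfolding power_mult_distrib by (intro mult_left_mono norm_tderiv_le_graph fU) auto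
      finally have s2: "(norm (to_l2 ?s))\<^sup>2 \<le> A\<^sup>2 * (112 * graph_sq f)" .
      have "dir_deriv b f = (\<lambda>z. hderiv j f z - ?s z)"
        by (simp add: 2 hderiv_eq[OF test_smooth[OF f]])
      then have "to_l2 (dir_deriv b f) = to_l2 (hderiv j f) - to_l2 ?s"
        by (simp add: to_l2_diff test_sq s test_hderiv fU)
      then have "(norm (to_l2 (dir_deriv b f)))\<^sup>2 \<le> (norm (to_l2 (hderiv j f)) + norm (to_l2 ?s))\<^sup>2"
        by (intro power_mono) (auto intro: norm_triangle_ineq4)
      also have "\<dots> \<le> 2 * (norm (to_l2 (hderiv j f)))\<^sup>2 + 2 * (norm (to_l2 ?s))\<^sup>2"
        using sum_squares_bound[of "norm (to_l2 (hderiv j f))" "norm (to_l2 ?s)"] by (simp add: power2_sum)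
      also have "\<dots> \<le> 2 * graph_sq f + 2 * (A\<^sup>2 * (112 * graph_sq f))"
        using norm_hderiv_le[OF fU, of j] s2 by linarith
      also have "\<dots> \<le> (112 + 2 + 224 * A\<^sup>2) * graph_sq f"
        using g0 by (simp add: algebra_simps)
      finally show ?thesis .
    qed
  qed
qed

lemma norm_dir_deriv_le:
  fixes \<Omega> :: "'n::finite heis set"
  assumes "bounded \<Omega>"
  obtains C where "C \<ge> 0"
    "\<And>f v. f \<in> test_functions \<Omega> \<Longrightarrow> (norm (to_l2 (dir_deriv v f)))\<^sup>2 \<le> C * (norm v)\<^sup>2 * graph_sq f"
proof -
  obtain C where C: "C \<ge> 0" "\<And>f b. f \<in> test_functions \<Omega> \<Longrightarrow> b \<in> Basis \<Longrightarrow>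
      (norm (to_l2 (dir_deriv b f)))\<^sup>2 \<le> C * graph_sq f"
    using norm_dir_deriv_Basis_le[OF assms] by metis
  let ?d = "real DIM('n heis)"
  show thesis
  proof (rule that[of "?d\<^sup>2 * C"])
    show "0 \<le> ?d\<^sup>2 * C" using C(1) by simp
    fix f and v :: "'n heis" assume f: "f \<in> test_functions \<Omega>"
    have fU: "f \<in> test_functions UNIV" by (rule test_mono[OF _ f]) simp
    have g0: "C * graph_sq f \<ge> 0" using C(1) by (simp add: graph_sq_def)
    have tf: "(\<lambda>z. (v \<bullet> b) * dir_deriv b f z) \<in> test_functions UNIV" for b
      by (intro test_scale test_dir_deriv fU)
    have "to_l2 (\<lambda>z. \<Sum>b\<in>J. (v \<bullet> b) * dir_deriv b f z) = (\<Sum>b\<in>J. (v \<bullet> b) *\<^sub>R to_l2 (dir_deriv b f))" for J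
      by (induction J rule: infinite_finite_induct)
        (simp_all add: to_l2_zero to_l2_add to_l2_scale test_sq test_sum
          test_dir_deriv test_scale fU)
    moreover have "dir_deriv v f = (\<lambda>z. \<Sum>b\<in>Basis. (v \<bullet> b) * dir_deriv b f z)"
      using along_eq_sum[OF test_smooth[OF f], of "\<lambda>z. v"] by (simp add: along_const)
    ultimately have "norm (to_l2 (dir_deriv v f)) \<le> (\<Sum>b\<in>Basis. norm ((v \<bullet> b) *\<^sub>R to_l2 (dir_deriv b f)))"
      by (simp only: norm_sum)
    also have "\<dots> \<le> (\<Sum>b\<in>(Basis :: 'n heis set). norm v * sqrt (C * graph_sq f))"
    proof (rule sum_mono)
      fix b :: "'n heis" assume b: "b \<in> Basis"
      have "norm (to_l2 (dir_deriv b f)) \<le> sqrt (C * graph_sq f)"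
        by (rule real_le_rsqrt[OF C(2)[OF f b]])
      moreover have "\<bar>v \<bullet> b\<bar> \<le> norm v" by (rule Basis_le_norm[OF b])
      ultimately show "norm ((v \<bullet> b) *\<^sub>R to_l2 (dir_deriv b f)) \<le> norm v * sqrt (C * graph_sq f)"
        by (simp add: mult_mono)
    qed
    also have "\<dots> = ?d * (norm v * sqrt (C * graph_sq f))" by simp
    finally have "(norm (to_l2 (dir_deriv v f)))\<^sup>2 \<le> (?d * (norm v * sqrt (C * graph_sq f)))\<^sup>2"
      by (intro power_mono) auto
    also have "\<dots> = ?d\<^sup>2 * C * (norm v)\<^sup>2 * graph_sq f"
      unfolding power_mult_distrib using g0 by (simp add: mult_ac)
    finally show "(norm (to_l2 (dir_deriv v f)))\<^sup>2 \<le> ?d\<^sup>2 * C * (norm v)\<^sup>2 * graph_sq f" .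
  qed
qed

text \<open>Translating by \<open>v\<close> moves \<open>\<psi>\<close> in L2 by at most the norm of
  its derivative along \<open>v\<close>, and the graph norm of \<open>L\<close> controls this. The
  translation criterion then applies. That \<open>K\<close> is arbitrary expresses compactness of
  the embedding: outside finitely many functionals the form is as large as desired.\<close>

lemma sublap_compactness:
  fixes \<Omega> :: "'n::finite heis set"
  assumes \<Omega>: "bounded \<Omega>" and K: "K > 0"
  obtains F C where "finite F" "C \<ge> 0"
    "\<And>\<psi>. \<psi> \<in> test_functions \<Omega> \<Longrightarrow>
      K * (norm (to_l2 \<psi>))\<^sup>2 \<le> (norm (to_l2 (sublap \<psi>)))\<^sup>2 + C * (\<Sum>g\<in>F. (inner (to_l2 \<psi>) g)\<^sup>2)"
proof -
  obtain A where A: "A \<ge> 0" "\<And>f v. f \<in> test_functions \<Omega> \<Longrightarrow>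
      (norm (to_l2 (dir_deriv v f)))\<^sup>2 \<le> A * (norm v)\<^sup>2 * graph_sq f"
    using norm_dir_deriv_le[OF \<Omega>] by metis
  \<comment> \<open>The bound \<open>\<eta> \<le> 1 / 2\<close> absorbs the L2 part of the graph
    norm on the left, which doubles the rest; \<open>2 * K * \<eta> \<le> 1\<close> then leaves
    coefficient 1 in front of \<open>norm (L \<psi>)^2\<close>. The radius \<open>\<delta>\<close>
    makes the translation error at most \<open>\<eta>\<close> times the graph norm.\<close>
  define \<eta> where "\<eta> = min (1 / 2) (1 / (2 * K))"
  have \<eta>: "\<eta> > 0" "\<eta> \<le> 1 / 2" "2 * K * \<eta> \<le> 1"
    using K by (auto simp: \<eta>_def min_def field_simps)
  define \<delta> where "\<delta> = sqrt (\<eta> / (4 * (A + 1)))"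
  have \<delta>: "\<delta> > 0" using \<eta> A(1) by (simp add: \<delta>_def)
  have \<delta>2: "4 * (A * \<delta>\<^sup>2) \<le> \<eta>"
  proof -
    have "\<delta>\<^sup>2 = \<eta> / (4 * (A + 1))" unfolding \<delta>_def using \<eta> A(1) by simp
    then have "4 * (A * \<delta>\<^sup>2) = A / (A + 1) * \<eta>" using A(1) by (simp add: field_simps)
    also have "\<dots> \<le> 1 * \<eta>" using A(1) \<eta>(1) by (intro mult_right_mono) auto
    finally show ?thesis by simp
  qed
  obtain F C where F: "finite F" "C \<ge> 0"
    "\<And>\<psi> D. \<psi> \<in> test_functions \<Omega> \<Longrightarrow> D \<ge> 0 \<Longrightarrow>
      (\<And>v. norm v \<le> \<delta> \<Longrightarrow> (norm (to_l2 (flow (\<lambda>z. v) 1 \<psi>) - to_l2 \<psi>))\<^sup>2 \<le> D) \<Longrightarrow>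
      (norm (to_l2 \<psi>))\<^sup>2 \<le> 4 * D + C * (\<Sum>g\<in>F. (inner (to_l2 \<psi>) g)\<^sup>2)"
    using l2_translation_compactness[OF \<Omega> \<delta>] by metis
  show thesis
  proof (rule that[of F "2 * K * C"])
    show "finite F" "0 \<le> 2 * K * C" using F K by auto
    fix \<psi> assume \<psi>: "\<psi> \<in> test_functions \<Omega>"
    have \<psi>U: "\<psi> \<in> test_functions UNIV" by (rule test_mono[OF _ \<psi>]) simp
    let ?S = "\<Sum>g\<in>F. (inner (to_l2 \<psi>) g)\<^sup>2" and ?N = "(norm (to_l2 \<psi>))\<^sup>2"
      and ?L = "(norm (to_l2 (sublap \<psi>)))\<^sup>2"
    have g0: "graph_sq \<psi> \<ge> 0" by (simp add: graph_sq_def)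
    have "?N \<le> 4 * (A * \<delta>\<^sup>2 * graph_sq \<psi>) + C * ?S"
    proof (rule F(3)[OF \<psi>])
      show "0 \<le> A * \<delta>\<^sup>2 * graph_sq \<psi>" using A(1) g0 by simp
      fix v :: "'n heis" assume v: "norm v \<le> \<delta>"
      have "norm (to_l2 (flow (\<lambda>z. v) 1 \<psi>) - to_l2 \<psi>) \<le> norm (to_l2 (dir_deriv v \<psi>))"
        using norm_flow_diff[OF shear_field_const \<psi>U, of v 1] by (simp add: along_const)
      then have "(norm (to_l2 (flow (\<lambda>z. v) 1 \<psi>) - to_l2 \<psi>))\<^sup>2 \<le> (norm (to_l2 (dir_deriv v \<psi>)))\<^sup>2"
        by (intro power_mono) auto
      also have "\<dots> \<le> A * (norm v)\<^sup>2 * graph_sq \<psi>" by (rule A(2)[OF \<psi>])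
      also have "\<dots> \<le> A * \<delta>\<^sup>2 * graph_sq \<psi>"
        using v A(1) g0 by (intro mult_right_mono mult_left_mono power_mono) auto
      finally show "(norm (to_l2 (flow (\<lambda>z. v) 1 \<psi>) - to_l2 \<psi>))\<^sup>2 \<le> A * \<delta>\<^sup>2 * graph_sq \<psi>" .
    qed
    also have "4 * (A * \<delta>\<^sup>2 * graph_sq \<psi>) \<le> \<eta> * graph_sq \<psi>"
      using mult_right_mono[OF \<delta>2 g0] by (simp add: mult_ac)
    finally have "?N \<le> \<eta> * (?N + ?L) + C * ?S" by (simp add: graph_sq_def)
    moreover have "\<eta> * ?N \<le> 1 / 2 * ?N" using \<eta>(2) by (intro mult_right_mono) auto
    ultimately have "?N \<le> 2 * \<eta> * ?L + 2 * C * ?S" by (simp add: distrib_left)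
    then have "K * ?N \<le> K * (2 * \<eta> * ?L + 2 * C * ?S)" using K by (intro mult_left_mono) auto
    also have "\<dots> = 2 * K * \<eta> * ?L + 2 * K * C * ?S" by (simp add: algebra_simps)
    also have "2 * K * \<eta> * ?L \<le> 1 * ?L" using \<eta>(3) by (intro mult_right_mono) auto
    finally show "K * ?N \<le> ?L + 2 * K * C * ?S" by simp
  qed
qed

subsection \<open>Density of test functions\<close>

text \<open>Derivatives of \<open>P(1/x) exp(-1/x)\<close> are of the same form.\<close>

definition flat :: "real poly \<Rightarrow> real \<Rightarrow> real" where
  "flat p x = (if x > 0 then poly p (1 / x) * exp (- (1 / x)) else 0)"

text \<open>In the variable \<open>u = 1 / x\<close> the derivative in \<open>x\<close> is
  \<open>- u^2\<close> times the derivative in \<open>u\<close>, so \<open>p(u) exp(-u)\<close>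
  becomes \<open>u^2 (p - p')(u) exp(-u)\<close>.\<close>

definition flat_step :: "real poly \<Rightarrow> real poly" where
  "flat_step p = [:0, 0, 1:] * (p - pderiv p)"

lemma tendsto_poly_div_exp: "((\<lambda>u. poly p u / exp u) \<longlongrightarrow> (0::real)) at_top"
proof -
  have "((\<lambda>u. \<Sum>i\<le>degree p. coeff p i * (u ^ i / exp u)) \<longlongrightarrow> (\<Sum>i\<le>degree p. coeff p i * 0)) at_top"
    by (intro tendsto_intros tendsto_power_div_exp_0)
  then show ?thesis by (simp add: poly_altdef sum_divide_distrib)
qed

lemma flat_has_derivative: "(flat p has_field_derivative flat (flat_step p) x) (at x)"
proof -
  consider "x > 0" | "x < 0" | "x = 0" by linarith
  then show ?thesis
  proof cases
    case 1
    have "((\<lambda>x. poly p (1 / x) * exp (- (1 / x))) has_field_derivative flat (flat_step p) x) (at x)"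
      using 1 by (auto intro!: derivative_eq_intros poly_DERIV[THEN DERIV_chain2]
          simp: flat_def flat_step_def field_simps power2_eq_square)
    then show ?thesis
      by (rule has_field_derivative_transform_within_open[of _ _ _ "{0<..}"])
        (use 1 in \<open>auto simp: flat_def\<close>)
  next
    case 2
    have "((\<lambda>x. 0) has_field_derivative flat (flat_step p) x) (at x)"
      using 2 by (auto simp: flat_def)
    then show ?thesis
      by (rule has_field_derivative_transform_within_open[of _ _ _ "{..<0}"])
        (use 2 in \<open>auto simp: flat_def\<close>)
  next
    case 3
    have "((\<lambda>h. flat p h / h) \<longlongrightarrow> 0) (at_right 0)"
    proof -
      \<comment> \<open>For \<open>u = 1 / h\<close> the right-hand difference quotient at 0 is
        \<open>u * poly p u / exp u\<close>; \<open>pCons 0 p\<close> supplies the factor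
        \<open>u\<close>.\<close>
      have "((\<lambda>u::real. poly (pCons 0 p) u / exp u) \<longlongrightarrow> 0) at_top" by (rule tendsto_poly_div_exp)
      then have "((\<lambda>h::real. poly (pCons 0 p) (inverse h) / exp (inverse h)) \<longlongrightarrow> 0) (at_right 0)"
        by (rule filterlim_compose[OF _ filterlim_inverse_at_top_right])
      then show ?thesis
        by (rule Lim_transform_eventually)
          (auto simp: eventually_at_right_less flat_def exp_minus field_simps
            intro!: eventually_mono[OF eventually_at_right_less])
    qed
    moreover have "((\<lambda>h. flat p h / h) \<longlongrightarrow> 0) (at_left 0)"
      by (rule Lim_transform_eventually[of "\<lambda>h. 0"])
        (auto simp: flat_def eventually_at_left_field intro: exI[of _ "-1"])
    ultimately have "((\<lambda>h. flat p h / h) \<longlongrightarrow> 0) (at 0)"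
      by (simp add: filterlim_at_split)
    then show ?thesis using 3 by (simp add: DERIV_def flat_def)
  qed
qed

lemma flat_pos: "flat 1 x > 0 \<longleftrightarrow> x > 0"
  by (simp add: flat_def)

lemma flat_nonneg: "flat 1 x \<ge> 0"
  by (simp add: flat_def)

lemma smooth_flat:
  assumes "smooth_on UNIV g" shows "smooth_on UNIV (\<lambda>z. flat 1 (g z))"
  using smooth_compose_real[of "\<lambda>i. flat ((flat_step ^^ i) 1)" g 0] flat_has_derivative assms
  by simp

section \<open>Test functions approximating indicators of boxes\<close>

definition box_bump :: "'a::euclidean_space \<Rightarrow> 'a \<Rightarrow> 'a \<Rightarrow> real" where
  "box_bump a c z = (\<Prod>b\<in>Basis. flat 1 (z \<bullet> b - a \<bullet> b) * flat 1 (c \<bullet> b - z \<bullet> b))"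

lemma smooth_box_bump: "smooth_on UNIV (box_bump a c)"
  unfolding box_bump_def[abs_def]
  by (intro smooth_prod smooth_mult smooth_flat smooth_diff smooth_const
      smooth_linear[OF bounded_linear_inner_left])

lemma box_bump_nonneg: "box_bump a c z \<ge> 0"
  unfolding box_bump_def by (intro prod_nonneg mult_nonneg_nonneg flat_nonneg)

lemma box_bump_pos_iff: "box_bump a c z > 0 \<longleftrightarrow> z \<in> box a c"
proof
  assume "box_bump a c z > 0"
  then have "box_bump a c z \<noteq> 0" by simp
  then have "flat 1 (z \<bullet> b - a \<bullet> b) \<noteq> 0 \<and> flat 1 (c \<bullet> b - z \<bullet> b) \<noteq> 0" if "b \<in> Basis" for b
    using that unfolding box_bump_def prod_zero_iff[OF finite_Basis] by auto
  then have "\<forall>b\<in>Basis. flat 1 (z \<bullet> b - a \<bullet> b) > 0 \<and> flat 1 (c \<bullet> b - z \<bullet> b) > 0"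
    unfolding less_le by (auto simp: flat_nonneg)
  then show "z \<in> box a c" by (simp add: flat_pos mem_box)
next
  assume "z \<in> box a c"
  then show "box_bump a c z > 0"
    unfolding box_bump_def by (intro prod_pos mult_pos_pos) (auto simp: flat_pos mem_box)
qed

text \<open>The bump is positive exactly on the open box, so composing it with
  \<open>1 - exp (- j x)\<close> drives it up to the indicator of the box as \<open>j\<close> grows,
  while values stay between 0 and 1 and the support stays fixed.\<close>

definition box_approx :: "'a::euclidean_space \<Rightarrow> 'a \<Rightarrow> nat \<Rightarrow> 'a \<Rightarrow> real" where
  "box_approx a c j z = 1 - exp (- (real j * box_bump a c z))"

lemma box_approx_test:
  fixes a c :: "'a::euclidean_space"
  assumes "cbox a c \<subseteq> \<Omega>"
  shows "box_approx a c j \<in> test_functions \<Omega>"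
proof (rule test_functionsI[of _ "cbox a c"])
  let ?F = "\<lambda>i x. if i = 0 then 1 - exp (- (real j * x)) else - ((- real j) ^ i * exp (- (real j * x)))"
  have "(?F i has_field_derivative ?F (Suc i) x) (at x)" for i x
    by (cases i) (auto intro!: derivative_eq_intros)
  from smooth_compose_real[of ?F, OF this smooth_box_bump[of a c], of 0]
  show "smooth_on UNIV (box_approx a c j)"
    by (simp add: box_approx_def[abs_def])
  show "box_approx a c j z = 0" if "z \<notin> cbox a c" for z
  proof -
    have "z \<notin> box a c" using that box_subset_cbox by blast
    then have "box_bump a c z = 0"
      using box_bump_pos_iff box_bump_nonneg by (metis less_eq_real_def)
    then show ?thesis by (simp add: box_approx_def)
  qed
qed (use assms in auto)

lemma box_approx_bounds: "\<bar>box_approx a c j z\<bar> \<le> indicator (box a c) z"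
proof (cases "z \<in> box a c")
  case True
  then show ?thesis using box_bump_nonneg[of a c z] by (simp add: box_approx_def)
next
  case False
  then have "box_bump a c z = 0"
    using box_bump_pos_iff box_bump_nonneg by (metis less_eq_real_def)
  then show ?thesis by (simp add: box_approx_def)
qed

lemma box_approx_tendsto: "(\<lambda>j. box_approx a c j z) \<longlonglongrightarrow> indicator (box a c) z"
proof (cases "z \<in> box a c")
  case True
  have "filterlim (\<lambda>j. box_bump a c z * real j) at_top sequentially"
    by (rule filterlim_tendsto_pos_mult_at_top[OF tendsto_const _ filterlim_real_sequentially])
      (use True in \<open>simp add: box_bump_pos_iff\<close>)
  then have "filterlim (\<lambda>j. - (box_bump a c z * real j)) at_bot sequentially"
    by (simp add: filterlim_uminus_at_top)
  then have "(\<lambda>j. exp (- (box_bump a c z * real j))) \<longlonglongrightarrow> 0"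
    by (rule filterlim_compose[OF exp_at_bot])
  from tendsto_diff[OF tendsto_const[of 1] this] True show ?thesis
    by (simp add: box_approx_def[abs_def] mult.commute)
next
  case False
  then show ?thesis using box_approx_bounds[of a c _ z] by simp
qed

section \<open>The fundamental lemma of the calculus of variations\<close>

lemma weak_zero_integral_box:
  fixes h :: "'a::euclidean_space \<Rightarrow> real"
  assumes h: "sq_integrable h" and orth: "\<And>\<phi>. \<phi> \<in> test_functions \<Omega> \<Longrightarrow> inner (to_l2 h) (to_l2 \<phi>) = 0"
    and box: "cbox a c \<subseteq> \<Omega>"
  shows "(\<integral>z. h z * indicator (box a c) z \<partial>lebesgue) = 0"
proof -
  have ind: "sq_integrable (indicator (cbox a c) :: 'a \<Rightarrow> real)"
    by (rule sq_integrable_indicator_compact) simp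
  have w: "integrable lebesgue (\<lambda>z. \<bar>h z * indicator (cbox a c) z\<bar>)"
    using sq_integrable_mult[OF h ind] by (rule integrable_abs)
  have t: "box_approx a c j \<in> test_functions \<Omega>" for j by (rule box_approx_test[OF box])
  have [measurable]: "box a c \<in> sets lebesgue" by simp
  have [measurable]: "h \<in> borel_measurable lebesgue" "box_approx a c j \<in> borel_measurable lebesgue" for j
    using h test_sq_integrable[OF t[of j]] by (auto simp: sq_integrable_def)
  have "(\<lambda>j. \<integral>z. h z * box_approx a c j z \<partial>lebesgue) \<longlonglongrightarrow> (\<integral>z. h z * indicator (box a c) z \<partial>lebesgue)"
  proof (rule integral_dominated_convergence[OF _ _ w])
    show "(\<lambda>z. h z * indicator (box a c) z) \<in> borel_measurable lebesgue" by measurable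
    show "AE z in lebesgue. (\<lambda>j. h z * box_approx a c j z) \<longlonglongrightarrow> h z * indicator (box a c) z"
      by (intro AE_I2 tendsto_mult tendsto_const box_approx_tendsto)
    fix j
    have "\<bar>box_approx a c j z\<bar> \<le> indicator (cbox a c) z" for z
    proof (rule order_trans[OF box_approx_bounds])
      show "indicator (box a c) z \<le> (indicator (cbox a c) z :: real)"
        using box_subset_cbox[of a c] by (auto split: split_indicator)
    qed
    then show "AE z in lebesgue. norm (h z * box_approx a c j z) \<le> \<bar>h z * indicator (cbox a c) z\<bar>"
      by (auto simp: abs_mult intro!: mult_left_mono)
  qed measurable
  moreover have "(\<integral>z. h z * box_approx a c j z \<partial>lebesgue) = 0" for j
    using orth[OF t] by (simp add: inner_to_l2 h test_sq_integrable[OF t])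
  ultimately show ?thesis by (simp add: LIMSEQ_const_iff)
qed

text \<open>Integrals of \<open>h\<close> over open boxes with closure in \<open>\<Omega>\<close>
  vanish. Open boxes are stable under intersection and generate the Borel sets, so the integral of
  the truncation of \<open>h\<close> to \<open>box a c\<close> vanishes over every Borel set. The
  argument runs on a Borel representative \<open>h'\<close>.\<close>

lemma weak_zero_AE_box:
  fixes h :: "'a::euclidean_space \<Rightarrow> real"
  assumes h: "sq_integrable h" and orth: "\<And>\<phi>. \<phi> \<in> test_functions \<Omega> \<Longrightarrow> inner (to_l2 h) (to_l2 \<phi>) = 0"
    and box: "cbox a c \<subseteq> \<Omega>"
  shows "AE z in lborel. z \<in> box a c \<longrightarrow> h z = 0"
proof -
  have ind: "sq_integrable (indicator (cbox a c) :: 'a \<Rightarrow> real)"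
    by (rule sq_integrable_indicator_compact) simp
  obtain h' where h'[measurable]: "h' \<in> borel_measurable lborel" "AE z in lborel. h z = h' z"
    using completion_ex_borel_measurable_real[of h lborel] h by (auto simp: sq_integrable_def)
  define f where "f z = h' z * indicator (box a c) z" for z
  have [measurable]: "f \<in> borel_measurable lborel" unfolding f_def[abs_def] by measurable
  have base: "integrable lborel (\<lambda>z. h' z * indicator (box p q) z) \<and>
      (\<integral>z. h' z * indicator (box p q) z \<partial>lborel) = 0" if "cbox p q \<subseteq> \<Omega>" for p q
  proof -
    have [measurable]: "box p q \<in> sets lebesgue" by simp
    have [measurable]: "h \<in> borel_measurable lebesgue" using h by (simp add: sq_integrable_def)
    have h'l[measurable]: "h' \<in> borel_measurable lebesgue"
      using h'(1) by (rule measurable_completion)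
    have ae: "AE z in lebesgue. h z * indicator (box p q) z = h' z * indicator (box p q) z"
      using AE_completion[OF h'(2)] by (auto elim!: AE_mp)
    have i: "integrable lebesgue (\<lambda>z. h z * indicator (box p q) z)"
    proof (rule Bochner_Integration.integrable_bound)
      show "integrable lebesgue (\<lambda>z. h z * indicator (cbox p q) z)"
        by (rule sq_integrable_mult[OF h sq_integrable_indicator_compact]) simp
      show "AE z in lebesgue. norm (h z * indicator (box p q) z) \<le> norm (h z * indicator (cbox p q) z)"
        using box_subset_cbox[of p q] by (auto simp: indicator_def)
    qed measurable
    have "integrable lebesgue (\<lambda>z. h' z * indicator (box p q) z)"
      using i ae by (subst integrable_cong_AE[symmetric, of "\<lambda>z. h z * indicator (box p q) z"]) auto
    moreover have "(\<integral>z. h' z * indicator (box p q) z \<partial>lebesgue) = (\<integral>z. h z * indicator (box p q) z \<partial>lebesgue)"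
      using ae by (intro integral_cong_AE) (auto elim!: AE_mp)
    ultimately show ?thesis
      using weak_zero_integral_box[OF h orth that] by (simp add: integrable_completion integral_completion)
  qed
  have f: "integrable lborel f" "(\<integral>z. f z \<partial>lborel) = 0"
    using base[OF box] by (auto simp: f_def[abs_def])
  have fset: "set_integrable lborel A f" if "A \<in> sets borel" for A
    unfolding set_integrable_def using that f(1) by (intro integrable_mult_indicator) auto
  have zero: "(\<integral>z\<in>A. f z \<partial>lborel) = 0" if A: "A \<in> sets borel" for A
  proof -
    have "Int_stable (range (\<lambda>(u, v). box u v :: 'a set))"
      by (auto simp: Int_stable_def box_Int_box)
    moreover have "range (\<lambda>(u, v). box u v :: 'a set) \<subseteq> Pow UNIV" by auto
    moreover have "A \<in> sigma_sets UNIV (range (\<lambda>(u, v). box u v))"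
      using A unfolding borel_eq_box by simp
    ultimately show ?thesis
    proof (induction rule: sigma_sets_induct_disjoint)
      case (basic A)
      then obtain u v where A: "A = box u v" by auto
      obtain p q where pq: "box a c \<inter> box u v = box p q" unfolding box_Int_box by blast
      have "(\<lambda>z. indicator A z *\<^sub>R f z) = (\<lambda>z. h' z * indicator (box p q) z)"
        unfolding pq[symmetric] A f_def by (auto simp: indicator_def)
      moreover have "(\<integral>z. h' z * indicator (box p q) z \<partial>lborel) = 0"
      proof (cases "box p q = {}")
        case True
        then show ?thesis by simp
      next
        case False
        \<comment> \<open>The closed box is the closure of the open one only if the latter is
          nonempty, hence the case distinction.\<close>
        have "cbox p q = closure (box p q)" using False by simp
        also have "\<dots> \<subseteq> closure (cbox a c)"
          unfolding pq[symmetric] by (intro closure_mono) (use box_subset_cbox in blast)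
        finally show ?thesis using base box by simp
      qed
      ultimately show ?case by (simp add: set_lebesgue_integral_def)
    next
      case empty
      then show ?case by (simp add: set_lebesgue_integral_def)
    next
      case (compl A)
      then have [measurable]: "A \<in> sets borel" by (simp add: borel_eq_box)
      have "(\<integral>z\<in>A \<union> (UNIV - A). f z \<partial>lborel) = (\<integral>z\<in>A. f z \<partial>lborel) + (\<integral>z\<in>UNIV - A. f z \<partial>lborel)"
        by (intro set_integral_Un fset) auto
      then show ?case using compl f(2) by (simp add: set_lebesgue_integral_def)
    next
      case (union F)
      then have [measurable]: "F i \<in> sets borel" for i
        by (simp add: borel_eq_box subset_eq)
      have "(\<integral>z\<in>(\<Union>i. F i). f z \<partial>lborel) = (\<Sum>i. (\<integral>z\<in>F i. f z \<partial>lborel))"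
        using union(1) by (intro lebesgue_integral_countable_add fset) (auto simp: disjoint_family_on_def)
      then show ?case using union.IH by simp
    qed
  qed
  have "AE z in lborel. f z = 0"
    by (rule density_unique_real[OF f(1), of "\<lambda>z. 0"]) (auto simp: zero)
  then show ?thesis
    using h'(2) by eventually_elim (auto simp: f_def)
qed

text \<open>An open set is a countable union of closed boxes, and passing from the closed to the
  open boxes loses only their boundaries, which are null sets.\<close>

lemma weak_zero_AE:
  fixes h :: "'a::euclidean_space \<Rightarrow> real"
  assumes "open \<Omega>" and h: "sq_integrable h"
    and orth: "\<And>\<phi>. \<phi> \<in> test_functions \<Omega> \<Longrightarrow> inner (to_l2 h) (to_l2 \<phi>) = 0"
  shows "AE z in lebesgue. z \<in> \<Omega> \<longrightarrow> h z = 0"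
proof -
  obtain \<D> where D: "countable \<D>" "\<D> \<subseteq> Pow \<Omega>" "\<And>X. X \<in> \<D> \<Longrightarrow> \<exists>a b. X = cbox a b" "\<Union>\<D> = \<Omega>"
    using open_countable_Union_open_cbox[OF assms(1)] by metis
  have "AE z in lebesgue. z \<in> X \<longrightarrow> h z = 0" if X: "X \<in> \<D>" for X
  proof -
    obtain a c where ac: "X = cbox a c" using D(3)[OF X] by blast
    have "cbox a c \<subseteq> \<Omega>" using D(2) X ac by auto
    then have 1: "AE z in lebesgue. z \<in> box a c \<longrightarrow> h z = 0"
      by (intro AE_completion weak_zero_AE_box[OF h orth]) auto
    have "AE z in lebesgue. z \<notin> cbox a c - box a c"
      by (rule AE_not_in) (use negligible_frontier_interval in \<open>simp add: negligible_iff_null_sets\<close>)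
    with 1 show ?thesis unfolding ac by eventually_elim auto
  qed
  then have "AE z in lebesgue. \<forall>X\<in>\<D>. z \<in> X \<longrightarrow> h z = 0"
    unfolding AE_ball_countable[OF D(1)] by blast
  then show ?thesis by eventually_elim (use D(4) in auto)
qed

text \<open>Extension by zero embeds \<open>L2 \<Omega>\<close> isometrically into the global space.
  The plain class \<open>to_l2 u\<close> would depend on the values of \<open>u\<close> outside
  \<open>\<Omega>\<close>, which \<open>L2 \<Omega>\<close> leaves unconstrained.\<close>

definition L2_class :: "'a::euclidean_space set \<Rightarrow> ('a \<Rightarrow> real) \<Rightarrow> 'a l2" where
  "L2_class \<Omega> u = to_l2 (\<lambda>z. indicator \<Omega> z * u z)"

lemma L2_sq_integrable:
  assumes "\<Omega> \<in> sets lebesgue" "u \<in> L2 \<Omega>" shows "sq_integrable (\<lambda>z. indicator \<Omega> z * u z)"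
proof -
  have "(\<lambda>z. indicator \<Omega> z *\<^sub>R u z) \<in> borel_measurable lebesgue"
    using assms by (subst borel_measurable_restrict_space_iff[symmetric]) (auto simp: L2_def)
  moreover have "integrable lebesgue (\<lambda>z. indicator \<Omega> z *\<^sub>R (u z)\<^sup>2)"
    using assms by (subst integrable_restrict_space[symmetric]) (auto simp: L2_def)
  moreover have "(\<lambda>z. (indicator \<Omega> z * u z)\<^sup>2) = (\<lambda>z. indicator \<Omega> z *\<^sub>R (u z)\<^sup>2)"
    by (auto simp: indicator_def)
  ultimately show ?thesis by (simp add: sq_integrable_def)
qed

lemma sq_integrable_L2:
  assumes "\<Omega> \<in> sets lebesgue" "sq_integrable f" shows "f \<in> L2 \<Omega>"
proof -
  have "f \<in> borel_measurable (lebesgue_on \<Omega>)"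
    using assms(2) by (intro measurable_restrict_space1) (simp add: sq_integrable_def)
  moreover have "integrable (lebesgue_on \<Omega>) (\<lambda>z. (f z)\<^sup>2)"
    using assms integrable_mult_indicator[OF assms(1), of "\<lambda>z. (f z)\<^sup>2"]
    by (subst integrable_restrict_space) (auto simp: sq_integrable_def)
  ultimately show ?thesis by (simp add: L2_def)
qed

lemma L2_inner_eq:
  assumes "\<Omega> \<in> sets lebesgue" "u \<in> L2 \<Omega>" "v \<in> L2 \<Omega>"
  shows "L2_inner \<Omega> u v = inner (L2_class \<Omega> u) (L2_class \<Omega> v)"
proof -
  have "L2_inner \<Omega> u v = (\<integral>z. indicator \<Omega> z *\<^sub>R (u z * v z) \<partial>lebesgue)"
    unfolding L2_inner_def using assms(1) by (intro integral_restrict_space) auto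
  also have "(\<lambda>z. indicator \<Omega> z *\<^sub>R (u z * v z)) = (\<lambda>z. (indicator \<Omega> z * u z) * (indicator \<Omega> z * v z))"
    by (auto simp: indicator_def)
  finally show ?thesis
    by (simp add: L2_class_def inner_to_l2 L2_sq_integrable assms)
qed

lemma L2_class_test: "\<phi> \<in> test_functions \<Omega> \<Longrightarrow> L2_class \<Omega> \<phi> = to_l2 \<phi>"
  unfolding L2_class_def
  by (rule arg_cong[of _ _ to_l2]) (auto simp: fun_eq_iff indicator_def test_outside)

lemma test_L2: "\<Omega> \<in> sets lebesgue \<Longrightarrow> \<phi> \<in> test_functions \<Omega> \<Longrightarrow> \<phi> \<in> L2 \<Omega>"
  by (intro sq_integrable_L2 test_sq_integrable)

lemma L2_diff:
  assumes "\<Omega> \<in> sets lebesgue" "u \<in> L2 \<Omega>" "v \<in> L2 \<Omega>"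
  shows "(\<lambda>z. u z - v z) \<in> L2 \<Omega>" "L2_class \<Omega> (\<lambda>z. u z - v z) = L2_class \<Omega> u - L2_class \<Omega> v"
proof -
  let ?u = "\<lambda>z. indicator \<Omega> z * u z" and ?v = "\<lambda>z. indicator \<Omega> z * v z"
  have sq: "sq_integrable ?u" "sq_integrable ?v" using assms by (auto intro: L2_sq_integrable)
  have "(\<lambda>z. ?u z - ?v z) \<in> L2 \<Omega>"
    by (intro sq_integrable_L2 assms sq_integrable_diff sq)
  moreover have "(\<lambda>z. (?u z - ?v z)\<^sup>2) z = (\<lambda>z. (u z - v z)\<^sup>2) z" "?u z - ?v z = u z - v z"
    if "z \<in> space (lebesgue_on \<Omega>)" for z
    using that by (auto simp: space_restrict_space)
  ultimately show "(\<lambda>z. u z - v z) \<in> L2 \<Omega>"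
    unfolding L2_def mem_Collect_eq
    by (metis (no_types, lifting) Bochner_Integration.integrable_cong measurable_cong)
  show "L2_class \<Omega> (\<lambda>z. u z - v z) = L2_class \<Omega> u - L2_class \<Omega> v"
    unfolding L2_class_def using to_l2_diff[OF sq] by (simp add: right_diff_distrib)
qed

lemma L2_class_eq_0_iff:
  assumes "\<Omega> \<in> sets lebesgue" "u \<in> L2 \<Omega>"
  shows "L2_class \<Omega> u = 0 \<longleftrightarrow> (AE z in lebesgue_on \<Omega>. u z = 0)"
proof -
  have "L2_class \<Omega> u = 0 \<longleftrightarrow> (AE z in lebesgue. indicator \<Omega> z * u z = 0)"
    unfolding L2_class_def
    using to_l2_eq_iff[OF L2_sq_integrable[OF assms] sq_integrable_zero] by (simp add: to_l2_zero)
  also have "\<dots> \<longleftrightarrow> (AE z in lebesgue. z \<in> \<Omega> \<longrightarrow> u z = 0)"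
    by (intro AE_cong) (auto simp: indicator_def)
  also have "\<dots> \<longleftrightarrow> (AE z in lebesgue_on \<Omega>. u z = 0)"
    using assms(1) by (subst AE_restrict_space_iff) auto
  finally show ?thesis .
qed

text \<open>Uniqueness of weak derivatives in terms of classes. It makes the arbitrary choice inside
  \<open>weak_deriv\<close> harmless.\<close>

lemma L2_class_weak_eqI:
  assumes "open \<Omega>" "u \<in> L2 \<Omega>" "v \<in> L2 \<Omega>"
    and eq: "\<And>\<phi>. \<phi> \<in> test_functions \<Omega> \<Longrightarrow> L2_inner \<Omega> u \<phi> = L2_inner \<Omega> v \<phi>"
  shows "L2_class \<Omega> u = L2_class \<Omega> v"
proof -
  have \<Omega>: "\<Omega> \<in> sets lebesgue" using assms(1) by auto
  let ?h = "\<lambda>z. indicator \<Omega> z * (u z - v z)"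
  have d: "(\<lambda>z. u z - v z) \<in> L2 \<Omega>" by (rule L2_diff[OF \<Omega> assms(2,3)])
  have h: "sq_integrable ?h" by (rule L2_sq_integrable[OF \<Omega> d])
  have "inner (to_l2 ?h) (to_l2 \<phi>) = 0" if \<phi>: "\<phi> \<in> test_functions \<Omega>" for \<phi>
  proof -
    have "inner (L2_class \<Omega> u - L2_class \<Omega> v) (L2_class \<Omega> \<phi>) = 0"
      using eq[OF \<phi>] by (simp add: L2_inner_eq \<Omega> assms(2,3) test_L2[OF \<Omega> \<phi>] inner_diff_left)
    then show ?thesis
      by (simp add: L2_diff(2)[OF \<Omega> assms(2,3), symmetric] L2_class_test[OF \<phi>]) (simp add: L2_class_def)
  qed
  then have "AE z in lebesgue. z \<in> \<Omega> \<longrightarrow> ?h z = 0"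
    by (rule weak_zero_AE[OF assms(1) h])
  then have "AE z in lebesgue. z \<in> \<Omega> \<longrightarrow> u z - v z = 0"
    by eventually_elim (auto simp: indicator_def)
  then have "L2_class \<Omega> (\<lambda>z. u z - v z) = 0"
    using \<Omega> by (simp add: L2_class_eq_0_iff d AE_restrict_space_iff)
  then show ?thesis by (simp add: L2_diff(2)[OF \<Omega> assms(2,3)])
qed

subsection \<open>Jets\<close>

text \<open>The components are exactly those measured by the norm of \<open>S_space 2\<close>: the
  function, its first horizontal derivatives and their pure squares, with no mixed derivatives. As
  separate coordinates of a complete space, derivatives become continuous projections.\<close>

type_synonym 'n hjet = "'n heis l2 \<times> ('n heis l2 ^ ('n + 'n)) \<times> ('n heis l2 ^ ('n + 'n))"

definition jet :: "('n::finite heis \<Rightarrow> real) \<Rightarrow> 'n hjet" where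
  "jet f = (to_l2 f, \<chi> j. to_l2 (hderiv j f), \<chi> j. to_l2 (hderiv j (hderiv j f)))"

abbreviation jval :: "'n::finite hjet \<Rightarrow> 'n heis l2" where
  "jval \<xi> \<equiv> fst \<xi>"

abbreviation jder :: "'n::finite + 'n \<Rightarrow> 'n hjet \<Rightarrow> 'n heis l2" where
  "jder j \<xi> \<equiv> fst (snd \<xi>) $ j"

abbreviation jder2 :: "'n::finite + 'n \<Rightarrow> 'n hjet \<Rightarrow> 'n heis l2" where
  "jder2 j \<xi> \<equiv> snd (snd \<xi>) $ j"

definition jlap :: "'n::finite hjet \<Rightarrow> 'n heis l2" where
  "jlap \<xi> = - (\<Sum>j\<in>UNIV. jder2 j \<xi>)"

text \<open>For open \<open>\<Omega>\<close> this closed subspace is a concrete model of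
  \<open>S0_space 2 \<Omega>\<close>; \<open>S0_space_jets\<close> and \<open>jets_S0_space\<close>
  translate between the two.\<close>

definition jets :: "'n::finite heis set \<Rightarrow> 'n hjet set" where
  "jets \<Omega> = closure (jet ` test_functions \<Omega>)"

lemma jet_simps [simp]:
  "jval (jet f) = to_l2 f" "jder j (jet f) = to_l2 (hderiv j f)"
  "jder2 j (jet f) = to_l2 (hderiv j (hderiv j f))"
  by (simp_all add: jet_def)

lemma jlap_jet: "f \<in> test_functions UNIV \<Longrightarrow> jlap (jet f) = to_l2 (sublap f)"
  by (simp add: jlap_def to_l2_sublap)

lemma test_UNIV: "f \<in> test_functions \<Omega> \<Longrightarrow> f \<in> test_functions UNIV"
  by (rule test_mono) auto

lemma jet_jets: "f \<in> test_functions \<Omega> \<Longrightarrow> jet f \<in> jets \<Omega>"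
  unfolding jets_def by (rule subsetD[OF closure_subset imageI])

lemma hjet_eqI:
  assumes "jval \<xi> = jval \<eta>" "\<And>j. jder j \<xi> = jder j \<eta>" "\<And>j. jder2 j \<xi> = jder2 j \<eta>"
  shows "\<xi> = \<eta>"
  using assms by (simp add: prod_eq_iff vec_eq_iff)

lemma jet_add:
  assumes "f \<in> test_functions UNIV" "g \<in> test_functions UNIV"
  shows "jet (\<lambda>z. f z + g z) = jet f + jet g"
  by (rule hjet_eqI)
    (simp_all add: assms along_add to_l2_add test_sq test_hderiv test_smooth[of _ UNIV])

lemma jet_scale:
  assumes "f \<in> test_functions UNIV"
  shows "jet (\<lambda>z. c * f z) = c *\<^sub>R jet f"
  by (rule hjet_eqI)
    (simp_all add: assms along_mult_const to_l2_scale test_sq test_hderiv test_smooth[of _ UNIV])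

lemma closed_jets: "closed (jets \<Omega>)"
  by (simp add: jets_def)

text \<open>The device by which identities and inequalities between continuous expressions pass from
  test functions to limits. Statements about two jets use it once in each argument.\<close>

lemma jets_closed_induct:
  assumes "\<xi> \<in> jets \<Omega>" "closed {\<xi>. P \<xi>}" "\<And>f. f \<in> test_functions \<Omega> \<Longrightarrow> P (jet f)"
  shows "P \<xi>"
proof -
  have "jets \<Omega> \<subseteq> {\<xi>. P \<xi>}"
    unfolding jets_def using assms by (intro closure_minimal) auto
  then show ?thesis using assms(1) by auto
qed

lemma jets_image:
  assumes "\<And>f. f \<in> test_functions \<Omega> \<Longrightarrow> F (jet f) \<in> jets \<Omega>" "continuous_on UNIV F" "\<xi> \<in> jets \<Omega>"
  shows "F \<xi> \<in> jets \<Omega>"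
  using image_closure_subset[of "jet ` test_functions \<Omega>" F "jets \<Omega>"] assms closed_jets
    continuous_on_subset[OF assms(2)] unfolding jets_def by blast

lemma subspace_jets: "subspace (jets \<Omega>)"
  unfolding subspace_def
proof (intro conjI ballI allI)
  have "jet (\<lambda>z. 0) = (0 :: 'a hjet)"
    using jet_scale[OF test_zero, of 0] by simp
  then show "0 \<in> jets \<Omega>" using jet_jets[OF test_zero, of \<Omega>] by simp
  fix \<xi> \<eta> assume \<xi>: "\<xi> \<in> jets \<Omega>" and \<eta>: "\<eta> \<in> jets \<Omega>"
  show "\<xi> + \<eta> \<in> jets \<Omega>"
  proof (rule jets_image[OF _ _ \<eta>])
    fix g assume g: "g \<in> test_functions \<Omega>"
    show "\<xi> + jet g \<in> jets \<Omega>"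
    proof (rule jets_image[OF _ _ \<xi>])
      fix f assume f: "f \<in> test_functions \<Omega>"
      show "jet f + jet g \<in> jets \<Omega>"
        using jet_jets[OF test_add[OF f g]] f g by (simp add: jet_add test_UNIV)
    qed (intro continuous_intros)
  qed (intro continuous_intros)
  fix c :: real
  show "c *\<^sub>R \<xi> \<in> jets \<Omega>"
  proof (rule jets_image[OF _ _ \<xi>])
    fix f assume f: "f \<in> test_functions \<Omega>"
    show "c *\<^sub>R jet f \<in> jets \<Omega>"
      using jet_jets[OF test_scale[OF f]] f by (simp add: jet_scale test_UNIV)
  qed (intro continuous_intros)
qed

lemma bounded_linear_jder: "bounded_linear (jder j)"
  by (intro bounded_linear_compose[OF bounded_linear_vec_nth]
      bounded_linear_compose[OF bounded_linear_fst bounded_linear_snd])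

lemma bounded_linear_jder2: "bounded_linear (jder2 j)"
  by (intro bounded_linear_compose[OF bounded_linear_vec_nth]
      bounded_linear_compose[OF bounded_linear_snd bounded_linear_snd])

lemma bounded_linear_jlap: "bounded_linear jlap"
  unfolding jlap_def[abs_def]
  by (intro bounded_linear_minus bounded_linear_sum bounded_linear_jder2)

lemmas continuous_on_jet_components [continuous_intros] =
  bounded_linear.continuous_on[OF bounded_linear_jlap]
  bounded_linear.continuous_on[OF bounded_linear_jder]
  bounded_linear.continuous_on[OF bounded_linear_jder2]

lemma inner_jlap:
  assumes \<xi>: "\<xi> \<in> jets \<Omega>" and \<eta>: "\<eta> \<in> jets \<Omega>"
  shows "inner (jlap \<xi>) (jval \<eta>) = (\<Sum>j\<in>UNIV. inner (jder j \<xi>) (jder j \<eta>))"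
  using \<eta>
proof (rule jets_closed_induct)
  fix g assume g: "g \<in> test_functions \<Omega>"
  show "inner (jlap \<xi>) (jval (jet g)) = (\<Sum>j\<in>UNIV. inner (jder j \<xi>) (jder j (jet g)))"
    using \<xi>
  proof (rule jets_closed_induct)
    fix f assume f: "f \<in> test_functions \<Omega>"
    show "inner (jlap (jet f)) (jval (jet g)) = (\<Sum>j\<in>UNIV. inner (jder j (jet f)) (jder j (jet g)))"
      using inner_sublap[OF test_UNIV[OF f] test_UNIV[OF g]] f
      by (simp add: jlap_jet test_UNIV)
  qed (intro closed_Collect_eq continuous_intros)
qed (intro closed_Collect_eq continuous_intros)

lemma inner_jlap_commute:
  assumes "\<xi> \<in> jets \<Omega>" "\<eta> \<in> jets \<Omega>"
  shows "inner (jlap \<xi>) (jval \<eta>) = inner (jval \<xi>) (jlap \<eta>)"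
  using inner_jlap[OF assms] inner_jlap[OF assms(2,1)] by (simp add: inner_commute)

lemma inner_jder:
  assumes \<xi>: "\<xi> \<in> jets \<Omega>" and \<eta>: "\<eta> \<in> jets \<Omega>"
  shows "inner (jder j \<xi>) (jval \<eta>) = - inner (jval \<xi>) (jder j \<eta>)"
  using \<eta>
proof (rule jets_closed_induct)
  fix g assume g: "g \<in> test_functions \<Omega>"
  show "inner (jder j \<xi>) (jval (jet g)) = - inner (jval \<xi>) (jder j (jet g))"
    using \<xi>
  proof (rule jets_closed_induct)
    fix f assume f: "f \<in> test_functions \<Omega>"
    show "inner (jder j (jet f)) (jval (jet g)) = - inner (jval (jet f)) (jder j (jet g))"
      using inner_hderiv[OF test_UNIV[OF f] test_UNIV[OF g]] by simp
  qed (intro closed_Collect_eq continuous_intros)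
qed (intro closed_Collect_eq continuous_intros)

lemma norm_jet_sq:
  "(norm \<xi>)\<^sup>2 = (norm (jval \<xi>))\<^sup>2 + (\<Sum>j\<in>UNIV. (norm (jder j \<xi>))\<^sup>2) + (\<Sum>j\<in>UNIV. (norm (jder2 j \<xi>))\<^sup>2)"
  by (cases \<xi>, rename_tac a b, case_tac b)
    (simp add: norm_Pair norm_vec_def L2_set_def sum_nonneg)

text \<open>Coercivity: convergence of \<open>u\<close> and \<open>L u\<close> forces convergence of
  the whole jet, so limits of minimizing sequences stay in the space. Of the constant,
  \<open>1\<close> and \<open>2 * n\<close> come from the value and the 2n first derivatives,
  \<open>1 + 2 * n * 112\<close> from the pure second derivatives.\<close>

lemma norm_jets_le:
  obtains C where "C \<ge> 0"
    "\<And>\<xi>. \<xi> \<in> jets (\<Omega> :: 'n::finite heis set) \<Longrightarrow> (norm \<xi>)\<^sup>2 \<le> C * ((norm (jval \<xi>))\<^sup>2 + (norm (jlap \<xi>))\<^sup>2)"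
proof -
  let ?n = "real CARD('n)"
  let ?C = "1 + 2 * ?n + (1 + 224 * ?n)"
  show thesis
  proof (rule that[of ?C])
    fix \<xi> :: "'n hjet" assume "\<xi> \<in> jets \<Omega>"
    then show "(norm \<xi>)\<^sup>2 \<le> ?C * ((norm (jval \<xi>))\<^sup>2 + (norm (jlap \<xi>))\<^sup>2)"
    proof (rule jets_closed_induct)
      fix f assume "f \<in> test_functions \<Omega>"
      then have f: "f \<in> test_functions UNIV" by (rule test_UNIV)
      have "(\<Sum>j\<in>(UNIV :: ('n + 'n) set). (norm (to_l2 (hderiv j f)))\<^sup>2) \<le> (\<Sum>j\<in>(UNIV :: ('n + 'n) set). graph_sq f)"
        by (intro sum_mono norm_hderiv_le f)
      then have 1: "(\<Sum>j\<in>UNIV. (norm (to_l2 (hderiv j f)))\<^sup>2) \<le> 2 * ?n * graph_sq f"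
        by simp
      have "2 * ?n * (norm (to_l2 (dir_deriv tbase f)))\<^sup>2 \<le> 2 * ?n * (112 * graph_sq f)"
        by (intro mult_left_mono norm_tderiv_le_graph f) simp
      then have 2: "(\<Sum>j\<in>UNIV. (norm (to_l2 (hderiv j (hderiv j f))))\<^sup>2)
          \<le> (norm (to_l2 (sublap f)))\<^sup>2 + 224 * ?n * graph_sq f"
        using sum_hderiv_square_le[OF f] by linarith
      have "(norm (to_l2 f))\<^sup>2 \<le> graph_sq f" "(norm (to_l2 (sublap f)))\<^sup>2 \<le> graph_sq f"
        by (simp_all add: graph_sq_def)
      with 1 2 have "(norm (jet f))\<^sup>2 \<le> ?C * graph_sq f"
        unfolding norm_jet_sq jet_simps by (simp add: algebra_simps)
      then show "(norm (jet f))\<^sup>2 \<le> ?C * ((norm (jval (jet f)))\<^sup>2 + (norm (jlap (jet f)))\<^sup>2)"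
        by (simp add: graph_sq_def jlap_jet[OF f])
    qed (intro closed_Collect_le continuous_intros)
  qed simp
qed

lemma jets_compactness:
  fixes \<Omega> :: "'n::finite heis set"
  assumes "bounded \<Omega>" "K > 0"
  obtains F C where "finite F" "C \<ge> 0"
    "\<And>\<xi>. \<xi> \<in> jets \<Omega> \<Longrightarrow>
      K * (norm (jval \<xi>))\<^sup>2 \<le> (norm (jlap \<xi>))\<^sup>2 + C * (\<Sum>g\<in>F. (inner (jval \<xi>) g)\<^sup>2)"
proof -
  obtain F C where F: "finite F" "C \<ge> 0"
    "\<And>\<psi>. \<psi> \<in> test_functions \<Omega> \<Longrightarrow>
      K * (norm (to_l2 \<psi>))\<^sup>2 \<le> (norm (to_l2 (sublap \<psi>)))\<^sup>2 + C * (\<Sum>g\<in>F. (inner (to_l2 \<psi>) g)\<^sup>2)"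
    using sublap_compactness[OF assms] by metis
  show thesis
  proof (rule that[OF F(1,2)])
    fix \<xi> assume "\<xi> \<in> jets \<Omega>"
    then show "K * (norm (jval \<xi>))\<^sup>2 \<le> (norm (jlap \<xi>))\<^sup>2 + C * (\<Sum>g\<in>F. (inner (jval \<xi>) g)\<^sup>2)"
    proof (rule jets_closed_induct)
      fix f assume "f \<in> test_functions \<Omega>"
      then show "K * (norm (jval (jet f)))\<^sup>2 \<le> (norm (jlap (jet f)))\<^sup>2 + C * (\<Sum>g\<in>F. (inner (jval (jet f)) g)\<^sup>2)"
        using F(3) by (simp add: jlap_jet test_UNIV)
    qed (intro closed_Collect_le continuous_intros)
  qed
qed

section \<open>Multiplication of jets by horizontal coordinates\<close>

definition coord_mult :: "'n::finite heis set \<Rightarrow> 'n + 'n \<Rightarrow> 'n heis l2 \<Rightarrow> 'n heis l2" where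
  "coord_mult \<Omega> i = l2_mult (\<lambda>z. indicator \<Omega> z * hcoord i z)"

text \<open>The components are dictated by the product rule: the field \<open>j\<close> maps the
  coordinate \<open>i\<close> to 1 or 0, and its square annihilates the coordinate. On the jet of a
  test function the result is the jet of the product.\<close>

definition jmult :: "'n::finite heis set \<Rightarrow> 'n + 'n \<Rightarrow> 'n hjet \<Rightarrow> 'n hjet" where
  "jmult \<Omega> i \<xi> = (coord_mult \<Omega> i (jval \<xi>),
     \<chi> j. coord_mult \<Omega> i (jder j \<xi>) + (if j = i then 1 else 0) *\<^sub>R jval \<xi>,
     \<chi> j. coord_mult \<Omega> i (jder2 j \<xi>) + (if j = i then 2 else 0) *\<^sub>R jder j \<xi>)"

lemma coord_bound:
  assumes "bounded \<Omega>" obtains B where "\<And>z. \<bar>indicator \<Omega> z * hcoord i z\<bar> \<le> B"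
proof -
  obtain B where B: "\<And>z. z \<in> \<Omega> \<Longrightarrow> \<bar>hcoord i z\<bar> \<le> B"
    using bounded_linear_image[OF assms bounded_linear_hcoord[of i]] by (auto simp: bounded_iff)
  have "\<bar>indicator \<Omega> z * hcoord i z\<bar> \<le> max B 0" for z
    using B[of z] by (cases "z \<in> \<Omega>") (auto simp: le_max_iff_disj)
  then show thesis by (rule that)
qed

lemma coord_measurable:
  assumes "\<Omega> \<in> sets lebesgue"
  shows "(\<lambda>z. indicator \<Omega> z * hcoord i z) \<in> borel_measurable lebesgue"
proof -
  have "hcoord i \<in> borel_measurable borel"
    by (intro borel_measurable_continuous_onI linear_continuous_on bounded_linear_hcoord)
  then have "hcoord i \<in> borel_measurable lebesgue" by (intro measurable_completion) simp
  then show ?thesis using assms by (intro borel_measurable_times borel_measurable_indicator)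
qed

lemma bounded_linear_coord_mult:
  assumes "bounded \<Omega>" "\<Omega> \<in> sets lebesgue" shows "bounded_linear (coord_mult \<Omega> i)"
proof -
  obtain B where "\<And>z. \<bar>indicator \<Omega> z * hcoord i z\<bar> \<le> B" using coord_bound[OF assms(1)] by metis
  then show ?thesis
    unfolding coord_mult_def by (rule bounded_linear_l2_mult[OF coord_measurable[OF assms(2)]])
qed

lemma inner_coord_mult:
  assumes "bounded \<Omega>" "\<Omega> \<in> sets lebesgue"
  shows "inner (coord_mult \<Omega> i x) y = inner x (coord_mult \<Omega> i y)"
proof -
  obtain B where "\<And>z. \<bar>indicator \<Omega> z * hcoord i z\<bar> \<le> B" using coord_bound[OF assms(1)] by metis
  then show ?thesis
    unfolding coord_mult_def by (rule inner_l2_mult[OF coord_measurable[OF assms(2)]])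
qed

lemma coord_mult_test:
  assumes \<Omega>: "bounded \<Omega>" "\<Omega> \<in> sets lebesgue" and f: "f \<in> test_functions \<Omega>"
  shows "coord_mult \<Omega> i (to_l2 f) = to_l2 (\<lambda>z. hcoord i z * f z)"
proof -
  obtain B where "\<And>z. \<bar>indicator \<Omega> z * hcoord i z\<bar> \<le> B" using coord_bound[OF \<Omega>(1)] by metis
  then have "coord_mult \<Omega> i (to_l2 f) = to_l2 (\<lambda>z. indicator \<Omega> z * hcoord i z * f z)"
    unfolding coord_mult_def
    by (intro l2_mult_to_l2[OF coord_measurable[OF \<Omega>(2)]] test_sq_integrable[OF f])
  also have "(\<lambda>z. indicator \<Omega> z * hcoord i z * f z) = (\<lambda>z. hcoord i z * f z)"
  proof
    show "indicator \<Omega> z * hcoord i z * f z = hcoord i z * f z" for z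
      using test_outside[OF f, of z] by (cases "z \<in> \<Omega>") auto
  qed
  finally show ?thesis .
qed

lemma hderiv_coord_mult:
  assumes f: "smooth_on UNIV f"
  shows "hderiv j (\<lambda>z. hcoord i z * f z) = (\<lambda>z. hcoord i z * hderiv j f z + (if j = i then 1 else 0) * f z)"
  by (auto simp: along_mult[OF smooth_linear[OF bounded_linear_hcoord] f] hderiv_hcoord)

lemma jmult_jet:
  assumes \<Omega>: "bounded \<Omega>" "\<Omega> \<in> sets lebesgue" and f: "f \<in> test_functions \<Omega>"
  shows "jmult \<Omega> i (jet f) = jet (\<lambda>z. hcoord i z * f z)"
proof (rule hjet_eqI)
  note c = smooth_linear[OF bounded_linear_hcoord[of i]]
  have t: "(\<lambda>z. hcoord i z * g z) \<in> test_functions UNIV" if "g \<in> test_functions \<Omega>" for g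
    by (rule test_smooth_mult[OF test_UNIV[OF that] c])
  have s: "smooth_on UNIV g" if "g \<in> test_functions \<Omega>" for g
    by (rule test_smooth[OF that])
  have tU: "f \<in> test_functions UNIV" "hderiv j f \<in> test_functions UNIV" "hderiv j f \<in> test_functions \<Omega>"
    "hderiv j (hderiv j f) \<in> test_functions \<Omega>" for j
    using f by (auto intro: test_UNIV test_hderiv)
  show "jval (jmult \<Omega> i (jet f)) = jval (jet (\<lambda>z. hcoord i z * f z))"
    by (simp add: jmult_def coord_mult_test[OF \<Omega> f])
  show "jder j (jmult \<Omega> i (jet f)) = jder j (jet (\<lambda>z. hcoord i z * f z))" for j
    by (simp add: jmult_def coord_mult_test[OF \<Omega> tU(3)] hderiv_coord_mult[OF s[OF f]]
        to_l2_add to_l2_scale test_sq t tU test_scale)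
  show "jder2 j (jmult \<Omega> i (jet f)) = jder2 j (jet (\<lambda>z. hcoord i z * f z))" for j
  proof -
    have "hderiv j (hderiv j (\<lambda>z. hcoord i z * f z))
        = (\<lambda>z. hcoord i z * hderiv j (hderiv j f) z + (if j = i then 2 else 0) * hderiv j f z)"
      unfolding hderiv_coord_mult[OF s[OF f]]
      using along_add[OF smooth_mult[OF c s[OF tU(3)[of j]]] smooth_scale[OF s[OF f], of "if j = i then 1 else 0"], of "hfield j"]
      by (auto simp: hderiv_coord_mult[OF s[OF tU(3)]] along_mult_const[OF s[OF f]] along_linear)
    then show ?thesis
      by (simp add: jmult_def coord_mult_test[OF \<Omega> tU(4)] to_l2_add to_l2_scale test_sq t tU test_scale)
  qed
qed

lemma jmult_jets:
  assumes \<Omega>: "bounded \<Omega>" "\<Omega> \<in> sets lebesgue" and \<xi>: "\<xi> \<in> jets \<Omega>"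
  shows "jmult \<Omega> i \<xi> \<in> jets \<Omega>"
proof (rule jets_image[OF _ _ \<xi>])
  fix f assume f: "f \<in> test_functions \<Omega>"
  show "jmult \<Omega> i (jet f) \<in> jets \<Omega>"
    unfolding jmult_jet[OF \<Omega> f]
    by (rule jet_jets[OF test_smooth_mult[OF f smooth_linear[OF bounded_linear_hcoord]]])
next
  note [continuous_intros] = bounded_linear.continuous_on[OF bounded_linear_coord_mult[OF \<Omega>]]
  show "continuous_on UNIV (jmult \<Omega> i)"
    unfolding jmult_def[abs_def] by (intro continuous_intros)
qed

text \<open>The commutator of \<open>L\<close> with a coordinate is \<open>-2\<close> times the
  conjugate field, because every \<open>X_j^2\<close> annihilates the coordinate and only the mixed
  term of the product rule remains.\<close>

lemma jlap_jmult:
  assumes \<Omega>: "bounded \<Omega>" "\<Omega> \<in> sets lebesgue"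
  shows "jlap (jmult \<Omega> i \<xi>) = coord_mult \<Omega> i (jlap \<xi>) - 2 *\<^sub>R jder i \<xi>"
proof -
  note lin = bounded_linear.linear[OF bounded_linear_coord_mult[OF \<Omega>, of i]]
  have "(\<Sum>j\<in>UNIV. (if j = i then 2 else 0) *\<^sub>R jder j \<xi>) = 2 *\<^sub>R jder i \<xi>"
    by (simp add: if_distrib[of "\<lambda>c. c *\<^sub>R _"] cong: if_cong)
  then show ?thesis
    by (simp add: jlap_def jmult_def sum.distrib linear_neg[OF lin] linear_sum[OF lin])
qed

lemma jval_jmult: "jval (jmult \<Omega> i \<xi>) = coord_mult \<Omega> i (jval \<xi>)"
  by (simp add: jmult_def)

lemma jder_jmult: "jder i (jmult \<Omega> i \<xi>) = coord_mult \<Omega> i (jder i \<xi>) + jval \<xi>"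
  by (simp add: jmult_def)

subsection \<open>Weak derivatives and jets\<close>

abbreviation hpow :: "'n::finite + 'n \<Rightarrow> nat \<Rightarrow> ('n heis \<Rightarrow> real) \<Rightarrow> 'n heis \<Rightarrow> real" where
  "hpow j d \<equiv> along (hfield j) ^^ d"

lemma test_hpow: "f \<in> test_functions \<Omega> \<Longrightarrow> hpow j d f \<in> test_functions \<Omega>"
  by (induction d) (auto intro: test_hderiv)

lemma inner_hpow:
  assumes "f \<in> test_functions UNIV" "g \<in> test_functions UNIV"
  shows "inner (to_l2 (hpow j d f)) (to_l2 g) = (-1) ^ d * inner (to_l2 f) (to_l2 (hpow j d g))"
  using assms(2)
proof (induction d arbitrary: g)
  case (Suc d)
  have "inner (to_l2 (hpow j (Suc d) f)) (to_l2 g) = - inner (to_l2 (hpow j d f)) (to_l2 (hderiv j g))"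
    using inner_hderiv[OF test_hpow[OF assms(1)] Suc.prems] by simp
  also have "\<dots> = - ((-1) ^ d * inner (to_l2 f) (to_l2 (hpow j d (hderiv j g))))"
    using Suc.IH[OF test_hderiv[OF Suc.prems]] by simp
  also have "hpow j d (hderiv j g) = hpow j (Suc d) g"
    by (simp add: funpow_swap1)
  finally show ?case by simp
qed simp

text \<open>Only \<open>d = 1\<close> and \<open>d = 2\<close> are meant; every other
  \<open>d\<close> also yields the second derivative.\<close>

definition jpow :: "'n::finite + 'n \<Rightarrow> nat \<Rightarrow> 'n hjet \<Rightarrow> 'n heis l2" where
  "jpow j d \<xi> = (if d = 1 then jder j \<xi> else jder2 j \<xi>)"

lemma jpow_jet: "d \<in> {1..2} \<Longrightarrow> jpow j d (jet f) = to_l2 (hpow j d f)"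
proof -
  assume "d \<in> {1..2}"
  then have "d = 1 \<or> d = 2" by auto
  then show ?thesis by (auto simp: jpow_def numeral_2_eq_2)
qed

lemma bounded_linear_jpow: "bounded_linear (jpow j d)"
  unfolding jpow_def[abs_def] using bounded_linear_jder bounded_linear_jder2 by (cases "d = 1") auto

lemma S_space_iff:
  "u \<in> S_space 2 \<Omega> \<longleftrightarrow> u \<in> L2 \<Omega> \<and> (\<forall>d\<in>{1..2}. \<forall>j. \<exists>g. has_weak_deriv \<Omega> (hfield j) d u g)"
proof -
  have "(\<forall>j. Q j) \<longleftrightarrow> (\<forall>p. Q (Inl p) \<and> Q (Inr p))" for Q :: "'a + 'a \<Rightarrow> bool"
    by (metis sum.exhaust)
  then show ?thesis by (simp add: S_space_def)
qed

lemma has_weak_deriv_iff: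
  fixes \<Omega> :: "'n::finite heis set"
  assumes \<Omega>: "\<Omega> \<in> sets lebesgue" and u: "u \<in> L2 \<Omega>"
  shows "has_weak_deriv \<Omega> (hfield j) d u g \<longleftrightarrow> g \<in> L2 \<Omega> \<and>
    (\<forall>\<phi>\<in>test_functions \<Omega>. inner (L2_class \<Omega> g) (to_l2 \<phi>) = (-1) ^ d * inner (L2_class \<Omega> u) (to_l2 (hpow j d \<phi>)))"
proof -
  have "L2_inner \<Omega> g \<phi> = (-1) ^ d * L2_inner \<Omega> u (hpow j d \<phi>) \<longleftrightarrow>
      inner (L2_class \<Omega> g) (to_l2 \<phi>) = (-1) ^ d * inner (L2_class \<Omega> u) (to_l2 (hpow j d \<phi>))"
    if "g \<in> L2 \<Omega>" "\<phi> \<in> test_functions \<Omega>" for \<phi>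
    using that by (simp add: L2_inner_eq[OF \<Omega>] u test_L2[OF \<Omega>] test_hpow L2_class_test)
  then show ?thesis unfolding has_weak_deriv_def by blast
qed

text \<open>The norm of \<open>u - f\<close> is defined through chosen weak derivatives. The choice
  is meaningful here because a weak derivative of \<open>u\<close> minus the classical derivative of
  \<open>f\<close> is a witness.\<close>

lemma weak_deriv_minus_test:
  fixes \<Omega> :: "'n::finite heis set"
  assumes \<Omega>: "\<Omega> \<in> sets lebesgue" and u: "u \<in> L2 \<Omega>" and g: "has_weak_deriv \<Omega> (hfield j) d u g"
    and f: "f \<in> test_functions \<Omega>"
  shows "has_weak_deriv \<Omega> (hfield j) d (\<lambda>z. u z - f z) (weak_deriv \<Omega> (hfield j) d (\<lambda>z. u z - f z))"
proof -
  have fL: "f \<in> L2 \<Omega>" "hpow j d f \<in> L2 \<Omega>"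
    by (intro test_L2[OF \<Omega>] test_hpow f)+
  note uf = L2_diff[OF \<Omega> u fL(1)]
  have "has_weak_deriv \<Omega> (hfield j) d (\<lambda>z. u z - f z) (\<lambda>z. g z - hpow j d f z)"
    unfolding has_weak_deriv_iff[OF \<Omega> uf(1)]
  proof (intro conjI ballI)
    have gL: "g \<in> L2 \<Omega>" using g by (simp add: has_weak_deriv_def)
    then show "(\<lambda>z. g z - hpow j d f z) \<in> L2 \<Omega>" by (intro L2_diff \<Omega> fL)
    fix \<phi> assume \<phi>: "\<phi> \<in> test_functions \<Omega>"
    show "inner (L2_class \<Omega> (\<lambda>z. g z - hpow j d f z)) (to_l2 \<phi>)
        = (-1) ^ d * inner (L2_class \<Omega> (\<lambda>z. u z - f z)) (to_l2 (hpow j d \<phi>))"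
      using g \<phi> inner_hpow[OF test_UNIV[OF f] test_UNIV[OF \<phi>], of d j]
      unfolding has_weak_deriv_iff[OF \<Omega> u] L2_diff(2)[OF \<Omega> gL fL(2)] uf(2)
        L2_class_test[OF f] L2_class_test[OF test_hpow[OF f]] inner_diff_left
      by (simp add: right_diff_distrib)
  qed
  then show ?thesis
    unfolding weak_deriv_def by (rule someI[of "has_weak_deriv \<Omega> (hfield j) d (\<lambda>z. u z - f z)"])
qed

lemma S_norm_sq:
  fixes \<Omega> :: "'n::finite heis set"
  assumes \<Omega>: "\<Omega> \<in> sets lebesgue" and u: "u \<in> L2 \<Omega>"
    and wd: "\<And>d j. d \<in> {1..2} \<Longrightarrow> weak_deriv \<Omega> (hfield j) d u \<in> L2 \<Omega>"
  shows "(S_norm 2 \<Omega> u)\<^sup>2 = (\<Sum>d=1..2. \<Sum>j\<in>UNIV. (norm (L2_class \<Omega> (weak_deriv \<Omega> (hfield j) d u)))\<^sup>2)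
      + (norm (L2_class \<Omega> u))\<^sup>2"
proof -
  have split: "(\<Sum>j\<in>UNIV. g j) = (\<Sum>p\<in>UNIV. g (Inl p)) + (\<Sum>p\<in>UNIV. g (Inr p))"
    for g :: "'n + 'n \<Rightarrow> real"
    unfolding UNIV_Plus_UNIV[symmetric] by (subst sum.Plus) auto
  have sq: "(\<integral>z. (f z)\<^sup>2 \<partial>lebesgue_on \<Omega>) = (norm (L2_class \<Omega> f))\<^sup>2" if "f \<in> L2 \<Omega>" for f
    using L2_inner_eq[OF \<Omega> that that] by (simp add: L2_inner_def power2_norm_eq_inner) (simp add: power2_eq_square)
  have int: "integrable (lebesgue_on \<Omega>) (\<lambda>z. (f z)\<^sup>2)" if "f \<in> L2 \<Omega>" for f
    using that by (simp add: L2_def)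
  let ?w = "\<lambda>j d. weak_deriv \<Omega> (hfield j) d u"
  have "(\<integral>z. (\<Sum>d=1..2. \<Sum>p\<in>UNIV. (weak_deriv \<Omega> (X_field p) d u z)\<^sup>2 + (weak_deriv \<Omega> (Y_field p) d u z)\<^sup>2)
        + (u z)\<^sup>2 \<partial>lebesgue_on \<Omega>)
      = (\<integral>z. (\<Sum>d=1..2. \<Sum>j\<in>UNIV. (?w j d z)\<^sup>2) + (u z)\<^sup>2 \<partial>lebesgue_on \<Omega>)"
    by (simp add: split sum.distrib)
  also have "\<dots> = (\<Sum>d=1..2. \<Sum>j\<in>UNIV. (norm (L2_class \<Omega> (?w j d)))\<^sup>2) + (norm (L2_class \<Omega> u))\<^sup>2"
  proof -
    have two: "(\<Sum>d=1..2::nat. h d) = h 1 + h 2" for h :: "nat \<Rightarrow> real"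
      by (simp add: numeral_2_eq_2)
    have i: "integrable (lebesgue_on \<Omega>) (\<lambda>z. (?w j 1 z)\<^sup>2)" "integrable (lebesgue_on \<Omega>) (\<lambda>z. (?w j 2 z)\<^sup>2)" for j
      by (intro int wd; simp)+
    have s: "(\<integral>z. (?w j 1 z)\<^sup>2 \<partial>lebesgue_on \<Omega>) = (norm (L2_class \<Omega> (?w j 1)))\<^sup>2"
      "(\<integral>z. (?w j 2 z)\<^sup>2 \<partial>lebesgue_on \<Omega>) = (norm (L2_class \<Omega> (?w j 2)))\<^sup>2" for j
      by (intro sq wd; simp)+
    show ?thesis unfolding two using i s int[OF u] sq[OF u] by simp
  qed
  finally show ?thesis
    unfolding S_norm_def by (subst real_sqrt_pow2) (auto intro!: add_nonneg_nonneg sum_nonneg)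
qed

text \<open>Weak derivatives of \<open>u - \<phi> m\<close> are small in L2. Let
  \<open>\<chi>\<close> be the difference of the derivatives of \<open>\<phi> m\<close> and
  \<open>\<phi> l\<close>. Testing the two weak derivatives against \<open>\<chi>\<close> itself
  gives \<open>norm \<chi>^2 \<le> norm (w l - w m) * norm \<chi>\<close>. Hence the classical
  derivatives are Cauchy, with no appeal to linearity of the chosen weak derivatives.\<close>

lemma S0_space_jets:
  fixes \<Omega> :: "'n::finite heis set"
  assumes \<Omega>: "\<Omega> \<in> sets lebesgue" and u: "u \<in> S0_space 2 \<Omega>"
  obtains \<xi> where "\<xi> \<in> jets \<Omega>" "jval \<xi> = L2_class \<Omega> u"
proof -
  have uL: "u \<in> L2 \<Omega>" and uw: "\<And>d j. d \<in> {1..2} \<Longrightarrow> \<exists>g. has_weak_deriv \<Omega> (hfield j) d u g"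
    and approx: "\<And>\<epsilon>. \<epsilon> > 0 \<Longrightarrow> \<exists>\<phi>\<in>test_functions \<Omega>. S_norm 2 \<Omega> (\<lambda>z. u z - \<phi> z) < \<epsilon>"
    using u unfolding S0_space_def mem_Collect_eq S_space_iff by blast+
  have "\<forall>m. \<exists>\<phi>. \<phi> \<in> test_functions \<Omega> \<and> S_norm 2 \<Omega> (\<lambda>z. u z - \<phi> z) < inverse (real (Suc m))"
    using approx by (meson inverse_positive_iff_positive of_nat_0_less_iff zero_less_Suc)
  then obtain \<phi> where \<phi>: "\<And>m. \<phi> m \<in> test_functions \<Omega>"
      "\<And>m. S_norm 2 \<Omega> (\<lambda>z. u z - \<phi> m z) < inverse (real (Suc m))"
    by metis
  have \<phi>U: "\<phi> m \<in> test_functions UNIV" for m by (rule test_UNIV[OF \<phi>(1)])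
  define D where "D m z = u z - \<phi> m z" for m z
  have D: "D m \<in> L2 \<Omega>" "L2_class \<Omega> (D m) = L2_class \<Omega> u - to_l2 (\<phi> m)" for m
    using L2_diff[OF \<Omega> uL test_L2[OF \<Omega> \<phi>(1)[of m]]]
    by (simp_all add: D_def[abs_def] L2_class_test[OF \<phi>(1)])
  define w where "w m j d = weak_deriv \<Omega> (hfield j) d (D m)" for m j d
  have wd: "has_weak_deriv \<Omega> (hfield j) d (D m) (w m j d)" if "d \<in> {1..2}" for m j d
    using uw[OF that] weak_deriv_minus_test[OF \<Omega> uL _ \<phi>(1)] unfolding w_def D_def[abs_def] by blast
  have wL: "w m j d \<in> L2 \<Omega>" if "d \<in> {1..2}" for m j d
    using wd[OF that] by (simp add: has_weak_deriv_def)
  have S: "(S_norm 2 \<Omega> (D m))\<^sup>2 = (\<Sum>d=1..2. \<Sum>j\<in>UNIV. (norm (L2_class \<Omega> (w m j d)))\<^sup>2)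
      + (norm (L2_class \<Omega> (D m)))\<^sup>2" for m
    unfolding w_def using wL unfolding w_def by (intro S_norm_sq[OF \<Omega> D(1)]) auto
  have S_nonneg: "S_norm 2 \<Omega> (D m) \<ge> 0" for m
    by (auto simp: S_norm_def intro!: Bochner_Integration.integral_nonneg add_nonneg_nonneg sum_nonneg)
  have w_small: "norm (L2_class \<Omega> (w m j d)) \<le> inverse (real (Suc m))" if "d \<in> {1..2}" for m j d
  proof -
    have "(norm (L2_class \<Omega> (w m j d)))\<^sup>2 \<le> (\<Sum>j\<in>UNIV. (norm (L2_class \<Omega> (w m j d)))\<^sup>2)"
      by (rule member_le_sum) auto
    also have "\<dots> \<le> (\<Sum>d=1..2. \<Sum>j\<in>UNIV. (norm (L2_class \<Omega> (w m j d)))\<^sup>2)"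
      using that by (intro member_le_sum[of d]) (auto intro: sum_nonneg)
    also have "\<dots> \<le> (S_norm 2 \<Omega> (D m))\<^sup>2" by (simp add: S)
    finally have "norm (L2_class \<Omega> (w m j d)) \<le> S_norm 2 \<Omega> (D m)"
      by (rule power2_le_imp_le) (rule S_nonneg)
    then show ?thesis using \<phi>(2)[of m] unfolding D_def[abs_def] by linarith
  qed
  have D_small: "norm (L2_class \<Omega> u - to_l2 (\<phi> m)) \<le> inverse (real (Suc m))" for m
  proof -
    have "(norm (L2_class \<Omega> (D m)))\<^sup>2 \<le> (S_norm 2 \<Omega> (D m))\<^sup>2"
      unfolding S by (simp add: sum_nonneg)
    then have "norm (L2_class \<Omega> (D m)) \<le> S_norm 2 \<Omega> (D m)"
      by (rule power2_le_imp_le) (rule S_nonneg)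
    then show ?thesis using \<phi>(2)[of m] unfolding D(2) unfolding D_def[abs_def] by linarith
  qed
  have diff: "norm (to_l2 (hpow j d (\<phi> m)) - to_l2 (hpow j d (\<phi> l)))
      \<le> inverse (real (Suc m)) + inverse (real (Suc l))" if d: "d \<in> {1..2}" for j d m l
  proof -
    let ?\<chi> = "\<lambda>z. hpow j d (\<phi> m) z - hpow j d (\<phi> l) z"
    have \<chi>: "?\<chi> \<in> test_functions \<Omega>" by (intro test_diff test_hpow \<phi>)
    have \<chi>eq: "to_l2 ?\<chi> = to_l2 (hpow j d (\<phi> m)) - to_l2 (hpow j d (\<phi> l))"
      by (intro to_l2_diff test_sq test_hpow \<phi>U)
    have w: "inner (L2_class \<Omega> (w i j d)) (to_l2 ?\<chi>) = (-1) ^ d * inner (L2_class \<Omega> u - to_l2 (\<phi> i)) (to_l2 (hpow j d ?\<chi>))" for i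
      using wd[OF d, of j i] \<chi> unfolding has_weak_deriv_iff[OF \<Omega> D(1)] D(2) by blast
    have "inner (to_l2 ?\<chi>) (to_l2 ?\<chi>)
        = (-1) ^ d * inner (to_l2 (\<phi> m) - to_l2 (\<phi> l)) (to_l2 (hpow j d ?\<chi>))"
      using inner_hpow[OF \<phi>U[of m] test_UNIV[OF \<chi>], of d j]
        inner_hpow[OF \<phi>U[of l] test_UNIV[OF \<chi>], of d j]
      by (simp add: \<chi>eq inner_diff_left right_diff_distrib)
    also have "\<dots> = inner (L2_class \<Omega> (w l j d) - L2_class \<Omega> (w m j d)) (to_l2 ?\<chi>)"
      by (simp add: inner_diff_left w right_diff_distrib)
    also have "\<dots> \<le> norm (L2_class \<Omega> (w l j d) - L2_class \<Omega> (w m j d)) * norm (to_l2 ?\<chi>)"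
      by (rule norm_cauchy_schwarz)
    finally have "norm (to_l2 ?\<chi>) * norm (to_l2 ?\<chi>)
        \<le> norm (L2_class \<Omega> (w l j d) - L2_class \<Omega> (w m j d)) * norm (to_l2 ?\<chi>)"
      by (simp add: power2_norm_eq_inner[symmetric] power2_eq_square)
    then have "norm (to_l2 ?\<chi>) \<le> norm (L2_class \<Omega> (w l j d) - L2_class \<Omega> (w m j d))"
      by (cases "norm (to_l2 ?\<chi>) = 0") (auto dest: mult_right_le_imp_le)
    also have "\<dots> \<le> norm (L2_class \<Omega> (w l j d)) + norm (L2_class \<Omega> (w m j d))"
      by (rule norm_triangle_ineq4)
    finally show ?thesis using w_small[OF d, of l j] w_small[OF d, of m j] unfolding \<chi>eq by linarith
  qed
  have "convergent (\<lambda>m. to_l2 (hpow j d (\<phi> m)))" if d: "d \<in> {1..2}" for j d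
  proof -
    have "Cauchy (\<lambda>m. to_l2 (hpow j d (\<phi> m)))"
    proof (rule CauchyI)
      fix e :: real assume "0 < e"
      then obtain M where M: "inverse (real (Suc M)) < e / 2" using reals_Archimedean[of "e / 2"] by auto
      have "norm (to_l2 (hpow j d (\<phi> m)) - to_l2 (hpow j d (\<phi> l))) < e" if "m \<ge> M" "l \<ge> M" for m l
      proof -
        have "inverse (real (Suc m)) \<le> inverse (real (Suc M))" "inverse (real (Suc l)) \<le> inverse (real (Suc M))"
          using that by (auto intro!: le_imp_inverse_le)
        then show ?thesis using diff[OF d, of j m l] M by linarith
      qed
      then show "\<exists>M. \<forall>m\<ge>M. \<forall>n\<ge>M. norm (to_l2 (hpow j d (\<phi> m)) - to_l2 (hpow j d (\<phi> n))) < e" by blast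
    qed
    then show ?thesis by (rule Cauchy_convergent)
  qed
  then have g: "(\<lambda>m. to_l2 (hpow j d (\<phi> m))) \<longlonglongrightarrow> lim (\<lambda>m. to_l2 (hpow j d (\<phi> m)))"
    if "d \<in> {1..2}" for j d using that by (simp add: convergent_LIMSEQ_iff)
  define g where "g j d = lim (\<lambda>m. to_l2 (hpow j d (\<phi> m)))" for j d
  note g = g[folded g_def]
  have "(\<lambda>m. L2_class \<Omega> u - to_l2 (\<phi> m)) \<longlonglongrightarrow> 0"
    by (rule Lim_null_comparison[OF always_eventually LIMSEQ_inverse_real_of_nat]) (use D_small in auto)
  then have "(\<lambda>m. L2_class \<Omega> u - (L2_class \<Omega> u - to_l2 (\<phi> m))) \<longlonglongrightarrow> L2_class \<Omega> u - 0"
    by (intro tendsto_diff tendsto_const)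
  then have lim0: "(\<lambda>m. to_l2 (\<phi> m)) \<longlonglongrightarrow> L2_class \<Omega> u" by simp
  let ?\<xi> = "(L2_class \<Omega> u, \<chi> j. g j 1, \<chi> j. g j 2)"
  have "(\<lambda>m. jet (\<phi> m)) \<longlonglongrightarrow> ?\<xi>"
    unfolding jet_def
  proof (intro tendsto_Pair lim0 vec_tendstoI)
    show "(\<lambda>m. (\<chi> j. to_l2 (hderiv j (\<phi> m))) $ j) \<longlonglongrightarrow> (\<chi> j. g j 1) $ j" for j
      using g[of 1 j] by simp
    show "(\<lambda>m. (\<chi> j. to_l2 (hderiv j (hderiv j (\<phi> m)))) $ j) \<longlonglongrightarrow> (\<chi> j. g j 2) $ j" for j
      using g[of 2 j] by (simp add: numeral_2_eq_2)
  qed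
  moreover have "jet (\<phi> m) \<in> jet ` test_functions \<Omega>" for m using \<phi>(1) by blast
  ultimately have "\<exists>x. (\<forall>m. x m \<in> jet ` test_functions \<Omega>) \<and> x \<longlonglongrightarrow> ?\<xi>"
    by (intro exI[of _ "\<lambda>m. jet (\<phi> m)"] conjI allI)
  then have "?\<xi> \<in> jets \<Omega>" unfolding jets_def closure_sequential .
  then show thesis by (rule that) simp
qed

text \<open>Multiplication by the indicator of \<open>\<Omega>\<close> is continuous and fixes the
  classes of test functions, so it fixes all their limits. Components of jets are therefore
  extensions by zero.\<close>

lemma jets_supported:
  fixes \<Omega> :: "'n::finite heis set"
  assumes \<Omega>: "\<Omega> \<in> sets lebesgue" and F: "bounded_linear F"
    and test: "\<And>f. f \<in> test_functions \<Omega> \<Longrightarrow> \<exists>g\<in>test_functions \<Omega>. F (jet f) = to_l2 g"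
    and \<xi>: "\<xi> \<in> jets \<Omega>"
  obtains f where "f \<in> L2 \<Omega>" "L2_class \<Omega> f = F \<xi>"
proof -
  have ind: "indicator \<Omega> \<in> borel_measurable lebesgue" "\<And>z. \<bar>indicator \<Omega> z :: real\<bar> \<le> 1"
    using \<Omega> by (auto simp: indicator_def)
  note [continuous_intros] = bounded_linear.continuous_on[OF bounded_linear_l2_mult[OF ind]]
    bounded_linear.continuous_on[OF F]
  have "l2_mult (indicator \<Omega>) (F \<xi>) = F \<xi>"
    using \<xi>
  proof (rule jets_closed_induct)
    fix f assume "f \<in> test_functions \<Omega>"
    then obtain g where g: "g \<in> test_functions \<Omega>" "F (jet f) = to_l2 g" using test by blast
    have "l2_mult (indicator \<Omega>) (to_l2 g) = L2_class \<Omega> g"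
      unfolding L2_class_def by (rule l2_mult_to_l2[OF ind test_sq_integrable[OF g(1)]])
    then show "l2_mult (indicator \<Omega>) (F (jet f)) = F (jet f)"
      by (simp add: g L2_class_test)
  qed (intro closed_Collect_eq continuous_intros)
  moreover obtain f where f: "sq_integrable f" "F \<xi> = to_l2 f" by (rule to_l2_cases)
  ultimately have "L2_class \<Omega> f = F \<xi>"
    unfolding L2_class_def using l2_mult_to_l2[OF ind f(1)] by simp
  then show thesis using sq_integrable_L2[OF \<Omega> f(1)] that by blast
qed

text \<open>Integration by parts passes to the limit, so the components of a jet represent weak
  derivatives of its value. By uniqueness of weak derivatives the chosen ones agree with them almost
  everywhere. The norm of \<open>v - \<phi>\<close> is then the norm of the jet difference, and
  approximability is membership in the closure.\<close>

lemma jets_S0_space: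
  fixes \<Omega> :: "'n::finite heis set"
  assumes op: "open \<Omega>" and \<xi>: "\<xi> \<in> jets \<Omega>"
  obtains v where "v \<in> S0_space 2 \<Omega>" "L2_class \<Omega> v = jval \<xi>"
proof -
  have \<Omega>: "\<Omega> \<in> sets lebesgue" using op by auto
  obtain v where v: "v \<in> L2 \<Omega>" "L2_class \<Omega> v = jval \<xi>"
    by (rule jets_supported[OF \<Omega> bounded_linear_fst _ \<xi>]) auto
  have "\<exists>g. g \<in> L2 \<Omega> \<and> L2_class \<Omega> g = jpow j d \<xi>" if "d \<in> {1..2}" for j d
    by (rule jets_supported[OF \<Omega> bounded_linear_jpow _ \<xi>, of j d])
      (use jpow_jet[OF that] test_hpow in blast)+
  note ex = this
  define g where "g j d = (SOME g. g \<in> L2 \<Omega> \<and> L2_class \<Omega> g = jpow j d \<xi>)" for j d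
  have g: "g j d \<in> L2 \<Omega>" "L2_class \<Omega> (g j d) = jpow j d \<xi>" if "d \<in> {1..2}" for j d
    using someI_ex[OF ex[OF that, of j]] by (simp_all add: g_def)
  have wd: "has_weak_deriv \<Omega> (hfield j) d v (g j d)" if d: "d \<in> {1..2}" for j d
    unfolding has_weak_deriv_iff[OF \<Omega> v(1)]
  proof (intro conjI ballI g(1) d)
    fix \<phi> assume \<phi>: "\<phi> \<in> test_functions \<Omega>"
    have "inner (jpow j d \<xi>) (to_l2 \<phi>) = (-1) ^ d * inner (jval \<xi>) (to_l2 (hpow j d \<phi>))"
      using \<xi>
    proof (rule jets_closed_induct)
      note [continuous_intros] = bounded_linear.continuous_on[OF bounded_linear_jpow]
      show "closed {\<xi>. inner (jpow j d \<xi>) (to_l2 \<phi>) = (-1) ^ d * inner (jval \<xi>) (to_l2 (hpow j d \<phi>))}"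
        by (intro closed_Collect_eq continuous_intros)
      fix f assume "f \<in> test_functions \<Omega>"
      then show "inner (jpow j d (jet f)) (to_l2 \<phi>) = (-1) ^ d * inner (jval (jet f)) (to_l2 (hpow j d \<phi>))"
        unfolding jpow_jet[OF d] jet_simps
        by (rule inner_hpow[OF test_UNIV test_UNIV[OF \<phi>]])
    qed
    then show "inner (L2_class \<Omega> (g j d)) (to_l2 \<phi>) = (-1) ^ d * inner (L2_class \<Omega> v) (to_l2 (hpow j d \<phi>))"
      by (simp only: g(2)[OF d] v(2))
  qed
  have S_eq: "(S_norm 2 \<Omega> (\<lambda>z. v z - \<phi> z))\<^sup>2 \<le> (norm (\<xi> - jet \<phi>))\<^sup>2" if \<phi>: "\<phi> \<in> test_functions \<Omega>" for \<phi>
  proof -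
    let ?D = "\<lambda>z. v z - \<phi> z" and ?w = "\<lambda>j d. weak_deriv \<Omega> (hfield j) d (\<lambda>z. v z - \<phi> z)"
    note D = L2_diff[OF \<Omega> v(1) test_L2[OF \<Omega> \<phi>]]
    have w: "has_weak_deriv \<Omega> (hfield j) d ?D (?w j d)" if "d \<in> {1..2}" for j d
      by (rule weak_deriv_minus_test[OF \<Omega> v(1) wd[OF that] \<phi>])
    have wL: "?w j d \<in> L2 \<Omega>" if "d \<in> {1..2}" for j d
      using w[OF that] by (simp add: has_weak_deriv_def)
    have weq: "L2_class \<Omega> (?w j d) = jpow j d (\<xi> - jet \<phi>)" if d: "d \<in> {1..2}" for j d
    proof -
      have h: "hpow j d \<phi> \<in> test_functions \<Omega>" by (rule test_hpow[OF \<phi>])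
      note gd = L2_diff[OF \<Omega> g(1)[OF d] test_L2[OF \<Omega> h]]
      have "L2_class \<Omega> (?w j d) = L2_class \<Omega> (\<lambda>z. g j d z - hpow j d \<phi> z)"
      proof (rule L2_class_weak_eqI[OF op wL[OF d] gd(1)])
        fix \<psi> assume \<psi>: "\<psi> \<in> test_functions \<Omega>"
        have "inner (L2_class \<Omega> (?w j d)) (to_l2 \<psi>) = (-1) ^ d * inner (L2_class \<Omega> v - to_l2 \<phi>) (to_l2 (hpow j d \<psi>))"
          using w[OF d, of j] \<psi> unfolding has_weak_deriv_iff[OF \<Omega> D(1)] D(2) L2_class_test[OF \<phi>] by blast
        also have "\<dots> = inner (L2_class \<Omega> (g j d)) (to_l2 \<psi>) - inner (to_l2 (hpow j d \<phi>)) (to_l2 \<psi>)"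
          using wd[OF d, of j] \<psi> inner_hpow[OF test_UNIV[OF \<phi>] test_UNIV[OF \<psi>], of d j]
          unfolding has_weak_deriv_iff[OF \<Omega> v(1)] by (simp add: inner_diff_left right_diff_distrib)
        finally show "L2_inner \<Omega> (?w j d) \<psi> = L2_inner \<Omega> (\<lambda>z. g j d z - hpow j d \<phi> z) \<psi>"
          using test_L2[OF \<Omega> \<psi>]
          by (simp add: L2_inner_eq[OF \<Omega>] wL[OF d] gd L2_class_test[OF \<psi>] L2_class_test[OF h] inner_diff_left)
      qed
      also have "\<dots> = jpow j d \<xi> - jpow j d (jet \<phi>)"
        by (simp add: gd(2) g(2)[OF d] L2_class_test[OF h] jpow_jet[OF d])
      also have "\<dots> = jpow j d (\<xi> - jet \<phi>)"
        by (simp add: linear_diff[OF bounded_linear.linear[OF bounded_linear_jpow]])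
      finally show ?thesis .
    qed
    have "(S_norm 2 \<Omega> ?D)\<^sup>2 = (\<Sum>d=1..2. \<Sum>j\<in>UNIV. (norm (L2_class \<Omega> (?w j d)))\<^sup>2)
        + (norm (L2_class \<Omega> ?D))\<^sup>2"
      by (rule S_norm_sq[OF \<Omega> D(1)]) (rule wL)
    also have "(\<Sum>d=1..2. \<Sum>j\<in>UNIV. (norm (L2_class \<Omega> (?w j d)))\<^sup>2)
        = (\<Sum>d=1..2. \<Sum>j\<in>UNIV. (norm (jpow j d (\<xi> - jet \<phi>)))\<^sup>2)"
      using weq by (intro sum.cong refl) simp
    also have "L2_class \<Omega> ?D = jval (\<xi> - jet \<phi>)"
      by (simp add: D(2) L2_class_test[OF \<phi>] v(2))
    finally have "(S_norm 2 \<Omega> ?D)\<^sup>2 = (\<Sum>d=1..2. \<Sum>j\<in>UNIV. (norm (jpow j d (\<xi> - jet \<phi>)))\<^sup>2)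
        + (norm (jval (\<xi> - jet \<phi>)))\<^sup>2" .
    also have "\<dots> = (norm (\<xi> - jet \<phi>))\<^sup>2"
      unfolding norm_jet_sq by (simp add: jpow_def numeral_2_eq_2)
    finally show ?thesis by simp
  qed
  have "v \<in> S0_space 2 \<Omega>"
    unfolding S0_space_def mem_Collect_eq
  proof (intro conjI allI impI)
    show "v \<in> S_space 2 \<Omega>" unfolding S_space_iff using v wd by blast
    fix \<epsilon> :: real assume "\<epsilon> > 0"
    then obtain \<eta> where \<eta>: "\<eta> \<in> jet ` test_functions \<Omega>" "dist \<eta> \<xi> < \<epsilon>"
      using \<xi> unfolding jets_def closure_approachable by blast
    then obtain \<phi> where \<phi>: "\<phi> \<in> test_functions \<Omega>" "\<eta> = jet \<phi>" by blast
    have "S_norm 2 \<Omega> (\<lambda>z. v z - \<phi> z) \<le> norm (\<xi> - jet \<phi>)"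
      by (rule power2_le_imp_le[OF S_eq[OF \<phi>(1)]]) simp
    also have "\<dots> < \<epsilon>" using \<eta>(2) \<phi>(2) by (simp add: dist_norm norm_minus_commute)
    finally show "\<exists>\<phi>\<in>test_functions \<Omega>. S_norm 2 \<Omega> (\<lambda>z. v z - \<phi> z) < \<epsilon>" using \<phi>(1) by blast
  qed
  then show thesis using v(2) by (rule that)
qed

lemma sublap_sublap_eq: "((\<lambda>f z. - kohn_laplacian f z) ^^ 2) \<phi> = sublap (sublap \<phi>)"
  by (simp add: numeral_2_eq_2 sublap_eq[abs_def])

text \<open>Moving one factor \<open>L\<close> from the test function to \<open>u\<close> turns the
  distributional equation into the weak form for \<open><L u, L \<eta>>\<close>. Both sides are
  continuous in the jet \<open>\<eta>\<close>, so test functions and all jets give the same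
  condition.\<close>

lemma weak_eigen_jets:
  fixes \<Omega> :: "'n::finite heis set"
  assumes \<Omega>: "\<Omega> \<in> sets lebesgue" and \<xi>: "\<xi> \<in> jets \<Omega>" and u: "u \<in> L2 \<Omega>" "L2_class \<Omega> u = jval \<xi>"
  shows "(\<forall>\<phi>\<in>test_functions \<Omega>. L2_inner \<Omega> u (((\<lambda>f z. - kohn_laplacian f z) ^^ 2) \<phi>) = \<mu> * L2_inner \<Omega> u \<phi>)
    \<longleftrightarrow> (\<forall>\<eta>\<in>jets \<Omega>. inner (jlap \<xi>) (jlap \<eta>) = \<mu> * inner (jval \<xi>) (jval \<eta>))"
proof -
  have eq: "L2_inner \<Omega> u (((\<lambda>f z. - kohn_laplacian f z) ^^ 2) \<phi>) = inner (jlap \<xi>) (jlap (jet \<phi>)) \<and>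
      L2_inner \<Omega> u \<phi> = inner (jval \<xi>) (jval (jet \<phi>))" if \<phi>: "\<phi> \<in> test_functions \<Omega>" for \<phi>
  proof -
    have s: "sublap \<phi> \<in> test_functions \<Omega>" "sublap (sublap \<phi>) \<in> test_functions \<Omega>"
      by (intro test_sublap \<phi>)+
    have "L2_inner \<Omega> u (sublap (sublap \<phi>)) = inner (jval \<xi>) (jlap (jet (sublap \<phi>)))"
      using s by (simp add: L2_inner_eq[OF \<Omega> u(1) test_L2[OF \<Omega>]] L2_class_test u(2)
          jlap_jet test_UNIV)
    also have "\<dots> = inner (jlap \<xi>) (jval (jet (sublap \<phi>)))"
      by (rule inner_jlap_commute[OF \<xi> jet_jets[OF s(1)], symmetric])
    finally show ?thesis
      using \<phi> by (simp add: sublap_sublap_eq jlap_jet[OF test_UNIV[OF \<phi>]]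
          L2_inner_eq[OF \<Omega> u(1) test_L2[OF \<Omega> \<phi>]] L2_class_test u(2))
  qed
  show ?thesis
  proof (intro iffI ballI)
    fix \<eta> assume *: "\<forall>\<phi>\<in>test_functions \<Omega>.
      L2_inner \<Omega> u (((\<lambda>f z. - kohn_laplacian f z) ^^ 2) \<phi>) = \<mu> * L2_inner \<Omega> u \<phi>" and "\<eta> \<in> jets \<Omega>"
    then show "inner (jlap \<xi>) (jlap \<eta>) = \<mu> * inner (jval \<xi>) (jval \<eta>)"
      by (elim jets_closed_induct) (intro closed_Collect_eq continuous_intros, use * eq in metis)
  next
    fix \<phi> assume "\<forall>\<eta>\<in>jets \<Omega>. inner (jlap \<xi>) (jlap \<eta>) = \<mu> * inner (jval \<xi>) (jval \<eta>)"
      "\<phi> \<in> test_functions \<Omega>"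
    then show "L2_inner \<Omega> u (((\<lambda>f z. - kohn_laplacian f z) ^^ 2) \<phi>) = \<mu> * L2_inner \<Omega> u \<phi>"
      using eq jet_jets by metis
  qed
qed

subsection \<open>The variational principle\<close>

lemma finite_convergent_subsequence:
  fixes a :: "'i \<Rightarrow> nat \<Rightarrow> real"
  assumes "finite F" "\<And>g. g \<in> F \<Longrightarrow> bounded (range (a g))"
  shows "\<exists>r :: nat \<Rightarrow> nat. strict_mono r \<and> (\<forall>g\<in>F. convergent (a g \<circ> r))"
  using assms
proof (induction F rule: finite_induct)
  case empty
  then show ?case by (auto intro: strict_mono_id)
next
  case (insert g F)
  have "\<exists>r :: nat \<Rightarrow> nat. strict_mono r \<and> (\<forall>g\<in>F. convergent (a g \<circ> r))"
    by (rule insert.IH) (rule insert.prems, simp)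
  then obtain r :: "nat \<Rightarrow> nat" where r: "strict_mono r" "\<forall>h\<in>F. convergent (a h \<circ> r)" by blast
  have "bounded (range (a g \<circ> r))"
    using insert.prems[of g] by (auto intro: bounded_subset)
  then obtain l s where s: "strict_mono s" "((a g \<circ> r) \<circ> s) \<longlonglongrightarrow> l"
    using bounded_imp_convergent_subsequence by blast
  have "convergent (a h \<circ> (r \<circ> s))" if "h \<in> insert g F" for h
  proof (cases "h = g")
    case True
    then show ?thesis using s(2) by (auto simp: convergent_def o_assoc)
  next
    case False
    then have "convergent (a h \<circ> r)" using r(2) that by auto
    then obtain l' where "(a h \<circ> r) \<longlonglongrightarrow> l'" by (auto simp: convergent_def)
    then have "((a h \<circ> r) \<circ> s) \<longlonglongrightarrow> l'" by (rule LIMSEQ_subseq_LIMSEQ[OF _ s(1)])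
    then show ?thesis by (auto simp: convergent_def o_assoc)
  qed
  then show ?case using strict_mono_o[OF r(1) s(1)] by blast
qed

lemma quadratic_nonneg_slope:
  fixes q B :: real
  assumes "\<And>s. 0 \<le> 2 * s * q + s\<^sup>2 * B"
  shows "q = 0"
proof (rule ccontr)
  assume "q \<noteq> 0"
  have B: "B \<ge> 0" using assms[of 1] assms[of "-1"] by simp
  \<comment> \<open>At \<open>s = - c\<close> the quadratic equals \<open>- c^2 * (B + 2)\<close>.
    Dividing by \<open>B + 1\<close> instead of \<open>B\<close> covers
    \<open>B = 0\<close>.\<close>
  define c where "c = q / (B + 1)"
  have q: "q = c * (B + 1)" using B by (simp add: c_def)
  have "0 \<le> 2 * (- c) * q + (- c)\<^sup>2 * B" by (rule assms)
  also have "\<dots> = - (c\<^sup>2 * (B + 2))"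
    unfolding q by (simp add: algebra_simps power2_eq_square)
  also have "\<dots> < 0" using B \<open>q \<noteq> 0\<close> q by (auto intro!: mult_pos_pos)
  finally show False by simp
qed

text \<open>The direct method: along a minimizing sequence of the Rayleigh quotient the parallelogram law and
  the finite codimension estimate give convergence in the norm of the form.\<close>

lemma rayleigh_minimizer:
  fixes M :: "'e::banach set" and U L :: "'e \<Rightarrow> 'h::real_inner"
  assumes M: "closed M" "subspace M" and U: "bounded_linear U" and L: "bounded_linear L"
    and norm: "\<And>\<xi>. \<xi> \<in> M \<Longrightarrow> (norm \<xi>)\<^sup>2 \<le> C * ((norm (U \<xi>))\<^sup>2 + (norm (L \<xi>))\<^sup>2)" and C: "C \<ge> 0"
    and comp: "\<And>K. K > 0 \<Longrightarrow> \<exists>F A. finite F \<and> A \<ge> 0 \<and>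
      (\<forall>\<xi>\<in>M. K * (norm (U \<xi>))\<^sup>2 \<le> (norm (L \<xi>))\<^sup>2 + A * (\<Sum>g\<in>F. (inner (U \<xi>) g)\<^sup>2))"
    and ex: "\<xi>0 \<in> M" "(norm (L \<xi>0))\<^sup>2 < \<kappa> * (norm (U \<xi>0))\<^sup>2"
  obtains \<mu> \<xi> where "\<mu> < \<kappa>" "\<xi> \<in> M" "U \<xi> \<noteq> 0"
    "\<And>\<eta>. \<eta> \<in> M \<Longrightarrow> inner (L \<xi>) (L \<eta>) = \<mu> * inner (U \<xi>) (U \<eta>)"
proof -
  note lU = bounded_linear.linear[OF U] and lL = bounded_linear.linear[OF L]
  define S where "S = {(norm (L \<xi>))\<^sup>2 | \<xi>. \<xi> \<in> M \<and> norm (U \<xi>) = 1}"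
  define \<mu> where "\<mu> = Inf S"
  have bdd: "bdd_below S" by (rule bdd_belowI[of _ 0]) (auto simp: S_def)
  have scaled: "(norm (L \<eta>))\<^sup>2 / (norm (U \<eta>))\<^sup>2 \<in> S" if "\<eta> \<in> M" "U \<eta> \<noteq> 0" for \<eta>
  proof -
    let ?\<zeta> = "inverse (norm (U \<eta>)) *\<^sub>R \<eta>"
    have 1: "?\<zeta> \<in> M" using that(1) M(2) by (simp add: subspace_scale)
    have 2: "norm (U ?\<zeta>) = 1" using that(2) by (simp add: linear_cmul[OF lU])
    have 3: "(norm (L ?\<zeta>))\<^sup>2 = (norm (L \<eta>))\<^sup>2 / (norm (U \<eta>))\<^sup>2"
      by (simp add: linear_cmul[OF lL] power_mult_distrib field_simps)
    show ?thesis unfolding S_def mem_Collect_eq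
      by (rule exI[of _ ?\<zeta>], rule conjI[OF 3[symmetric] conjI[OF 1 2]])
  qed
  have lower: "\<mu> * (norm (U \<eta>))\<^sup>2 \<le> (norm (L \<eta>))\<^sup>2" if "\<eta> \<in> M" for \<eta>
  proof (cases "U \<eta> = 0")
    case False
    then have "\<mu> \<le> (norm (L \<eta>))\<^sup>2 / (norm (U \<eta>))\<^sup>2"
      unfolding \<mu>_def by (intro cInf_lower scaled that bdd)
    then show ?thesis using False by (simp add: field_simps)
  qed simp
  have U0: "U \<xi>0 \<noteq> 0" using ex(2) by auto
  have S0: "S \<noteq> {}" using scaled[OF ex(1) U0] by auto
  have \<mu>0: "\<mu> \<ge> 0" unfolding \<mu>_def by (intro cInf_greatest S0) (auto simp: S_def)
  have "\<mu> \<le> (norm (L \<xi>0))\<^sup>2 / (norm (U \<xi>0))\<^sup>2"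
    unfolding \<mu>_def by (intro cInf_lower scaled ex U0 bdd)
  also have "\<dots> < \<kappa>" using ex(2) U0 by (simp add: field_simps)
  finally have \<mu>\<kappa>: "\<mu> < \<kappa>" .
  have "\<exists>\<xi>. \<xi> \<in> M \<and> norm (U \<xi>) = 1 \<and> (norm (L \<xi>))\<^sup>2 < \<mu> + inverse (real (Suc m))" for m
  proof -
    have "Inf S < \<mu> + inverse (real (Suc m))" by (simp add: \<mu>_def)
    then obtain y where "y \<in> S" "y < \<mu> + inverse (real (Suc m))"
      using cInf_lessD[OF S0] by blast
    then show ?thesis unfolding S_def by blast
  qed
  then obtain \<xi> where \<xi>: "\<And>m. \<xi> m \<in> M" "\<And>m. norm (U (\<xi> m)) = 1"
      "\<And>m. (norm (L (\<xi> m)))\<^sup>2 < \<mu> + inverse (real (Suc m))" by metis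
  \<comment> \<open>With \<open>K = \<mu> + 1\<close> the estimate reads
    \<open>norm (U \<eta>)^2 \<le> b \<eta> + A * (\<Sum> ...)\<close> for the defect
    \<open>b\<close> introduced below: differences that are small in \<open>b\<close> and in
    finitely many functionals are small in norm.\<close>
  obtain F A where FA: "finite F" "A \<ge> 0"
    "\<And>\<eta>. \<eta> \<in> M \<Longrightarrow> (\<mu> + 1) * (norm (U \<eta>))\<^sup>2 \<le> (norm (L \<eta>))\<^sup>2 + A * (\<Sum>g\<in>F. (inner (U \<eta>) g)\<^sup>2)"
    using comp[of "\<mu> + 1"] \<mu>0 by auto
  have "bounded (range (\<lambda>m. inner (U (\<xi> m)) g))" for g
  proof (rule boundedI)
    show "norm y \<le> norm g" if "y \<in> range (\<lambda>m. inner (U (\<xi> m)) g)" for y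
      using that Cauchy_Schwarz_ineq2[of "U (\<xi> _)" g] by (auto simp: \<xi>(2))
  qed
  then obtain r :: "nat \<Rightarrow> nat" where r: "strict_mono r"
      "\<forall>g\<in>F. convergent ((\<lambda>m. inner (U (\<xi> m)) g) \<circ> r)"
    using finite_convergent_subsequence[OF FA(1), of "\<lambda>g m. inner (U (\<xi> m)) g"] by blast
  define \<eta> where "\<eta> m = \<xi> (r m)" for m
  have \<eta>: "\<eta> m \<in> M" "norm (U (\<eta> m)) = 1" "(norm (L (\<eta> m)))\<^sup>2 < \<mu> + inverse (real (Suc m))" for m
  proof -
    have "inverse (real (Suc (r m))) \<le> inverse (real (Suc m))"
      using seq_suble[OF r(1), of m] by (intro le_imp_inverse_le) auto
    then show "(norm (L (\<eta> m)))\<^sup>2 < \<mu> + inverse (real (Suc m))"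
      using \<xi>(3)[of "r m"] unfolding \<eta>_def by linarith
  qed (auto simp: \<eta>_def \<xi>)
  define \<alpha> where "\<alpha> g = lim (\<lambda>m. inner (U (\<eta> m)) g)" for g
  have \<alpha>: "(\<lambda>m. inner (U (\<eta> m)) g) \<longlonglongrightarrow> \<alpha> g" if "g \<in> F" for g
    using r(2) that by (auto simp: \<alpha>_def \<eta>_def o_def convergent_LIMSEQ_iff)
  define b where "b \<zeta> = (norm (L \<zeta>))\<^sup>2 - \<mu> * (norm (U \<zeta>))\<^sup>2" for \<zeta>
  have b_nonneg: "b \<zeta> \<ge> 0" if "\<zeta> \<in> M" for \<zeta>
    using lower[OF that] by (simp add: b_def)
  have b_add: "b (x + s *\<^sub>R y) = b x + 2 * s * (inner (L x) (L y) - \<mu> * inner (U x) (U y)) + s\<^sup>2 * b y" for x y s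
    unfolding b_def linear_add[OF lL] linear_add[OF lU] linear_cmul[OF lL] linear_cmul[OF lU] power2_norm_eq_inner
    by (simp add: inner_add_left inner_add_right inner_commute algebra_simps power2_eq_square)
  define t where "t m = 2 * inverse (real (Suc m)) + 2 * A * (\<Sum>g\<in>F. (inner (U (\<eta> m)) g - \<alpha> g)\<^sup>2)" for m
  have t_nonneg: "t m \<ge> 0" for m
    unfolding t_def using FA(2) by (intro add_nonneg_nonneg mult_nonneg_nonneg sum_nonneg) auto
  have t_lim: "t \<longlonglongrightarrow> 0"
  proof -
    have "t \<longlonglongrightarrow> 2 * 0 + 2 * A * (\<Sum>g\<in>F. (\<alpha> g - \<alpha> g)\<^sup>2)"
      unfolding t_def[abs_def] by (intro tendsto_intros \<alpha> LIMSEQ_inverse_real_of_nat)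
    then show ?thesis by simp
  qed
  have diff: "(norm (\<eta> m - \<eta> l))\<^sup>2 \<le> C * (2 + \<mu>) * (t m + t l)" for m l
  proof -
    let ?d = "\<eta> m - \<eta> l"
    have dM: "?d \<in> M" "\<eta> m + \<eta> l \<in> M" using \<eta>(1) M(2) by (auto simp: subspace_diff subspace_add)
    \<comment> \<open>The parallelogram law for the quadratic form \<open>b\<close>. Both terms on
      the right are almost minimal and \<open>b\<close> is nonnegative at the sum, so
      \<open>b\<close> is small at the difference.\<close>
    have "b ?d + b (\<eta> m + \<eta> l) = 2 * b (\<eta> m) + 2 * b (\<eta> l)"
      using b_add[of "\<eta> m" 1 "\<eta> l"] b_add[of "\<eta> m" "-1" "\<eta> l"] by simp
    moreover have "b (\<eta> i) \<le> inverse (real (Suc i))" for i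
      using \<eta>(2,3)[of i] by (simp add: b_def)
    ultimately have bd: "b ?d \<le> 2 * inverse (real (Suc m)) + 2 * inverse (real (Suc l))"
      using b_nonneg[OF dM(2)] by (smt (verit))
    have "(\<Sum>g\<in>F. (inner (U ?d) g)\<^sup>2)
        \<le> (\<Sum>g\<in>F. 2 * (inner (U (\<eta> m)) g - \<alpha> g)\<^sup>2 + 2 * (inner (U (\<eta> l)) g - \<alpha> g)\<^sup>2)"
    proof (rule sum_mono)
      fix g
      let ?x = "inner (U (\<eta> m)) g - \<alpha> g" and ?y = "inner (U (\<eta> l)) g - \<alpha> g"
      have *: "inner (U ?d) g = ?x - ?y" by (simp add: linear_diff[OF lU] inner_diff_left)
      have "(x - y)\<^sup>2 \<le> 2 * x\<^sup>2 + 2 * y\<^sup>2" for x y :: real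
        using zero_le_power2[of "x + y"] unfolding power2_sum power2_diff by linarith
      then show "(inner (U ?d) g)\<^sup>2 \<le> 2 * ?x\<^sup>2 + 2 * ?y\<^sup>2" unfolding * .
    qed
    then have "A * (\<Sum>g\<in>F. (inner (U ?d) g)\<^sup>2)
        \<le> A * (\<Sum>g\<in>F. 2 * (inner (U (\<eta> m)) g - \<alpha> g)\<^sup>2 + 2 * (inner (U (\<eta> l)) g - \<alpha> g)\<^sup>2)"
      by (rule mult_left_mono[OF _ FA(2)])
    also have "\<dots> = 2 * A * (\<Sum>g\<in>F. (inner (U (\<eta> m)) g - \<alpha> g)\<^sup>2) + 2 * A * (\<Sum>g\<in>F. (inner (U (\<eta> l)) g - \<alpha> g)\<^sup>2)"
      by (simp add: sum.distrib algebra_simps flip: sum_distrib_left)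
    finally have "(norm (U ?d))\<^sup>2 \<le> t m + t l"
      using FA(3)[OF dM(1)] bd unfolding t_def b_def by (simp add: distrib_right)
    moreover have "b ?d \<le> t m + t l"
    proof -
      have nonneg: "0 \<le> 2 * A * (\<Sum>g\<in>F. (inner (U (\<eta> i)) g - \<alpha> g)\<^sup>2)" for i
        using FA(2) by (intro mult_nonneg_nonneg sum_nonneg) auto
      show ?thesis using bd nonneg[of m] nonneg[of l] unfolding t_def by linarith
    qed
    moreover have "(norm (L ?d))\<^sup>2 = b ?d + \<mu> * (norm (U ?d))\<^sup>2" by (simp add: b_def)
    moreover have "\<mu> * (norm (U ?d))\<^sup>2 \<le> \<mu> * (t m + t l)"
      by (intro mult_left_mono calculation(1) \<mu>0)
    ultimately have "(norm (U ?d))\<^sup>2 + (norm (L ?d))\<^sup>2 \<le> (2 + \<mu>) * (t m + t l)"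
      by (simp add: algebra_simps)
    then have "C * ((norm (U ?d))\<^sup>2 + (norm (L ?d))\<^sup>2) \<le> C * ((2 + \<mu>) * (t m + t l))"
      by (rule mult_left_mono[OF _ C])
    then show ?thesis using norm[OF dM(1)] by (simp add: mult.assoc)
  qed
  have "Cauchy \<eta>"
  proof (rule CauchyI)
    fix e :: real assume e: "0 < e"
    define c where "c = C * (2 + \<mu>) + 1"
    have c: "c > 0" "C * (2 + \<mu>) \<le> c" using C \<mu>0 by (auto simp: c_def intro: add_nonneg_pos)
    have "e\<^sup>2 / (2 * c) > 0" using e c by simp
    then obtain N where N: "\<And>m. m \<ge> N \<Longrightarrow> t m < e\<^sup>2 / (2 * c)"
      using order_tendstoD(2)[OF t_lim] unfolding eventually_sequentially by blast
    have "norm (\<eta> m - \<eta> l) < e" if "m \<ge> N" "l \<ge> N" for m l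
    proof -
      have "(norm (\<eta> m - \<eta> l))\<^sup>2 \<le> C * (2 + \<mu>) * (t m + t l)" by (rule diff)
      also have "\<dots> \<le> c * (t m + t l)"
        using t_nonneg c(2) by (intro mult_right_mono add_nonneg_nonneg) auto
      also have "\<dots> < c * (e\<^sup>2 / (2 * c) + e\<^sup>2 / (2 * c))"
        using N[OF that(1)] N[OF that(2)] c(1) by (intro mult_strict_left_mono) auto
      also have "\<dots> = e\<^sup>2" using c(1) by (simp add: field_simps)
      finally show ?thesis by (rule power2_less_imp_less) (use e in simp)
    qed
    then show "\<exists>N. \<forall>m\<ge>N. \<forall>n\<ge>N. norm (\<eta> m - \<eta> n) < e" by blast
  qed
  then obtain \<zeta> where \<zeta>: "\<eta> \<longlonglongrightarrow> \<zeta>" using Cauchy_convergent convergent_def by blast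
  have \<zeta>M: "\<zeta> \<in> M" using closed_sequentially[OF M(1)] \<eta>(1) \<zeta> by blast
  have "(\<lambda>m. norm (U (\<eta> m))) \<longlonglongrightarrow> norm (U \<zeta>)"
    by (intro tendsto_intros bounded_linear.tendsto[OF U] \<zeta>)
  then have U1: "norm (U \<zeta>) = 1" by (simp add: \<eta>(2) LIMSEQ_const_iff)
  have "(\<lambda>m. (norm (L (\<eta> m)))\<^sup>2) \<longlonglongrightarrow> (norm (L \<zeta>))\<^sup>2"
    by (intro tendsto_intros bounded_linear.tendsto[OF L] \<zeta>)
  moreover have "(\<lambda>m. \<mu> + inverse (real (Suc m))) \<longlonglongrightarrow> \<mu> + 0"
    by (intro tendsto_intros LIMSEQ_inverse_real_of_nat)
  ultimately have "(norm (L \<zeta>))\<^sup>2 \<le> \<mu> + 0"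
    by (rule LIMSEQ_le) (use \<eta>(3) in \<open>auto intro: less_imp_le\<close>)
  then have b0: "b \<zeta> = 0" using b_nonneg[OF \<zeta>M] U1 by (simp add: b_def)
  show thesis
  proof (rule that[OF \<mu>\<kappa> \<zeta>M])
    show "U \<zeta> \<noteq> 0" using U1 by auto
    fix y assume y: "y \<in> M"
    \<comment> \<open>First variation: \<open>b\<close> is nonnegative on \<open>M\<close> and
      vanishes at \<open>\<zeta>\<close>, so its linear part there is zero, which is the weak
      eigenvalue equation.\<close>
    have "0 \<le> 2 * s * (inner (L \<zeta>) (L y) - \<mu> * inner (U \<zeta>) (U y)) + s\<^sup>2 * b y" for s
      using b_nonneg[of "\<zeta> + s *\<^sub>R y"] \<zeta>M y M(2) b0
      by (simp add: b_add subspace_add subspace_scale)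
    from quadratic_nonneg_slope[OF this]
    show "inner (L \<zeta>) (L y) = \<mu> * inner (U \<zeta>) (U y)" by simp
  qed
qed

section \<open>Lower bound of the form on the complement of the first eigenfunctions\<close>

lemma L2_scale:
  assumes \<Omega>: "\<Omega> \<in> sets lebesgue" and u: "u \<in> L2 \<Omega>"
  shows "(\<lambda>z. c * u z) \<in> L2 \<Omega>" "L2_class \<Omega> (\<lambda>z. c * u z) = c *\<^sub>R L2_class \<Omega> u"
proof -
  show "(\<lambda>z. c * u z) \<in> L2 \<Omega>" using u by (auto simp: L2_def power_mult_distrib)
  show "L2_class \<Omega> (\<lambda>z. c * u z) = c *\<^sub>R L2_class \<Omega> u"
    unfolding L2_class_def using to_l2_scale[OF L2_sq_integrable[OF \<Omega> u], of c]
    by (simp add: mult.left_commute)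
qed

lemma L2_sum:
  assumes \<Omega>: "\<Omega> \<in> sets lebesgue" and "finite I" and u: "\<And>i. i \<in> I \<Longrightarrow> u i \<in> L2 \<Omega>"
  shows "(\<lambda>z. \<Sum>i\<in>I. c i * u i z) \<in> L2 \<Omega> \<and>
    L2_class \<Omega> (\<lambda>z. \<Sum>i\<in>I. c i * u i z) = (\<Sum>i\<in>I. c i *\<^sub>R L2_class \<Omega> (u i))"
  using assms(2) u
proof (induction I rule: finite_induct)
  case empty
  have "(\<lambda>z. 0) \<in> L2 \<Omega>" by (simp add: L2_def)
  then show ?case by (simp add: L2_class_def to_l2_zero)
next
  case (insert i I)
  then have IH: "(\<lambda>z. \<Sum>i\<in>I. c i * u i z) \<in> L2 \<Omega>"
      "L2_class \<Omega> (\<lambda>z. \<Sum>i\<in>I. c i * u i z) = (\<Sum>i\<in>I. c i *\<^sub>R L2_class \<Omega> (u i))" by auto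
  note s = L2_scale[OF \<Omega>, of "u i" "- c i"]
  have "(\<lambda>z. \<Sum>i\<in>insert i I. c i * u i z) = (\<lambda>z. (\<Sum>i\<in>I. c i * u i z) - - c i * u i z)"
    using insert by (simp add: fun_eq_iff add.commute)
  then show ?case using L2_diff[OF \<Omega> IH(1) s(1)] s(2) IH(2) insert by simp
qed

lemma lam_mono:
  fixes lam :: "nat \<Rightarrow> real"
  assumes "\<forall>i\<ge>1. lam i \<le> lam (i + 1)" "1 \<le> i" "i \<le> j"
  shows "lam i \<le> lam j"
  using assms(3,2)
proof (induction j rule: dec_induct)
  case (step n)
  then show ?case using assms(1)[rule_format, of n] by simp
qed simp

text \<open>Minimization over the jets orthogonal to the first \<open>k\<close> eigenfunctions gives
  the weak equation only against such jets. It extends to every jet, since a combination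
  \<open>p\<close> of these eigenfunctions contributes nothing: \<open>jval \<eta>\<close> is
  orthogonal to them, and by their own equations so is \<open>jlap \<eta>\<close> to their images
  under \<open>L\<close>. The minimizer is thus an eigenfunction with eigenvalue below
  \<open>lam (k + 1)\<close>, and must be a combination of functions to which it is
  orthogonal.\<close>

lemma eigenvalue_variational:
  fixes \<Omega> :: "'n::finite heis set" and lam :: "nat \<Rightarrow> real" and k :: nat
  assumes op: "open \<Omega>" and bd: "bounded \<Omega>"
    and mono: "\<forall>i\<ge>1. lam i \<le> lam (i + 1)"
    and eig: "\<forall>i\<ge>1. eigenfunction \<Omega> (lam i) (u i)"
    and orth: "\<forall>i\<ge>1. \<forall>j\<ge>1. L2_inner \<Omega> (u i) (u j) = (if i = j then 1 else 0)"
    and all: "\<forall>\<mu> v. eigenfunction \<Omega> \<mu> v \<longrightarrow>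
           (\<exists>c. AE z in lebesgue_on \<Omega>. v z = (\<Sum>i | i \<ge> 1 \<and> lam i = \<mu>. c i * u i z))"
    and \<xi>: "\<And>i. i \<ge> 1 \<Longrightarrow> \<xi> i \<in> jets \<Omega>" "\<And>i. i \<ge> 1 \<Longrightarrow> jval (\<xi> i) = L2_class \<Omega> (u i)"
    and \<zeta>: "\<zeta> \<in> jets \<Omega>" "\<And>i. i \<in> {1..k} \<Longrightarrow> inner (jval \<zeta>) (jval (\<xi> i)) = 0"
  shows "lam (k + 1) * (norm (jval \<zeta>))\<^sup>2 \<le> (norm (jlap \<zeta>))\<^sup>2"
proof (rule ccontr)
  assume "\<not> ?thesis"
  then have less: "(norm (jlap \<zeta>))\<^sup>2 < lam (k + 1) * (norm (jval \<zeta>))\<^sup>2" by simp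
  have \<Omega>: "\<Omega> \<in> sets lebesgue" using op by auto
  have uL: "u i \<in> L2 \<Omega>" if "i \<ge> 1" for i
    using eig that by (auto simp: eigenfunction_def S0_space_def S_space_def)
  have eigj: "inner (jlap (\<xi> i)) (jlap \<eta>) = lam i * inner (jval (\<xi> i)) (jval \<eta>)"
    if "i \<ge> 1" "\<eta> \<in> jets \<Omega>" for i \<eta>
  proof -
    have "\<forall>\<phi>\<in>test_functions \<Omega>.
        L2_inner \<Omega> (u i) (((\<lambda>f z. - kohn_laplacian f z) ^^ 2) \<phi>) = lam i * L2_inner \<Omega> (u i) \<phi>"
      using eig that(1) unfolding eigenfunction_def by blast
    then show ?thesis
      using weak_eigen_jets[OF \<Omega> \<xi>(1)[OF that(1)] uL[OF that(1)] \<xi>(2)[OF that(1), symmetric]] that(2)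
      by blast
  qed
  have orthj: "inner (jval (\<xi> i)) (jval (\<xi> j)) = (if i = j then 1 else 0)" if "i \<ge> 1" "j \<ge> 1" for i j
    using orth that by (simp add: \<xi>(2) L2_inner_eq[OF \<Omega> uL uL])
  let ?M = "{\<eta> \<in> jets \<Omega>. \<forall>i\<in>{1..k}. inner (jval \<eta>) (jval (\<xi> i)) = 0}"
  have Meq: "?M = jets \<Omega> \<inter> (\<Inter>i\<in>{1..k}. {\<eta>. inner (jval \<eta>) (jval (\<xi> i)) = 0})" by auto
  have M: "closed ?M" "subspace ?M"
  proof -
    show "closed ?M" unfolding Meq
      by (intro closed_Int closed_jets closed_INT ballI closed_Collect_eq continuous_intros)
    show "subspace ?M"
      using subspace_jets[of \<Omega>] by (auto simp: subspace_def inner_add_left)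
  qed
  obtain C where C: "C \<ge> 0" "\<And>\<eta>. \<eta> \<in> jets \<Omega> \<Longrightarrow> (norm \<eta>)\<^sup>2 \<le> C * ((norm (jval \<eta>))\<^sup>2 + (norm (jlap \<eta>))\<^sup>2)"
    using norm_jets_le[of \<Omega>] by blast
  have comp: "\<exists>F A. finite F \<and> A \<ge> 0 \<and>
      (\<forall>\<eta>\<in>?M. K * (norm (jval \<eta>))\<^sup>2 \<le> (norm (jlap \<eta>))\<^sup>2 + A * (\<Sum>g\<in>F. (inner (jval \<eta>) g)\<^sup>2))"
    if "K > 0" for K
    by (rule jets_compactness[OF bd that]) blast
  obtain \<mu> \<eta> where \<mu>: "\<mu> < lam (k + 1)" "\<eta> \<in> ?M" "jval \<eta> \<noteq> 0"
    "\<And>\<theta>. \<theta> \<in> ?M \<Longrightarrow> inner (jlap \<eta>) (jlap \<theta>) = \<mu> * inner (jval \<eta>) (jval \<theta>)"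
    by (rule rayleigh_minimizer[OF M bounded_linear_fst bounded_linear_jlap _ C(1) comp _ less])
      (use C(2) \<zeta> in auto)
  note ljlap = bounded_linear.linear[OF bounded_linear_jlap]
  have weak: "inner (jlap \<eta>) (jlap \<theta>) = \<mu> * inner (jval \<eta>) (jval \<theta>)" if \<theta>: "\<theta> \<in> jets \<Omega>" for \<theta>
  proof -
    define p where "p = (\<Sum>i\<in>{1..k}. inner (jval \<theta>) (jval (\<xi> i)) *\<^sub>R \<xi> i)"
    have pj: "p \<in> jets \<Omega>"
      unfolding p_def by (intro subspace_sum subspace_scale subspace_jets \<xi>(1)) auto
    have pv: "jval p = (\<Sum>i\<in>{1..k}. inner (jval \<theta>) (jval (\<xi> i)) *\<^sub>R jval (\<xi> i))"
      by (simp add: p_def fst_sum)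
    have "inner (jval (\<theta> - p)) (jval (\<xi> l)) = 0" if "l \<in> {1..k}" for l
    proof -
      have "inner (jval p) (jval (\<xi> l)) = (\<Sum>i\<in>{1..k}. if i = l then inner (jval \<theta>) (jval (\<xi> i)) else 0)"
        unfolding pv inner_sum_left using that by (intro sum.cong refl) (auto simp: orthj)
      also have "\<dots> = inner (jval \<theta>) (jval (\<xi> l))"
        by (subst sum.delta) (use that in auto)
      finally show ?thesis by (simp add: inner_diff_left)
    qed
    then have "\<theta> - p \<in> ?M" using subspace_diff[OF subspace_jets \<theta> pj] by blast
    from \<mu>(4)[OF this] have "inner (jlap \<eta>) (jlap \<theta>) - inner (jlap \<eta>) (jlap p)
        = \<mu> * (inner (jval \<eta>) (jval \<theta>) - inner (jval \<eta>) (jval p))"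
      by (simp add: linear_diff[OF ljlap] inner_diff_right)
    moreover have "inner (jval \<eta>) (jval p) = 0"
      unfolding pv inner_sum_right using \<mu>(2) by (intro sum.neutral) auto
    moreover have "inner (jlap \<eta>) (jlap p) = 0"
    proof -
      have "inner (jlap \<eta>) (jlap (\<xi> i)) = 0" if "i \<in> {1..k}" for i
        using eigj[of i \<eta>] that \<mu>(2) by (simp add: inner_commute)
      then show ?thesis
        unfolding p_def linear_sum[OF ljlap] linear_cmul[OF ljlap] inner_sum_right
        by (intro sum.neutral) auto
    qed
    ultimately show ?thesis by simp
  qed
  have \<eta>j: "\<eta> \<in> jets \<Omega>" using \<mu>(2) by blast
  obtain v where v: "v \<in> S0_space 2 \<Omega>" "L2_class \<Omega> v = jval \<eta>"
    using jets_S0_space[OF op \<eta>j] by blast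
  have vL: "v \<in> L2 \<Omega>" using v(1) by (auto simp: S0_space_def S_space_def)
  have "eigenfunction \<Omega> \<mu> v"
    unfolding eigenfunction_def
    using v(1) \<mu>(3) L2_class_eq_0_iff[OF \<Omega> vL] weak_eigen_jets[OF \<Omega> \<eta>j vL v(2), of \<mu>] weak v(2) by auto
  then obtain c where c: "AE z in lebesgue_on \<Omega>. v z = (\<Sum>i | i \<ge> 1 \<and> lam i = \<mu>. c i * u i z)"
    using all by blast
  let ?I = "{i. i \<ge> 1 \<and> lam i = \<mu>}"
  \<comment> \<open>Monotonicity puts all indices with \<open>lam i = \<mu> < lam (k + 1)\<close>
    among the first \<open>k\<close>. In particular the index set is finite, so the sum in
    \<open>c\<close> is a genuine one and not the default value 0 of an infinite sum.\<close>
  have I: "?I \<subseteq> {1..k}"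
  proof
    fix i assume i: "i \<in> ?I"
    have "\<not> k + 1 \<le> i"
      using lam_mono[OF mono, of "k + 1" i] i \<mu>(1) by auto
    then show "i \<in> {1..k}" using i by auto
  qed
  then have finI: "finite ?I" by (rule finite_subset) simp
  note sum = L2_sum[OF \<Omega> finI, of u c]
  have uI: "\<And>i. i \<in> ?I \<Longrightarrow> u i \<in> L2 \<Omega>" using uL by auto
  have "L2_class \<Omega> (\<lambda>z. v z - (\<Sum>i\<in>?I. c i * u i z)) = 0"
    using L2_class_eq_0_iff[OF \<Omega> L2_diff(1)[OF \<Omega> vL conjunct1[OF sum[OF uI]]]] c by simp
  then have "jval \<eta> = (\<Sum>i\<in>?I. c i *\<^sub>R L2_class \<Omega> (u i))"
    using L2_diff(2)[OF \<Omega> vL conjunct1[OF sum[OF uI]]] conjunct2[OF sum[OF uI]] v(2) by simp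
  also have "\<dots> = (\<Sum>i\<in>?I. c i *\<^sub>R jval (\<xi> i))"
    by (intro sum.cong refl) (auto simp: \<xi>(2))
  finally have "inner (jval \<eta>) (jval \<eta>) = inner (jval \<eta>) (\<Sum>i\<in>?I. c i *\<^sub>R jval (\<xi> i))"
    by (rule arg_cong)
  also have "\<dots> = (\<Sum>i\<in>?I. c i * inner (jval \<eta>) (jval (\<xi> i)))"
    by (simp only: inner_sum_right inner_scaleR_right)
  also have "\<dots> = 0" using I \<mu>(2) by (intro sum.neutral) auto
  finally show False using \<mu>(3) by simp
qed

section \<open>Finite sums: the commutator argument and Chebyshev's inequality\<close>

lemma sum_antisym_zero:
  fixes w :: "'i \<Rightarrow> 'i \<Rightarrow> real"
  assumes "\<And>i l. i \<in> I \<Longrightarrow> l \<in> I \<Longrightarrow> w i l = - w l i"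
  shows "(\<Sum>i\<in>I. \<Sum>l\<in>I. w i l) = 0"
proof -
  have "(\<Sum>i\<in>I. \<Sum>l\<in>I. w i l) = (\<Sum>i\<in>I. \<Sum>l\<in>I. - w l i)"
    by (rule sum.cong[OF refl], rule sum.cong[OF refl], rule assms)
  also have "\<dots> = - (\<Sum>i\<in>I. \<Sum>l\<in>I. w i l)"
    by (subst sum.swap) (simp add: sum_negf)
  finally show ?thesis by simp
qed

text \<open>Here \<open>x i\<close> is a coordinate function times \<open>u i\<close>, and \<open>p i\<close> is the conjugate field applied to \<open>u i\<close>.\<close>

lemma commutator_inequality:
  fixes u x p :: "nat \<Rightarrow> 'h::real_inner" and lam B :: "nat \<Rightarrow> real"
  assumes I: "finite I"
    and orth: "\<And>i l. i \<in> I \<Longrightarrow> l \<in> I \<Longrightarrow> inner (u i) (u l) = (if i = l then 1 else 0)"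
    and sym: "\<And>i l. i \<in> I \<Longrightarrow> l \<in> I \<Longrightarrow> inner (x i) (u l) = inner (x l) (u i)"
    and anti: "\<And>i l. i \<in> I \<Longrightarrow> l \<in> I \<Longrightarrow> inner (p i) (u l) = - inner (p l) (u i)"
    and px: "\<And>i. i \<in> I \<Longrightarrow> inner (p i) (x i) = - 1 / 2"
    and le: "\<And>i. i \<in> I \<Longrightarrow> lam i \<le> \<Lambda>"
    and var: "\<And>i. i \<in> I \<Longrightarrow> (\<Lambda> - lam i) * (norm (x i - (\<Sum>l\<in>I. inner (x i) (u l) *\<^sub>R u l)))\<^sup>2
      \<le> B i + (\<Sum>l\<in>I. (lam i - lam l) * (inner (x i) (u l))\<^sup>2)"
    and \<alpha>: "\<alpha> > 0"
  shows "(\<Sum>i\<in>I. (\<Lambda> - lam i)\<^sup>2)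
    \<le> \<alpha> * (\<Sum>i\<in>I. (\<Lambda> - lam i)\<^sup>2 * B i) + (1 / \<alpha>) * (\<Sum>i\<in>I. (\<Lambda> - lam i) * (norm (p i))\<^sup>2)"
proof -
  define \<delta> where "\<delta> i = \<Lambda> - lam i" for i
  define a where "a i l = inner (x i) (u l)" for i l
  define t where "t i l = inner (p i) (u l)" for i l
  define f where "f i = x i - (\<Sum>l\<in>I. a i l *\<^sub>R u l)" for i
  \<comment> \<open>Subtracting the projection from \<open>p i\<close> does not change its pairing
    with \<open>f i\<close>, which is orthogonal to all \<open>u l\<close>. It lowers the squared
    norm by the sum of the \<open>(t i l)^2\<close>, and these terms later pay for the cross
    sums.\<close>
  define q where "q i = p i - (\<Sum>l\<in>I. t i l *\<^sub>R u l)" for i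
  have \<delta>0: "\<delta> i \<ge> 0" if "i \<in> I" for i using le[OF that] by (simp add: \<delta>_def)
  have proj: "inner (\<Sum>l\<in>I. c l *\<^sub>R u l) (u m) = c m" if "m \<in> I" for c m
  proof -
    have "inner (\<Sum>l\<in>I. c l *\<^sub>R u l) (u m) = (\<Sum>l\<in>I. if l = m then c l else 0)"
      unfolding inner_sum_left using that by (intro sum.cong refl) (auto simp: orth)
    then show ?thesis using that I by simp
  qed
  have fu: "inner (f i) (u m) = 0" if "m \<in> I" for i m
    using that by (simp add: f_def inner_diff_left proj a_def)
  have qu: "inner (q i) (u m) = 0" if "m \<in> I" for i m
    using that by (simp add: q_def inner_diff_left proj t_def)
  have pf: "- 2 * inner (q i) (f i) = 1 + 2 * (\<Sum>l\<in>I. a i l * t i l)" if i: "i \<in> I" for i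
  proof -
    have "inner (q i) (f i) = inner (p i) (f i) - (\<Sum>l\<in>I. t i l * inner (u l) (f i))"
      by (simp add: q_def inner_diff_left inner_sum_left)
    also have "\<dots> = inner (p i) (f i)" by (simp add: fu inner_commute[of "u _" "f i"])
    also have "\<dots> = inner (p i) (x i) - (\<Sum>l\<in>I. a i l * t i l)"
      by (simp add: f_def inner_diff_right inner_sum_right t_def)
    finally show ?thesis by (simp add: px[OF i])
  qed
  have qn: "(norm (q i))\<^sup>2 = (norm (p i))\<^sup>2 - (\<Sum>l\<in>I. (t i l)\<^sup>2)" for i
  proof -
    have "inner (q i) (q i) = inner (q i) (p i) - (\<Sum>l\<in>I. t i l * inner (q i) (u l))"
      by (subst (2) q_def) (simp add: inner_diff_right inner_sum_right)
    also have "\<dots> = inner (q i) (p i)" by (simp add: qu)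
    also have "\<dots> = inner (p i) (p i) - (\<Sum>l\<in>I. (t i l)\<^sup>2)"
      by (simp add: q_def inner_diff_left inner_sum_left inner_commute[of "u _"] t_def[symmetric] power2_eq_square)
    finally show ?thesis by (simp add: power2_norm_eq_inner)
  qed
  have main: "(\<delta> i)\<^sup>2 + (\<Sum>l\<in>I. (\<delta> i)\<^sup>2 * (2 * (a i l * t i l)))
      \<le> \<alpha> * ((\<delta> i)\<^sup>2 * B i) + \<alpha> * (\<Sum>l\<in>I. (\<delta> i)\<^sup>2 * ((lam i - lam l) * (a i l)\<^sup>2))
        + (1 / \<alpha>) * (\<delta> i * (norm (p i))\<^sup>2) - (\<Sum>l\<in>I. \<delta> i * ((t i l)\<^sup>2 / \<alpha>))" if i: "i \<in> I" for i
  proof -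
    \<comment> \<open>Young's inequality with weight \<open>\<alpha> * \<delta> i\<close>. The extra
      factor \<open>\<delta> i\<close> is what allows the variational bound for
      \<open>\<delta> i * norm (f i)^2\<close> to be inserted.\<close>
    have "0 \<le> inner (\<alpha> *\<^sub>R (\<delta> i *\<^sub>R f i) + q i) (\<alpha> *\<^sub>R (\<delta> i *\<^sub>R f i) + q i)" by simp
    also have "\<dots> = \<alpha>\<^sup>2 * (\<delta> i)\<^sup>2 * (norm (f i))\<^sup>2 + 2 * \<alpha> * \<delta> i * inner (q i) (f i) + (norm (q i))\<^sup>2"
      unfolding power2_norm_eq_inner
      by (simp add: inner_add_left inner_add_right inner_commute power2_eq_square algebra_simps)
    finally have "\<alpha> * (\<delta> i * (- 2 * inner (q i) (f i))) \<le> \<alpha> * (\<alpha> * (\<delta> i)\<^sup>2 * (norm (f i))\<^sup>2 + (norm (q i))\<^sup>2 / \<alpha>)"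
      using \<alpha> by (simp add: algebra_simps power2_eq_square)
    then have "\<delta> i * (- 2 * inner (q i) (f i)) \<le> \<alpha> * (\<delta> i)\<^sup>2 * (norm (f i))\<^sup>2 + (norm (q i))\<^sup>2 / \<alpha>"
      using \<alpha> by (rule mult_left_le_imp_le)
    then have "\<delta> i * (\<delta> i * (- 2 * inner (q i) (f i))) \<le> \<delta> i * (\<alpha> * (\<delta> i)\<^sup>2 * (norm (f i))\<^sup>2 + (norm (q i))\<^sup>2 / \<alpha>)"
      by (rule mult_left_mono[OF _ \<delta>0[OF i]])
    also have "\<dots> = \<alpha> * (\<delta> i)\<^sup>2 * (\<delta> i * (norm (f i))\<^sup>2) + \<delta> i * ((norm (q i))\<^sup>2 / \<alpha>)"
      by (simp add: algebra_simps)
    also have "\<dots> \<le> \<alpha> * (\<delta> i)\<^sup>2 * (B i + (\<Sum>l\<in>I. (lam i - lam l) * (a i l)\<^sup>2)) + \<delta> i * ((norm (q i))\<^sup>2 / \<alpha>)"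
      using var[OF i] \<alpha> unfolding \<delta>_def f_def a_def by (intro add_right_mono mult_left_mono) auto
    finally show ?thesis
      unfolding pf[OF i] qn
      by (simp add: sum_distrib_left sum_divide_distrib[symmetric] power2_eq_square algebra_simps diff_divide_distrib)
  qed
  \<comment> \<open>Since \<open>\<delta> i + lam i - lam l = \<delta> l\<close>, the two weights
    add up to the symmetric \<open>\<delta> i * \<delta> l\<close>, whose sum against an
    antisymmetric \<open>w\<close> vanishes.\<close>
  have anti_sum: "(\<Sum>i\<in>I. \<Sum>l\<in>I. (\<delta> i)\<^sup>2 * w i l) = - (\<Sum>i\<in>I. \<Sum>l\<in>I. \<delta> i * (lam i - lam l) * w i l)"
    if w: "\<And>i l. i \<in> I \<Longrightarrow> l \<in> I \<Longrightarrow> w i l = - w l i" for w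
  proof -
    have "(\<Sum>i\<in>I. \<Sum>l\<in>I. (\<delta> i)\<^sup>2 * w i l) + (\<Sum>i\<in>I. \<Sum>l\<in>I. \<delta> i * (lam i - lam l) * w i l)
        = (\<Sum>i\<in>I. \<Sum>l\<in>I. \<delta> i * \<delta> l * w i l)"
      unfolding sum.distrib[symmetric] by (intro sum.cong refl) (simp add: \<delta>_def power2_eq_square algebra_simps)
    also have "\<dots> = 0"
    proof (rule sum_antisym_zero)
      fix i l assume "i \<in> I" "l \<in> I"
      then show "\<delta> i * \<delta> l * w i l = - (\<delta> l * \<delta> i * w l i)" using w[of i l] by simp
    qed
    finally show ?thesis by simp
  qed
  have a_sym: "a i l = a l i" and t_anti: "t i l = - t l i" if "i \<in> I" "l \<in> I" for i l
    using sym[OF that] anti[OF that] by (simp_all add: a_def t_def)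
  have T1: "(\<Sum>i\<in>I. \<Sum>l\<in>I. (\<delta> i)\<^sup>2 * (2 * (a i l * t i l)))
      = - (\<Sum>i\<in>I. \<Sum>l\<in>I. \<delta> i * (lam i - lam l) * (2 * (a i l * t i l)))"
    by (rule anti_sum) (use a_sym t_anti in \<open>metis mult_minus_right\<close>)
  have T2: "(\<Sum>i\<in>I. \<Sum>l\<in>I. (\<delta> i)\<^sup>2 * ((lam i - lam l) * (a i l)\<^sup>2))
      = - (\<Sum>i\<in>I. \<Sum>l\<in>I. \<delta> i * (lam i - lam l) * ((lam i - lam l) * (a i l)\<^sup>2))"
  proof (rule anti_sum)
    fix i l assume "i \<in> I" "l \<in> I"
    then show "(lam i - lam l) * (a i l)\<^sup>2 = - ((lam l - lam i) * (a l i)\<^sup>2)"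
      using a_sym[of i l] by (simp add: algebra_simps)
  qed
  \<comment> \<open>Completing the square of
    \<open>\<alpha> * (lam i - lam l) * a i l - t i l\<close>. Its three terms match the double sums
    left over from \<open>T1\<close>, \<open>T2\<close> and the reduced norm of \<open>q\<close>, so
    all of them drop out of the final estimate.\<close>
  have sq: "(\<Sum>i\<in>I. \<Sum>l\<in>I. \<delta> i * (lam i - lam l) * (2 * (a i l * t i l)))
      \<le> \<alpha> * (\<Sum>i\<in>I. \<Sum>l\<in>I. \<delta> i * (lam i - lam l) * ((lam i - lam l) * (a i l)\<^sup>2))
        + (\<Sum>i\<in>I. \<Sum>l\<in>I. \<delta> i * ((t i l)\<^sup>2 / \<alpha>))"
    unfolding sum_distrib_left sum.distrib[symmetric]
  proof (intro sum_mono)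
    fix i l assume "i \<in> I" "l \<in> I"
    let ?y = "(lam i - lam l) * a i l"
    have "0 \<le> (\<alpha> * ?y - t i l)\<^sup>2 / \<alpha>" using \<alpha> by simp
    also have "\<dots> = \<alpha> * ?y\<^sup>2 - 2 * (?y * t i l) + (t i l)\<^sup>2 / \<alpha>"
      using \<alpha> by (simp add: power2_eq_square field_simps)
    finally have "\<delta> i * (2 * (?y * t i l)) \<le> \<delta> i * (\<alpha> * ?y\<^sup>2 + (t i l)\<^sup>2 / \<alpha>)"
      by (intro mult_left_mono \<delta>0[OF \<open>i \<in> I\<close>]) simp
    then show "\<delta> i * (lam i - lam l) * (2 * (a i l * t i l))
        \<le> \<alpha> * (\<delta> i * (lam i - lam l) * ((lam i - lam l) * (a i l)\<^sup>2)) + \<delta> i * ((t i l)\<^sup>2 / \<alpha>)"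
      by (simp add: power2_eq_square algebra_simps)
  qed
  have "(\<Sum>i\<in>I. (\<delta> i)\<^sup>2 + (\<Sum>l\<in>I. (\<delta> i)\<^sup>2 * (2 * (a i l * t i l))))
      \<le> (\<Sum>i\<in>I. \<alpha> * ((\<delta> i)\<^sup>2 * B i) + \<alpha> * (\<Sum>l\<in>I. (\<delta> i)\<^sup>2 * ((lam i - lam l) * (a i l)\<^sup>2))
        + (1 / \<alpha>) * (\<delta> i * (norm (p i))\<^sup>2) - (\<Sum>l\<in>I. \<delta> i * ((t i l)\<^sup>2 / \<alpha>)))"
    by (intro sum_mono main)
  then have "(\<Sum>i\<in>I. (\<delta> i)\<^sup>2) + (\<Sum>i\<in>I. \<Sum>l\<in>I. (\<delta> i)\<^sup>2 * (2 * (a i l * t i l)))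
      \<le> \<alpha> * (\<Sum>i\<in>I. (\<delta> i)\<^sup>2 * B i) + \<alpha> * (\<Sum>i\<in>I. \<Sum>l\<in>I. (\<delta> i)\<^sup>2 * ((lam i - lam l) * (a i l)\<^sup>2))
        + (1 / \<alpha>) * (\<Sum>i\<in>I. \<delta> i * (norm (p i))\<^sup>2) - (\<Sum>i\<in>I. \<Sum>l\<in>I. \<delta> i * ((t i l)\<^sup>2 / \<alpha>))"
    unfolding sum.distrib sum_subtractf sum_distrib_left .
  then have "(\<Sum>i\<in>I. (\<delta> i)\<^sup>2)
      \<le> \<alpha> * (\<Sum>i\<in>I. (\<delta> i)\<^sup>2 * B i) + (1 / \<alpha>) * (\<Sum>i\<in>I. \<delta> i * (norm (p i))\<^sup>2)"
    using sq unfolding T1 T2 by simp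
  then show ?thesis by (simp add: \<delta>_def)
qed

text \<open>After symmetrization the difference of the two sides is a sum of terms \<open>\<delta> i
  * \<delta> l * (s l - s i) * (\<delta> i * s l - \<delta> l * s i)\<close>. Since
  \<open>\<delta>\<close> decreases where \<open>s\<close> increases, the last two factors never
  have opposite signs.\<close>

lemma weighted_chebyshev:
  fixes \<delta> s :: "nat \<Rightarrow> real"
  assumes I: "finite I" and \<delta>: "\<And>i. i \<in> I \<Longrightarrow> \<delta> i \<ge> 0" and s: "\<And>i. i \<in> I \<Longrightarrow> s i \<ge> 0"
    and op: "\<And>i l. i \<in> I \<Longrightarrow> l \<in> I \<Longrightarrow> s i \<le> s l \<Longrightarrow> \<delta> l \<le> \<delta> i"
  shows "(\<Sum>i\<in>I. (\<delta> i)\<^sup>2 * s i) * (\<Sum>i\<in>I. \<delta> i * s i) \<le> (\<Sum>i\<in>I. (\<delta> i)\<^sup>2) * (\<Sum>i\<in>I. \<delta> i * (s i)\<^sup>2)"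
proof -
  let ?w = "\<lambda>i l. (\<delta> i)\<^sup>2 * (\<delta> l * (s l)\<^sup>2) - (\<delta> i)\<^sup>2 * s i * (\<delta> l * s l)"
  have pt: "?w i l + ?w l i \<ge> 0" if "i \<in> I" "l \<in> I" for i l
  proof -
    have "(s l - s i) * (\<delta> i * s l - \<delta> l * s i) \<ge> 0"
    proof (cases "s i \<le> s l")
      case True
      then have "\<delta> l * s i \<le> \<delta> i * s l"
        using op[OF that] \<delta>[of i] s[of i] that by (intro mult_mono) auto
      then show ?thesis using True by simp
    next
      case False
      then have "\<delta> i * s l \<le> \<delta> l * s i"
        using op[OF that(2,1)] \<delta>[of l] s[of l] that by (intro mult_mono) auto
      then show ?thesis using False by (intro mult_nonpos_nonpos) auto
    qed
    then have "\<delta> i * \<delta> l * ((s l - s i) * (\<delta> i * s l - \<delta> l * s i)) \<ge> 0"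
      using \<delta> that by simp
    then show ?thesis by (simp add: power2_eq_square algebra_simps)
  qed
  have "0 \<le> (\<Sum>i\<in>I. \<Sum>l\<in>I. ?w i l + ?w l i)"
    by (intro sum_nonneg pt)
  also have "\<dots> = 2 * (\<Sum>i\<in>I. \<Sum>l\<in>I. ?w i l)"
    unfolding sum.distrib by (subst (2) sum.swap) simp
  finally have "0 \<le> (\<Sum>i\<in>I. \<Sum>l\<in>I. ?w i l)" by simp
  then show ?thesis by (simp add: sum_subtractf sum_product)
qed

subsection \<open>The universal inequality\<close>

theorem corollary4p1:
  fixes \<Omega> :: "'n::finite heis set" and lam :: "nat \<Rightarrow> real" and k :: nat
  assumes "smooth_bounded_domain \<Omega>"
    and "eigenvalue_sequence \<Omega> lam"
    and "k \<ge> 1"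
  shows "(\<Sum>i=1..k. (lam (k + 1) - lam i)\<^sup>2)
    \<le> 4 * (real CARD('n) + 1) / (real CARD('n))\<^sup>2 * (\<Sum>i=1..k. (lam (k + 1) - lam i) * lam i)"
proof -
  have op: "open \<Omega>" and bd: "bounded \<Omega>" using assms(1) by (auto simp: smooth_bounded_domain_def)
  have \<Omega>: "\<Omega> \<in> sets lebesgue" using op by auto
  obtain u where pos: "0 < lam 1" and mono: "\<forall>i\<ge>1. lam i \<le> lam (i + 1)"
    and eig: "\<forall>i\<ge>1. eigenfunction \<Omega> (lam i) (u i)"
    and orth: "\<forall>i\<ge>1. \<forall>j\<ge>1. L2_inner \<Omega> (u i) (u j) = (if i = j then 1 else 0)"
    and all: "\<forall>\<mu> v. eigenfunction \<Omega> \<mu> v \<longrightarrow>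
           (\<exists>c. AE z in lebesgue_on \<Omega>. v z = (\<Sum>i | i \<ge> 1 \<and> lam i = \<mu>. c i * u i z))"
    using assms(2) unfolding eigenvalue_sequence_def by blast
  have uS: "u i \<in> S0_space 2 \<Omega>" and uL: "u i \<in> L2 \<Omega>"
    and uw: "\<forall>\<phi>\<in>test_functions \<Omega>.
        L2_inner \<Omega> (u i) (((\<lambda>f z. - kohn_laplacian f z) ^^ 2) \<phi>) = lam i * L2_inner \<Omega> (u i) \<phi>"
    if "i \<ge> 1" for i
    using eig that unfolding eigenfunction_def S0_space_def S_space_def by blast+
  \<comment> \<open>One jet is fixed for each eigenfunction; its value at \<open>i = 0\<close> is
    arbitrary.\<close>
  define \<xi> where "\<xi> i = (SOME \<xi>. \<xi> \<in> jets \<Omega> \<and> jval \<xi> = L2_class \<Omega> (u i))" for i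
  have \<xi>: "\<xi> i \<in> jets \<Omega>" "jval (\<xi> i) = L2_class \<Omega> (u i)" if "i \<ge> 1" for i
  proof -
    have "\<exists>\<xi>. \<xi> \<in> jets \<Omega> \<and> jval \<xi> = L2_class \<Omega> (u i)"
      using S0_space_jets[OF \<Omega> uS[OF that]] by blast
    from someI_ex[OF this] show "\<xi> i \<in> jets \<Omega>" "jval (\<xi> i) = L2_class \<Omega> (u i)"
      by (simp_all add: \<xi>_def)
  qed
  have eigj: "inner (jlap (\<xi> i)) (jlap \<eta>) = lam i * inner (jval (\<xi> i)) (jval \<eta>)"
    if "i \<ge> 1" "\<eta> \<in> jets \<Omega>" for i \<eta>
    using weak_eigen_jets[OF \<Omega> \<xi>(1)[OF that(1)] uL[OF that(1)] \<xi>(2)[OF that(1), symmetric]]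
      uw[OF that(1)] that(2) by blast
  have orthj: "inner (jval (\<xi> i)) (jval (\<xi> j)) = (if i = j then 1 else 0)" if "i \<ge> 1" "j \<ge> 1" for i j
    using orth that by (simp add: \<xi>(2) L2_inner_eq[OF \<Omega> uL uL])
  let ?I = "{1..k}" and ?n = "real CARD('n)"
  define \<delta> where "\<delta> i = lam (k + 1) - lam i" for i
  define s where "s i = sqrt (lam i)" for i
  define en where "en i = inner (jlap (\<xi> i)) (jval (\<xi> i))" for i
  have \<delta>0: "\<delta> i \<ge> 0" if "i \<in> ?I" for i
    using lam_mono[OF mono, of i "k + 1"] that by (simp add: \<delta>_def)
  have lam_pos: "lam i > 0" if "i \<in> ?I" for i
    using lam_mono[OF mono, of 1 i] pos that by simp
  have s_pos: "s i > 0" "(s i)\<^sup>2 = lam i" if "i \<in> ?I" for i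
    using lam_pos[OF that] by (simp_all add: s_def)
  \<comment> \<open>Testing the weak equation of \<open>\<xi> i\<close> with itself gives
    \<open>norm (L u)^2 = lam i\<close> for the normalized eigenfunction, and Cauchy--Schwarz bounds
    \<open><L u, u>\<close>.\<close>
  have en_le: "en i \<le> s i" if "i \<in> ?I" for i
  proof -
    have n: "norm (jval (\<xi> i)) = 1" using orthj[of i i] that by (simp add: norm_eq_sqrt_inner)
    have "norm (jlap (\<xi> i)) = s i"
      using eigj[of i "\<xi> i"] orthj[of i i] \<xi>(1)[of i] that by (simp add: norm_eq_sqrt_inner s_def)
    then show ?thesis
      using norm_cauchy_schwarz[of "jlap (\<xi> i)" "jval (\<xi> i)"] n by (simp add: en_def)
  qed
  have field: "(\<Sum>i\<in>?I. (\<delta> i)\<^sup>2) \<le> \<alpha> * (\<Sum>i\<in>?I. (\<delta> i)\<^sup>2 * (2 * en i + 4 * (norm (jder j (\<xi> i)))\<^sup>2))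
      + (1 / \<alpha>) * (\<Sum>i\<in>?I. \<delta> i * (norm (jder j (\<xi> i)))\<^sup>2)" if \<alpha>: "\<alpha> > 0" for \<alpha> j
    unfolding \<delta>_def
  proof (rule commutator_inequality[where x = "\<lambda>i. coord_mult \<Omega> j (jval (\<xi> i))"
        and u = "\<lambda>i. jval (\<xi> i)", OF _ _ _ _ _ _ _ \<alpha>])
    let ?c = "coord_mult \<Omega> j"
    note sym = inner_coord_mult[OF bd \<Omega>]
    note jm = jmult_jets[OF bd \<Omega>, of _ j]
    fix i assume i: "i \<in> ?I"
    have i1: "i \<ge> 1" using i by simp
    show "lam i \<le> lam (k + 1)" using \<delta>0[OF i] by (simp add: \<delta>_def)
    \<comment> \<open>Skew-adjointness of the field \<open>X\<close> and the commutator
      \<open>[X, c] = 1\<close> give \<open><X u, c u> = - <X u, c u> - 1\<close>.\<close>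
    show "inner (jder j (\<xi> i)) (?c (jval (\<xi> i))) = - 1 / 2"
    proof -
      have "inner (jder j (\<xi> i)) (?c (jval (\<xi> i))) = - inner (jval (\<xi> i)) (?c (jder j (\<xi> i)) + jval (\<xi> i))"
        using inner_jder[OF \<xi>(1)[OF i1] jm[OF \<xi>(1)[OF i1]], of j] unfolding jval_jmult jder_jmult .
      also have "\<dots> = - inner (?c (jval (\<xi> i))) (jder j (\<xi> i)) - 1"
        unfolding inner_add_right sym[of j "jval (\<xi> i)" "jder j (\<xi> i)", symmetric] using orthj[OF i1 i1] by simp
      also have "inner (?c (jval (\<xi> i))) (jder j (\<xi> i)) = inner (jder j (\<xi> i)) (?c (jval (\<xi> i)))"
        by (rule inner_commute)
      finally show ?thesis by simp
    qed
    let ?a = "\<lambda>l. inner (?c (jval (\<xi> i))) (jval (\<xi> l))"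
    let ?m = "jmult \<Omega> j (\<xi> i)"
    \<comment> \<open>The weak form of the commutator \<open>[L^2, c] = - 2 (L X + X L)\<close>
      applied to \<open>u\<close> and paired with \<open>\<eta>\<close>; it involves no derivative
      of \<open>u\<close> beyond those stored in the jet.\<close>
    define E where "E \<eta> = 2 * (inner (jlap (\<xi> i)) (jder j \<eta>) - inner (jder j (\<xi> i)) (jlap \<eta>))" for \<eta>
    have comm: "inner (jlap ?m) (jlap \<eta>) = lam i * inner (?c (jval (\<xi> i))) (jval \<eta>) + E \<eta>"
      if \<eta>: "\<eta> \<in> jets \<Omega>" for \<eta>
    proof -
      have "inner (?c (jlap (\<xi> i))) (jlap \<eta>) = inner (jlap (\<xi> i)) (jlap (jmult \<Omega> j \<eta>) + 2 *\<^sub>R jder j \<eta>)"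
        by (simp add: jlap_jmult[OF bd \<Omega>] sym)
      also have "\<dots> = lam i * inner (?c (jval (\<xi> i))) (jval \<eta>) + 2 * inner (jlap (\<xi> i)) (jder j \<eta>)"
        by (simp add: inner_add_right eigj[OF i1 jm[OF \<eta>]] jval_jmult sym)
      finally show ?thesis
        by (simp add: jlap_jmult[OF bd \<Omega>] inner_diff_left E_def)
    qed
    define \<zeta> where "\<zeta> = ?m - (\<Sum>l\<in>?I. ?a l *\<^sub>R \<xi> l)"
    have \<zeta>j: "\<zeta> \<in> jets \<Omega>"
      unfolding \<zeta>_def by (intro subspace_diff subspace_sum subspace_scale subspace_jets jm \<xi>(1) i1) auto
    have \<zeta>v: "jval \<zeta> = ?c (jval (\<xi> i)) - (\<Sum>l\<in>?I. ?a l *\<^sub>R jval (\<xi> l))"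
      by (simp add: \<zeta>_def jval_jmult fst_sum)
    have perp: "inner (jval \<zeta>) (jval (\<xi> m)) = 0" if m: "m \<in> ?I" for m
    proof -
      have "(\<Sum>l\<in>?I. ?a l * inner (jval (\<xi> l)) (jval (\<xi> m))) = (\<Sum>l\<in>?I. if l = m then ?a l else 0)"
        using m by (intro sum.cong refl) (auto simp: orthj)
      also have "\<dots> = ?a m" by (subst sum.delta) (use m in auto)
      finally show ?thesis by (simp add: \<zeta>v inner_diff_left inner_sum_left)
    qed
    have "lam (k + 1) * (norm (jval \<zeta>))\<^sup>2 \<le> (norm (jlap \<zeta>))\<^sup>2"
      by (rule eigenvalue_variational[OF op bd mono eig orth all \<xi> \<zeta>j perp])
    also have "(norm (jlap \<zeta>))\<^sup>2 = inner (jlap ?m) (jlap \<zeta>) - (\<Sum>l\<in>?I. ?a l * inner (jlap (\<xi> l)) (jlap \<zeta>))"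
    proof -
      note lin = bounded_linear.linear[OF bounded_linear_jlap]
      have "jlap \<zeta> = jlap ?m - (\<Sum>l\<in>?I. ?a l *\<^sub>R jlap (\<xi> l))"
        by (simp add: \<zeta>_def linear_diff[OF lin] linear_sum[OF lin] linear_cmul[OF lin])
      then have "inner (jlap \<zeta>) (jlap \<zeta>) = inner (jlap ?m - (\<Sum>l\<in>?I. ?a l *\<^sub>R jlap (\<xi> l))) (jlap \<zeta>)"
        by (rule arg_cong)
      then show ?thesis by (simp add: power2_norm_eq_inner inner_diff_left inner_sum_left)
    qed
    also have "(\<Sum>l\<in>?I. ?a l * inner (jlap (\<xi> l)) (jlap \<zeta>)) = 0"
    proof (rule sum.neutral, rule ballI)
      fix l assume l: "l \<in> ?I"
      then show "?a l * inner (jlap (\<xi> l)) (jlap \<zeta>) = 0"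
        using eigj[of l \<zeta>] \<zeta>j perp[OF l] by (simp add: inner_commute[of "jval (\<xi> l)"])
    qed
    \<comment> \<open>The part of \<open>c u\<close> along the first \<open>k\<close> eigenfunctions
      is orthogonal to \<open>\<zeta>\<close>, so \<open>lam i * norm (jval \<zeta>)^2\<close>
      appears. Moved to the left side it produces the factor
      \<open>lam (k + 1) - lam i\<close>.\<close>
    also have "inner (jlap ?m) (jlap \<zeta>) = lam i * (norm (jval \<zeta>))\<^sup>2 + E \<zeta>"
    proof -
      have "inner (?c (jval (\<xi> i))) (jval \<zeta>) = inner (jval \<zeta>) (jval \<zeta>) + (\<Sum>l\<in>?I. ?a l * inner (jval (\<xi> l)) (jval \<zeta>))"
      proof -
        have "?c (jval (\<xi> i)) = jval \<zeta> + (\<Sum>l\<in>?I. ?a l *\<^sub>R jval (\<xi> l))" by (simp add: \<zeta>v)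
        then have "inner (?c (jval (\<xi> i))) (jval \<zeta>) = inner (jval \<zeta> + (\<Sum>l\<in>?I. ?a l *\<^sub>R jval (\<xi> l))) (jval \<zeta>)"
          by (rule arg_cong)
        then show ?thesis by (simp add: inner_add_left inner_sum_left)
      qed
      also have "(\<Sum>l\<in>?I. ?a l * inner (jval (\<xi> l)) (jval \<zeta>)) = 0"
        using perp by (intro sum.neutral ballI) (simp add: inner_commute[of "jval (\<xi> _)"])
      finally show ?thesis by (simp add: comm[OF \<zeta>j] power2_norm_eq_inner)
    qed
    also have "E \<zeta> = E ?m - (\<Sum>l\<in>?I. ?a l * E (\<xi> l))"
    proof -
      have "bounded_linear E"
        unfolding E_def[abs_def]
        by (intro bounded_linear_const_mult bounded_linear_sub
            bounded_linear_compose[OF bounded_linear_inner_right bounded_linear_jder]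
            bounded_linear_compose[OF bounded_linear_inner_right bounded_linear_jlap])
      then have lin: "linear E" by (rule bounded_linear.linear)
      show ?thesis
        by (simp add: \<zeta>_def linear_diff[OF lin] linear_sum[OF lin] linear_cmul[OF lin])
    qed
    \<comment> \<open>The two terms containing \<open>c\<close> cancel because multiplication by
      \<open>c\<close> is symmetric. The commutators \<open>[X, c] = 1\<close> and
      \<open>[L, c] = - 2 X\<close> leave the two displayed terms.\<close>
    also have "E ?m = 2 * en i + 4 * (norm (jder j (\<xi> i)))\<^sup>2"
    proof -
      have "inner (jlap (\<xi> i)) (?c (jder j (\<xi> i))) = inner (jder j (\<xi> i)) (?c (jlap (\<xi> i)))"
        unfolding sym[of j "jlap (\<xi> i)" "jder j (\<xi> i)", symmetric] by (rule inner_commute)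
      then show ?thesis
        unfolding E_def jder_jmult jlap_jmult[OF bd \<Omega>] inner_add_right inner_diff_right
        by (simp add: en_def power2_norm_eq_inner)
    qed
    \<comment> \<open>The pairing of \<open>jlap ?m\<close> with \<open>jlap (\<xi> l)\<close> is
      evaluated twice: by the equation of \<open>\<xi> l\<close> it is \<open>lam l * ?a l\<close>,
      by \<open>comm\<close> it is \<open>lam i * ?a l + E (\<xi> l)\<close>.\<close>
    also have "(\<Sum>l\<in>?I. ?a l * E (\<xi> l)) = - (\<Sum>l\<in>?I. (lam i - lam l) * (?a l)\<^sup>2)"
      unfolding sum_negf[symmetric]
    proof (rule sum.cong[OF refl])
      fix l assume l: "l \<in> ?I"
      then have "inner (jlap ?m) (jlap (\<xi> l)) = lam l * ?a l"
        using eigj[of l ?m] jm[OF \<xi>(1)[OF i1]] by (simp add: inner_commute jval_jmult)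
      then have *: "E (\<xi> l) = (lam l - lam i) * ?a l"
        using comm[OF \<xi>(1), of l] l by (simp add: algebra_simps)
      show "?a l * E (\<xi> l) = - ((lam i - lam l) * (?a l)\<^sup>2)"
        unfolding * by (simp add: power2_eq_square algebra_simps)
    qed
    finally show "(lam (k + 1) - lam i) * (norm (?c (jval (\<xi> i)) - (\<Sum>l\<in>?I. ?a l *\<^sub>R jval (\<xi> l))))\<^sup>2
        \<le> 2 * en i + 4 * (norm (jder j (\<xi> i)))\<^sup>2 + (\<Sum>l\<in>?I. (lam i - lam l) * (?a l)\<^sup>2)"
      unfolding \<zeta>v[symmetric] by (simp add: left_diff_distrib)
    fix l assume l: "l \<in> ?I"
    show "inner (jval (\<xi> i)) (jval (\<xi> l)) = (if i = l then 1 else 0)" using i l by (simp add: orthj)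
    show "inner (?c (jval (\<xi> i))) (jval (\<xi> l)) = inner (?c (jval (\<xi> l))) (jval (\<xi> i))"
      by (metis inner_commute sym)
    show "inner (jder j (\<xi> i)) (jval (\<xi> l)) = - inner (jder j (\<xi> l)) (jval (\<xi> i))"
      using inner_jder[OF \<xi>(1) \<xi>(1), of i l j] i l by (simp add: inner_commute)
  qed simp
  define A where "A = (\<Sum>i\<in>?I. (\<delta> i)\<^sup>2)"
  define P where "P = (\<Sum>i\<in>?I. (\<delta> i)\<^sup>2 * s i)"
  define Q where "Q = (\<Sum>i\<in>?I. \<delta> i * s i)"
  define R where "R = (\<Sum>i\<in>?I. \<delta> i * lam i)"
  have sum_en: "(\<Sum>j\<in>UNIV. (norm (jder j (\<xi> i)))\<^sup>2) = en i" if "i \<in> ?I" for i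
    using inner_jlap[OF \<xi>(1) \<xi>(1), of i i] that by (simp add: en_def power2_norm_eq_inner)
  have main: "2 * ?n * A \<le> \<alpha> * (4 * (?n + 1) * P) + Q / \<alpha>" if \<alpha>: "\<alpha> > 0" for \<alpha>
  proof -
    have "(\<Sum>j\<in>(UNIV :: ('n + 'n) set). A) \<le> (\<Sum>j\<in>UNIV. \<alpha> * (\<Sum>i\<in>?I. (\<delta> i)\<^sup>2 * (2 * en i + 4 * (norm (jder j (\<xi> i)))\<^sup>2))
      + (1 / \<alpha>) * (\<Sum>i\<in>?I. \<delta> i * (norm (jder j (\<xi> i)))\<^sup>2))"
      unfolding A_def by (intro sum_mono field \<alpha>)
    also have "\<dots> = \<alpha> * (\<Sum>i\<in>?I. (\<delta> i)\<^sup>2 * (4 * (?n + 1) * en i)) + (1 / \<alpha>) * (\<Sum>i\<in>?I. \<delta> i * en i)"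
    proof -
      have "(\<Sum>j\<in>(UNIV :: ('n + 'n) set). \<Sum>i\<in>?I. (\<delta> i)\<^sup>2 * (2 * en i + 4 * (norm (jder j (\<xi> i)))\<^sup>2))
          = (\<Sum>i\<in>?I. (\<delta> i)\<^sup>2 * (4 * (?n + 1) * en i))"
      proof (subst sum.swap, intro sum.cong refl)
        fix i assume i: "i \<in> ?I"
        \<comment> \<open>The 2n copies of \<open>2 * en i\<close> give \<open>4 * n * en i\<close>,
          and the squared first derivatives sum to \<open>en i\<close> by \<open>sum_en\<close>,
          adding \<open>4 * en i\<close>.\<close>
        have "(\<Sum>j\<in>(UNIV :: ('n + 'n) set). 2 * en i + 4 * (norm (jder j (\<xi> i)))\<^sup>2) = 4 * (?n + 1) * en i"
          by (simp add: sum.distrib sum_en[OF i] algebra_simps flip: sum_distrib_left)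
        then show "(\<Sum>j\<in>(UNIV :: ('n + 'n) set). (\<delta> i)\<^sup>2 * (2 * en i + 4 * (norm (jder j (\<xi> i)))\<^sup>2))
            = (\<delta> i)\<^sup>2 * (4 * (?n + 1) * en i)"
          by (simp only: sum_distrib_left[symmetric])
      qed
      moreover have "(\<Sum>j\<in>(UNIV :: ('n + 'n) set). \<Sum>i\<in>?I. \<delta> i * (norm (jder j (\<xi> i)))\<^sup>2) = (\<Sum>i\<in>?I. \<delta> i * en i)"
        by (subst sum.swap, intro sum.cong refl) (simp add: sum_en flip: sum_distrib_left)
      ultimately show ?thesis by (simp only: sum.distrib sum_distrib_left[symmetric])
    qed
    also have "\<dots> \<le> \<alpha> * (\<Sum>i\<in>?I. (\<delta> i)\<^sup>2 * (4 * (?n + 1) * s i)) + (1 / \<alpha>) * (\<Sum>i\<in>?I. \<delta> i * s i)"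
      using \<alpha> en_le \<delta>0 by (intro add_mono mult_left_mono sum_mono) auto
    also have "(\<Sum>i\<in>?I. (\<delta> i)\<^sup>2 * (4 * (?n + 1) * s i)) = 4 * (?n + 1) * P"
      by (simp add: P_def sum_distrib_left mult_ac)
    finally show ?thesis by (simp add: Q_def)
  qed
  have R0: "R \<ge> 0"
    unfolding R_def using \<delta>0 lam_pos by (intro sum_nonneg mult_nonneg_nonneg) (auto intro: less_imp_le)
  have n0: "?n > 0" by simp
  have "A \<le> 4 * (?n + 1) / ?n\<^sup>2 * R"
  \<comment> \<open>If all gaps vanish, \<open>P\<close> and \<open>Q\<close> are zero and no
    optimal \<open>\<alpha>\<close> exists, but then the left side is zero as well.\<close>
  proof (cases "\<exists>i\<in>?I. \<delta> i \<noteq> 0")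
    case False
    then have "A = 0" by (simp add: A_def)
    then show ?thesis using R0 n0 by simp
  next
    case True
    then obtain i where i: "i \<in> ?I" "\<delta> i > 0" using \<delta>0 by (metis less_eq_real_def)
    have A: "A > 0" unfolding A_def
      by (rule sum_pos2[OF _ i(1)]) (use i in auto)
    have s0: "s l \<ge> 0" if "l \<in> ?I" for l using s_pos(1)[OF that] by simp
    have P: "P > 0" unfolding P_def
    proof (rule sum_pos2[OF _ i(1)])
      show "0 < (\<delta> i)\<^sup>2 * s i" using i s_pos(1)[OF i(1)] by simp
      show "0 \<le> (\<delta> l)\<^sup>2 * s l" if "l \<in> ?I" for l using s0[OF that] by simp
    qed simp
    have Q: "Q > 0" unfolding Q_def
    proof (rule sum_pos2[OF _ i(1)])
      show "0 < \<delta> i * s i" using i s_pos(1)[OF i(1)] by simp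
      show "0 \<le> \<delta> l * s l" if "l \<in> ?I" for l using s0[OF that] \<delta>0[OF that] by simp
    qed simp
    define X where "X = 4 * (?n + 1) * P"
    have X: "X > 0" using P n0 by (simp add: X_def)
    \<comment> \<open>This value balances the two terms, \<open>\<alpha> * X = Q / \<alpha>\<close>,
      and so minimizes the right side of \<open>main\<close>; squaring yields
      \<open>n^2 * A^2 \<le> X * Q\<close>.\<close>
    define \<alpha> where "\<alpha> = sqrt (Q / X)"
    have \<alpha>: "\<alpha> > 0" "\<alpha>\<^sup>2 = Q / X" using Q X by (simp_all add: \<alpha>_def)
    have "2 * ?n * A \<le> \<alpha> * X + Q / \<alpha>" using main[OF \<alpha>(1)] by (simp add: X_def)
    also have "Q / \<alpha> = \<alpha> * X"
      using \<alpha> X by (simp add: field_simps power2_eq_square)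
    finally have "?n * A \<le> \<alpha> * X" by (simp add: mult.commute)
    then have "(?n * A)\<^sup>2 \<le> (\<alpha> * X)\<^sup>2" using A n0 by (intro power_mono) auto
    also have "\<dots> = 4 * (?n + 1) * (P * Q)"
      unfolding power_mult_distrib \<alpha>(2) using X by (simp add: X_def power2_eq_square)
    also have "P * Q \<le> A * R"
    proof -
      have "(\<Sum>i\<in>?I. (\<delta> i)\<^sup>2 * s i) * (\<Sum>i\<in>?I. \<delta> i * s i) \<le> (\<Sum>i\<in>?I. (\<delta> i)\<^sup>2) * (\<Sum>i\<in>?I. \<delta> i * (s i)\<^sup>2)"
      proof (rule weighted_chebyshev)
        show "s i \<ge> 0" if "i \<in> ?I" for i using s_pos(1)[OF that] by simp
        show "\<delta> l \<le> \<delta> i" if "i \<in> ?I" "l \<in> ?I" "s i \<le> s l" for i l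
          using that(3) by (simp add: \<delta>_def s_def)
      qed (use \<delta>0 in auto)
      also have "(\<Sum>i\<in>?I. \<delta> i * (s i)\<^sup>2) = R"
        unfolding R_def by (intro sum.cong refl) (simp add: s_pos(2))
      finally show ?thesis by (simp add: P_def Q_def A_def)
    qed
    finally have "A * (?n\<^sup>2 * A) \<le> A * (4 * (?n + 1) * R)"
      using n0 by (simp add: power2_eq_square mult_ac)
    then have "?n\<^sup>2 * A \<le> 4 * (?n + 1) * R" using A by (rule mult_left_le_imp_le)
    then show ?thesis using n0 by (simp add: field_simps)
  qed
  then show ?thesis by (simp add: A_def R_def \<delta>_def)
qed

end
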